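(* Let $\nabla$ be a torsion-free $A$-anisotropic connection whose vertical derivative $P$ satisfies $P_v(v,v,u)=0$ for all $v\in A$ and $u\in T_{\pi(v)}M$, and let $\hat\nabla$ be any other torsion-free $A$-anisotropic connection whose difference tensor $Q_v(X,Y)=\hat\nabla^v_XY-\nabla^v_XY$ with respect to $\nabla$ satisfies $Q_v(v,u)=0$ for all $v\in A$ and $u\in T_{\pi(v)}M$. Then: (i) for every $v\in A$ and $u,w\in T_{\pi(v)}M$, $(\partial^\nu Q)_v(v,u,w)=-Q_v(w,u)$; (ii) the vertical derivative $\hat P$ of $\hat\nabla$ satisfies $\hat P_v(v,v,u)=0$ for all $v\in A$ and $u\in T_{\pi(v)}M$; (iii) $\hat\nabla$ has the same curvature operator and the same Jacobi equation as $\nabla$: along every auto-parallel curve $\gamma$, $\hat R_{\dot\gamma}(\dot\gamma,U)\dot\gamma=R_{\dot\gamma}(\dot\gamma,U)\dot\gamma$ for every vector field $U$ along $\gamma$, and the equations $(\hat D^{\dot\gamma}_\gamma)^2J=\hat R_{\dot\gamma}(\dot\gamma,J)\dot\gamma$ and $(D^{\dot\gamma}_\gamma)^2J=R_{\dot\gamma}(\dot\gamma,J)\dot\gamma$, satisfied by the Jacobi fields $J$ along $\gamma$ of $\hat\nabla$ and of $\nabla$ respectively, coincide. Here $R,\hat R$ are the curvature tensors and $D_\gamma,\hat D_\gamma$ the induced covariant derivatives of $\nabla,\hat\nabla$.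
   Context: $M$ is a smooth manifold, $\pi:TM\to M$ its tangent bundle, $\mathbf 0$ its zero section, $A\subset TM\setminus\mathbf 0$ an open subset with $\pi(A)=M$, $\mathcal F(\cdot)$ denotes smooth real functions, $\mathfrak X(\cdot)$ smooth vector fields. $\mathfrak T^1_0(M,A)$ is the set of smooth maps $v\in A\mapsto\mathcal X_v\in T_{\pi(v)}M$; vector fields $X$ on $M$ are regarded as such maps via $v\mapsto X_{\pi(v)}$. An $A$-anisotropic tensor $T$ of type $(1,s)$ amounts to multilinear maps $T_v:(T_{\pi(v)}M)^s\to T_{\pi(v)}M$ depending smoothly on $v\in A$. Its vertical derivative is $(\partial^\nu T)_v(x_1,\ldots,x_s,z)=\frac{d}{dt}T_{v+tz}(x_1,\ldots,x_s)|_{t=0}$. A vector field $V$ on an open $\Omega\subset M$ is $A$-admissible if $V_p\in A$ for all $p\in\Omega$; it extends $v$ if $V_{\pi(v)}=v$; $(\mathcal Y_V)_p=\mathcal Y_{V_p}$. An $A$-anisotropic connection is a map $\nabla:A\times\mathfrak X(M)\times\mathfrak X(M)\to TM$, $(v,X,Y)\mapsto\nabla^v_XY\in T_{\pi(v)}M$, additive in $Y$, with $\nabla^v_X(fY)=X_{\pi(v)}(f)Y_{\pi(v)}+f(\pi(v))\nabla^v_XY$, $\nabla^v_{fX+hY}Z=f(\pi(v))\nabla^v_XZ+h(\pi(v))\nabla^v_YZ$ for $f,h\in\mathcal F(M)$, and with $\nabla_XY\in\mathfrak T^1_0(M,A)$ (smoothness in $v$). The difference of two $A$-anisotropic connections is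 an $A$-anisotropic tensor. For $\mathcal Y\in\mathfrak T^1_0(M,A)$, $\nabla^v_X\mathcal Y=\nabla^v_X(\mathcal Y_V)-(\partial^\nu\mathcal Y)_v(\nabla^v_XV)$ for any local $A$-admissible extension $V$ of $v$ (independent of $V$). Torsion: $\mathcal T_v(X,Y)=\nabla^v_XY-\nabla^v_YX-[X,Y]_{\pi(v)}$; torsion-free means $\mathcal T=0$. Vertical derivative of $\nabla$: $P_v(X,Y,Z)=\frac{\partial}{\partial t}\big(\nabla^{v+tZ}_XY\big)|_{t=0}$. Curvature tensor: $R_v(X,Y)Z=\nabla^v_X(\nabla_YZ)-\nabla^v_Y(\nabla_XZ)-\nabla^v_{[X,Y]}Z$ for $X,Y,Z\in\mathfrak X(M)$. These are $A$-anisotropic tensors. The covariant derivative along a smooth curve $\gamma$ induced by $\nabla$ is $D^v_\gamma X=\big(\dot X^k(t_0)+\dot\gamma^i(t_0)X^j(t_0)\Gamma^k_{ij}(v)\big)\partial_k$ for $v\in A$ with $\pi(v)=\gamma(t_0)$ and $X$ a vector field along $\gamma$, where $\nabla^v_{\partial_i}\partial_j=\Gamma^k_{ij}(v)\partial_k$ in a chart. For $V$ along $\gamma$ with values in $A$, $(D^V_\gamma X)(t)=D^{V(t)}_\gamma X$. A smooth curve $\gamma:[a,b]\to M$ is auto-parallel if $\dot\gamma(t)\in A$ for all $t$ and $D^{\dot\gamma}_\gamma\dot\gamma=0$ (when $Q_v(v,v)=0$ for all $v\in A$, $\nabla$ and $\hat\nabla$ have the same auto-parallel curves). A Jacobi field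 along an auto-parallel curve $\gamma$ is the variational field $J(t)=\partial_s\Lambda(t,0)$ of a smooth variation $\Lambda:[a,b]\times(-\varepsilon,\varepsilon)\to M$ of $\gamma$ all of whose curves $\Lambda(\cdot,s)$ are auto-parallel. The curvature operator of an auto-parallel curve $\gamma$ is $R_\gamma(U)=R_{\dot\gamma}(\dot\gamma,U)\dot\gamma$ on vector fields $U$ along $\gamma$. *)

theory Defs
  imports "HOL-Analysis.Analysis"
begin

text \<open>
  The manifold \<open>M\<close> is a whole type \<open>'m\<close> (Hausdorff and second countable by its type classes) with
  a smooth atlas modelled on a Euclidean space \<open>'e\<close>.  Dimension 0 is thereby left out; there
  \<open>TM\<close> minus the zero section is empty and no set \<open>A\<close> as below projects onto \<open>M\<close>.

  Every point \<open>p\<close> has a preferred chart \<open>chart_at At p\<close>, and a tangent vector at \<open>p\<close> is stored as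
  its vector of components in that chart.  So every fibre of \<open>TM\<close> is a copy of \<open>'e\<close>, with its
  vector space structure, and the set underlying \<open>TM\<close> is \<open>'m \<times> 'e\<close>.  Components in another
  chart are obtained with the Jacobian of the transition map.  The topology and the smooth
  structure of \<open>TM\<close> are those of \<open>tangent_atlas\<close>, not those of the product: the preferred chart
  need not depend continuously on the point.

  A map \<open>v \<mapsto> Y v \<in> T_{\<pi>(v)}M\<close> or \<open>p \<mapsto> X p \<in> T_pM\<close> is given by its fibre component in \<open>'e\<close>.
\<close>

section \<open>Smooth maps and manifolds\<close>

text \<open>Meaningful for open \<open>S\<close>.\<close>

primrec Ck_on :: "nat \<Rightarrow> 'a::real_normed_vector set \<Rightarrow> ('a \<Rightarrow> 'b::real_normed_vector) \<Rightarrow> bool" where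
  "Ck_on 0 S f \<longleftrightarrow> continuous_on S f"
| "Ck_on (Suc n) S f \<longleftrightarrow> (\<forall>x\<in>S. f differentiable (at x)) \<and>
     (\<forall>h. Ck_on n S (\<lambda>x. frechet_derivative f (at x) h))"

definition smooth_on :: "'a::real_normed_vector set \<Rightarrow> ('a \<Rightarrow> 'b::real_normed_vector) \<Rightarrow> bool" where
  "smooth_on S f \<longleftrightarrow> (\<forall>n. Ck_on n S f)"

text \<open>A chart is its domain together with the coordinate map; only the values of the map on the
  domain matter.\<close>

type_synonym ('m, 'e) chart = "'m set \<times> ('m \<Rightarrow> 'e)"

definition chart_inv :: "('m, 'e) chart \<Rightarrow> 'e \<Rightarrow> 'm" where
  "chart_inv c = inv_into (fst c) (snd c)"

definition smooth_atlas ::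
  "('m::{t2_space,second_countable_topology}, 'e::euclidean_space) chart set \<Rightarrow> bool" where
  "smooth_atlas At \<longleftrightarrow>
     (\<forall>c\<in>At. open (fst c) \<and> open (snd c ` fst c) \<and>
        homeomorphism (fst c) (snd c ` fst c) (snd c) (chart_inv c)) \<and>
     (\<Union>c\<in>At. fst c) = UNIV \<and>
     (\<forall>c\<in>At. \<forall>c'\<in>At. smooth_on (snd c ` (fst c \<inter> fst c')) (snd c' \<circ> chart_inv c))"

definition atlas_open :: "('n, 'f::topological_space) chart set \<Rightarrow> 'n set \<Rightarrow> bool" where
  "atlas_open At S \<longleftrightarrow> (\<forall>c\<in>At. open (snd c ` (S \<inter> fst c)))"

definition smooth_fun :: "('m, 'e::real_normed_vector) chart set \<Rightarrow> ('m \<Rightarrow> real) \<Rightarrow> bool" where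
  "smooth_fun At f \<longleftrightarrow> (\<forall>c\<in>At. smooth_on (snd c ` fst c) (f \<circ> chart_inv c))"

text \<open>Smoothness of a map from an arbitrary subset of a Euclidean space into a manifold: locally,
  in a chart, it is the restriction of a smooth map defined on an open set.  This covers curves
  on \<open>[a,b]\<close> and variations on \<open>[a,b] \<times> (-\<epsilon>,\<epsilon>)\<close>.\<close>

definition smooth_map_into ::
  "('n, 'f::real_normed_vector) chart set \<Rightarrow> 'a::real_normed_vector set \<Rightarrow> ('a \<Rightarrow> 'n) \<Rightarrow> bool" where
  "smooth_map_into At S f \<longleftrightarrow>
     (\<forall>x\<in>S. \<exists>c\<in>At. \<exists>W G. open W \<and> x \<in> W \<and> smooth_on W G \<and>
        f ` (S \<inter> W) \<subseteq> fst c \<and> (\<forall>y\<in>S \<inter> W. snd c (f y) = G y))"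

section \<open>The tangent bundle\<close>

definition chart_at :: "('m, 'e) chart set \<Rightarrow> 'm \<Rightarrow> ('m, 'e) chart" where
  "chart_at At p = (SOME c. c \<in> At \<and> p \<in> fst c)"

definition tangent_trans ::
  "('m, 'e::real_normed_vector) chart \<Rightarrow> ('m, 'e) chart \<Rightarrow> 'm \<Rightarrow> 'e \<Rightarrow> 'e" where
  "tangent_trans c c' p = frechet_derivative (snd c' \<circ> chart_inv c) (at (snd c p))"

definition to_chart ::
  "('m, 'e::real_normed_vector) chart set \<Rightarrow> ('m, 'e) chart \<Rightarrow> 'm \<Rightarrow> 'e \<Rightarrow> 'e" where
  "to_chart At c p = tangent_trans (chart_at At p) c p"

definition from_chart ::
  "('m, 'e::real_normed_vector) chart set \<Rightarrow> ('m, 'e) chart \<Rightarrow> 'm \<Rightarrow> 'e \<Rightarrow> 'e" where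
  "from_chart At c p = tangent_trans c (chart_at At p) p"

definition tangent_chart ::
  "('m, 'e::real_normed_vector) chart set \<Rightarrow> ('m, 'e) chart \<Rightarrow> ('m \<times> 'e, 'e \<times> 'e) chart" where
  "tangent_chart At c = (fst c \<times> UNIV, \<lambda>v. (snd c (fst v), to_chart At c (fst v) (snd v)))"

definition tangent_atlas ::
  "('m, 'e::real_normed_vector) chart set \<Rightarrow> ('m \<times> 'e, 'e \<times> 'e) chart set" where
  "tangent_atlas At = tangent_chart At ` At"

definition vshift :: "'m \<times> 'e::real_vector \<Rightarrow> real \<Rightarrow> 'e \<Rightarrow> 'm \<times> 'e" where
  "vshift v t z = (fst v, snd v + t *\<^sub>R z)"

definition aniso_domain :: "('m, 'e::real_normed_vector) chart set \<Rightarrow> ('m \<times> 'e) set \<Rightarrow> bool" where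
  "aniso_domain At A \<longleftrightarrow>
     atlas_open (tangent_atlas At) A \<and> (\<forall>v\<in>A. snd v \<noteq> 0) \<and> fst ` A = UNIV"

section \<open>Vector fields\<close>

definition local_rep ::
  "('m, 'e::real_normed_vector) chart set \<Rightarrow> ('m, 'e) chart \<Rightarrow> ('m \<Rightarrow> 'e) \<Rightarrow> 'e \<Rightarrow> 'e" where
  "local_rep At c X = (\<lambda>x. to_chart At c (chart_inv c x) (X (chart_inv c x)))"

definition vector_field_on ::
  "('m, 'e::real_normed_vector) chart set \<Rightarrow> 'm set \<Rightarrow> ('m \<Rightarrow> 'e) \<Rightarrow> bool" where
  "vector_field_on At \<Omega> X \<longleftrightarrow> (\<forall>c\<in>At. smooth_on (snd c ` (\<Omega> \<inter> fst c)) (local_rep At c X))"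

abbreviation vector_field ::
  "('m, 'e::real_normed_vector) chart set \<Rightarrow> ('m \<Rightarrow> 'e) \<Rightarrow> bool" where
  "vector_field At X \<equiv> vector_field_on At UNIV X"

definition dir_deriv ::
  "('m, 'e::real_normed_vector) chart set \<Rightarrow> ('m \<Rightarrow> 'e) \<Rightarrow> ('m \<Rightarrow> real) \<Rightarrow> 'm \<Rightarrow> real" where
  "dir_deriv At X f p =
     (let c = chart_at At p in frechet_derivative (f \<circ> chart_inv c) (at (snd c p)) (X p))"

text \<open>\<open>[X,Y]\<^sup>k = X\<^sup>i \<partial>\<^sub>iY\<^sup>k - Y\<^sup>i \<partial>\<^sub>iX\<^sup>k\<close>\<close>

definition lie_bracket ::
  "('m, 'e::real_normed_vector) chart set \<Rightarrow> ('m \<Rightarrow> 'e) \<Rightarrow> ('m \<Rightarrow> 'e) \<Rightarrow> 'm \<Rightarrow> 'e" where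
  "lie_bracket At X Y p =
     (let c = chart_at At p; X' = local_rep At c X; Y' = local_rep At c Y; x = snd c p
      in from_chart At c p
           (frechet_derivative Y' (at x) (X' x) - frechet_derivative X' (at x) (Y' x)))"

definition field_through ::
  "('m, 'e::real_normed_vector) chart set \<Rightarrow> 'm \<Rightarrow> 'e \<Rightarrow> 'm \<Rightarrow> 'e" where
  "field_through At p x = (SOME X. vector_field At X \<and> X p = x)"

text \<open>A vector field on the whole of \<open>M\<close> with the same germ at \<open>p\<close> as the locally defined \<open>X\<close>.
  It serves to evaluate a connection, which is a local operator, on locally defined fields.\<close>

definition globalize ::
  "('m::topological_space, 'e::real_normed_vector) chart set \<Rightarrow> 'm \<Rightarrow> ('m \<Rightarrow> 'e) \<Rightarrow> 'm \<Rightarrow> 'e" where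
  "globalize At p X =
     (SOME X'. vector_field At X' \<and> (\<exists>W. open W \<and> p \<in> W \<and> (\<forall>q\<in>W. X' q = X q)))"

section \<open>Anisotropic fields and connections\<close>

text \<open>The set \<open>\<TT>\<^sup>1\<^sub>0(M,A)\<close>.\<close>

definition aniso_field ::
  "('m, 'e::real_normed_vector) chart set \<Rightarrow> ('m \<times> 'e) set \<Rightarrow> ('m \<times> 'e \<Rightarrow> 'e) \<Rightarrow> bool" where
  "aniso_field At A Y \<longleftrightarrow>
     (\<forall>c\<in>At. let T = tangent_chart At c in
        smooth_on (snd T ` (A \<inter> fst T))
          (\<lambda>x. to_chart At c (fst (chart_inv T x)) (Y (chart_inv T x))))"

definition vert_deriv :: "('m \<times> 'e::real_normed_vector \<Rightarrow> 'e) \<Rightarrow> 'm \<times> 'e \<Rightarrow> 'e \<Rightarrow> 'e" where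
  "vert_deriv Y v z = vector_derivative (\<lambda>t. Y (vshift v t z)) (at 0)"

definition vert_deriv2 ::
  "('m \<times> 'e::real_normed_vector \<Rightarrow> 'e \<Rightarrow> 'e \<Rightarrow> 'e) \<Rightarrow> 'm \<times> 'e \<Rightarrow> 'e \<Rightarrow> 'e \<Rightarrow> 'e \<Rightarrow> 'e" where
  "vert_deriv2 T v x y z = vector_derivative (\<lambda>t. T (vshift v t z) x y) (at 0)"

type_synonym ('m, 'e) conn = "'m \<times> 'e \<Rightarrow> ('m \<Rightarrow> 'e) \<Rightarrow> ('m \<Rightarrow> 'e) \<Rightarrow> 'e"

definition aniso_connection ::
  "('m, 'e::real_normed_vector) chart set \<Rightarrow> ('m \<times> 'e) set \<Rightarrow> ('m, 'e) conn \<Rightarrow> bool" where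
  "aniso_connection At A N \<longleftrightarrow>
     (\<forall>v\<in>A. \<forall>X Y Z. vector_field At X \<and> vector_field At Y \<and> vector_field At Z \<longrightarrow>
        N v X (\<lambda>p. Y p + Z p) = N v X Y + N v X Z) \<and>
     (\<forall>v\<in>A. \<forall>f X Y. smooth_fun At f \<and> vector_field At X \<and> vector_field At Y \<longrightarrow>
        N v X (\<lambda>p. f p *\<^sub>R Y p) =
          dir_deriv At X f (fst v) *\<^sub>R Y (fst v) + f (fst v) *\<^sub>R N v X Y) \<and>
     (\<forall>v\<in>A. \<forall>f h X Y Z. smooth_fun At f \<and> smooth_fun At h \<and>
          vector_field At X \<and> vector_field At Y \<and> vector_field At Z \<longrightarrow>
        N v (\<lambda>p. f p *\<^sub>R X p + h p *\<^sub>R Y p) Z = f (fst v) *\<^sub>R N v X Z + h (fst v) *\<^sub>R N v Y Z) \<and>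
     (\<forall>X Y. vector_field At X \<and> vector_field At Y \<longrightarrow> aniso_field At A (\<lambda>v. N v X Y))"

definition torsion ::
  "('m, 'e::real_normed_vector) chart set \<Rightarrow> ('m, 'e) conn \<Rightarrow> ('m, 'e) conn" where
  "torsion At N v X Y = N v X Y - N v Y X - lie_bracket At X Y (fst v)"

definition torsion_free ::
  "('m, 'e::real_normed_vector) chart set \<Rightarrow> ('m \<times> 'e) set \<Rightarrow> ('m, 'e) conn \<Rightarrow> bool" where
  "torsion_free At A N \<longleftrightarrow>
     (\<forall>v\<in>A. \<forall>X Y. vector_field At X \<and> vector_field At Y \<longrightarrow> torsion At N v X Y = 0)"

text \<open>The next two tensors, and the curvature below, are first defined on vector fields.  Being
  \<open>\<F>(M)\<close>-multilinear they depend only on the values of the fields at \<open>\<pi>(v)\<close>; on vectors they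
  are evaluated through \<open>field_through\<close>.\<close>

definition difference_tensor ::
  "('m, 'e::real_normed_vector) chart set \<Rightarrow> ('m, 'e) conn \<Rightarrow> ('m, 'e) conn \<Rightarrow>
     'm \<times> 'e \<Rightarrow> 'e \<Rightarrow> 'e \<Rightarrow> 'e" where
  "difference_tensor At N' N v x y =
     (let X = field_through At (fst v) x; Y = field_through At (fst v) y in N' v X Y - N v X Y)"

definition conn_vert_deriv ::
  "('m, 'e::real_normed_vector) chart set \<Rightarrow> ('m, 'e) conn \<Rightarrow>
     'm \<times> 'e \<Rightarrow> 'e \<Rightarrow> 'e \<Rightarrow> 'e \<Rightarrow> 'e" where
  "conn_vert_deriv At N v x y z =
     (let X = field_through At (fst v) x; Y = field_through At (fst v) y
      in vector_derivative (\<lambda>t. N (vshift v t z) X Y) (at 0))"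

definition admissible_extension ::
  "('m::topological_space, 'e::real_normed_vector) chart set \<Rightarrow> ('m \<times> 'e) set \<Rightarrow>
     'm \<times> 'e \<Rightarrow> ('m \<Rightarrow> 'e) \<Rightarrow> bool" where
  "admissible_extension At A v V \<longleftrightarrow>
     V (fst v) = snd v \<and>
     (\<exists>\<Omega>. open \<Omega> \<and> fst v \<in> \<Omega> \<and> vector_field_on At \<Omega> V \<and> (\<forall>p\<in>\<Omega>. (p, V p) \<in> A))"

text \<open>\<open>\<nabla>\<^sup>v\<^sub>X \<Y>\<close> for \<open>\<Y> \<in> \<TT>\<^sup>1\<^sub>0(M,A)\<close>; the value does not depend on the extension \<open>V\<close> of \<open>v\<close>.\<close>

definition conn_aniso ::
  "('m::topological_space, 'e::real_normed_vector) chart set \<Rightarrow> ('m \<times> 'e) set \<Rightarrow> ('m, 'e) conn \<Rightarrow>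
     'm \<times> 'e \<Rightarrow> ('m \<Rightarrow> 'e) \<Rightarrow> ('m \<times> 'e \<Rightarrow> 'e) \<Rightarrow> 'e" where
  "conn_aniso At A N v X Y =
     (let V = (SOME V. admissible_extension At A v V)
      in N v X (globalize At (fst v) (\<lambda>p. Y (p, V p)))
         - vert_deriv Y v (N v X (globalize At (fst v) V)))"

definition curvature_on_fields ::
  "('m::topological_space, 'e::real_normed_vector) chart set \<Rightarrow> ('m \<times> 'e) set \<Rightarrow> ('m, 'e) conn \<Rightarrow>
     'm \<times> 'e \<Rightarrow> ('m \<Rightarrow> 'e) \<Rightarrow> ('m \<Rightarrow> 'e) \<Rightarrow> ('m \<Rightarrow> 'e) \<Rightarrow> 'e" where
  "curvature_on_fields At A N v X Y Z =
     conn_aniso At A N v X (\<lambda>w. N w Y Z) - conn_aniso At A N v Y (\<lambda>w. N w X Z)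
     - N v (lie_bracket At X Y) Z"

text \<open>\<open>curvature At A N v x y z\<close> is \<open>R\<^sub>v(x,y)z\<close>.\<close>

definition curvature ::
  "('m::topological_space, 'e::real_normed_vector) chart set \<Rightarrow> ('m \<times> 'e) set \<Rightarrow> ('m, 'e) conn \<Rightarrow>
     'm \<times> 'e \<Rightarrow> 'e \<Rightarrow> 'e \<Rightarrow> 'e \<Rightarrow> 'e" where
  "curvature At A N v x y z =
     curvature_on_fields At A N v
       (field_through At (fst v) x) (field_through At (fst v) y) (field_through At (fst v) z)"

section \<open>Curves\<close>

text \<open>Derivatives of curves are taken within the parameter set \<open>S\<close>, hence are one-sided at the end
  points of an interval.  A field \<open>X\<close> along \<open>\<gamma>\<close> is given by its fibre components
  \<open>X t \<in> T_{\<gamma>(t)}M\<close>.\<close>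

definition velocity ::
  "('m, 'e::real_normed_vector) chart set \<Rightarrow> real set \<Rightarrow> (real \<Rightarrow> 'm) \<Rightarrow> real \<Rightarrow> 'e" where
  "velocity At S \<gamma> t = vector_derivative (\<lambda>\<tau>. snd (chart_at At (\<gamma> t)) (\<gamma> \<tau>)) (at t within S)"

definition field_along ::
  "('m, 'e::real_normed_vector) chart set \<Rightarrow> real set \<Rightarrow> (real \<Rightarrow> 'm) \<Rightarrow> (real \<Rightarrow> 'e) \<Rightarrow> bool" where
  "field_along At S \<gamma> X \<longleftrightarrow> smooth_map_into (tangent_atlas At) S (\<lambda>t. (\<gamma> t, X t))"

definition coord_field ::
  "('m, 'e::real_normed_vector) chart set \<Rightarrow> ('m, 'e) chart \<Rightarrow> 'e \<Rightarrow> 'm \<Rightarrow> 'e" where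
  "coord_field At c b = (\<lambda>p. from_chart At c p b)"

definition christoffel ::
  "('m::topological_space, 'e::euclidean_space) chart set \<Rightarrow> ('m, 'e) conn \<Rightarrow> ('m, 'e) chart \<Rightarrow>
     'm \<times> 'e \<Rightarrow> 'e \<Rightarrow> 'e \<Rightarrow> 'e \<Rightarrow> real" where
  "christoffel At N c v i j k =
     to_chart At c (fst v)
       (N v (globalize At (fst v) (coord_field At c i)) (globalize At (fst v) (coord_field At c j)))
     \<bullet> k"

text \<open>\<open>D\<^sup>v\<^sub>\<gamma> X\<close> at the parameter \<open>t\<close>, for \<open>v\<close> over \<open>\<gamma>(t)\<close>.  The value does not depend on the chart
  around \<open>\<gamma>(t)\<close> used to compute it.\<close>

definition cov_along_at ::
  "('m::topological_space, 'e::euclidean_space) chart set \<Rightarrow> ('m, 'e) conn \<Rightarrow> real set \<Rightarrow>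
     (real \<Rightarrow> 'm) \<Rightarrow> 'm \<times> 'e \<Rightarrow> (real \<Rightarrow> 'e) \<Rightarrow> real \<Rightarrow> 'e" where
  "cov_along_at At N S \<gamma> v X t =
     (let c = chart_at At (\<gamma> t);
          X' = (\<lambda>\<tau>. to_chart At c (\<gamma> \<tau>) (X \<tau>));
          dX = vector_derivative X' (at t within S);
          d\<gamma> = vector_derivative (\<lambda>\<tau>. snd c (\<gamma> \<tau>)) (at t within S)
      in \<Sum>k\<in>Basis.
           (dX \<bullet> k + (\<Sum>i\<in>Basis. \<Sum>j\<in>Basis. (d\<gamma> \<bullet> i) * (X' t \<bullet> j) * christoffel At N c v i j k))
           *\<^sub>R coord_field At c k (\<gamma> t))"

text \<open>\<open>D\<^sup>V\<^sub>\<gamma> X\<close>\<close>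

definition cov_along ::
  "('m::topological_space, 'e::euclidean_space) chart set \<Rightarrow> ('m, 'e) conn \<Rightarrow> real set \<Rightarrow>
     (real \<Rightarrow> 'm) \<Rightarrow> (real \<Rightarrow> 'e) \<Rightarrow> (real \<Rightarrow> 'e) \<Rightarrow> real \<Rightarrow> 'e" where
  "cov_along At N S \<gamma> V X = (\<lambda>t. cov_along_at At N S \<gamma> (\<gamma> t, V t) X t)"

definition autoparallel ::
  "('m::topological_space, 'e::euclidean_space) chart set \<Rightarrow> ('m \<times> 'e) set \<Rightarrow> ('m, 'e) conn \<Rightarrow>
     real \<Rightarrow> real \<Rightarrow> (real \<Rightarrow> 'm) \<Rightarrow> bool" where
  "autoparallel At A N a b \<gamma> \<longleftrightarrow>
     a < b \<and> smooth_map_into At {a..b} \<gamma> \<and>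
     (\<forall>t\<in>{a..b}. (\<gamma> t, velocity At {a..b} \<gamma> t) \<in> A) \<and>
     (\<forall>t\<in>{a..b}. cov_along At N {a..b} \<gamma> (velocity At {a..b} \<gamma>) (velocity At {a..b} \<gamma>) t = 0)"

definition jacobi_field ::
  "('m::topological_space, 'e::euclidean_space) chart set \<Rightarrow> ('m \<times> 'e) set \<Rightarrow> ('m, 'e) conn \<Rightarrow>
     real \<Rightarrow> real \<Rightarrow> (real \<Rightarrow> 'm) \<Rightarrow> (real \<Rightarrow> 'e) \<Rightarrow> bool" where
  "jacobi_field At A N a b \<gamma> J \<longleftrightarrow>
     autoparallel At A N a b \<gamma> \<and>
     (\<exists>\<epsilon> > 0. \<exists>\<Lambda>. smooth_map_into At ({a..b} \<times> {-\<epsilon><..<\<epsilon>}) \<Lambda> \<and>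
        (\<forall>t\<in>{a..b}. \<Lambda> (t, 0) = \<gamma> t) \<and>
        (\<forall>s\<in>{-\<epsilon><..<\<epsilon>}. autoparallel At A N a b (\<lambda>t. \<Lambda> (t, s))) \<and>
        (\<forall>t\<in>{a..b}. J t = velocity At {-\<epsilon><..<\<epsilon>} (\<lambda>s. \<Lambda> (t, s)) 0))"

text \<open>\<open>R\<^sub>\<gamma>(U) = R_{\<gamma>'}(\<gamma>',U)\<gamma>'\<close>\<close>

definition curvature_operator ::
  "('m::topological_space, 'e::real_normed_vector) chart set \<Rightarrow> ('m \<times> 'e) set \<Rightarrow> ('m, 'e) conn \<Rightarrow>
     real \<Rightarrow> real \<Rightarrow> (real \<Rightarrow> 'm) \<Rightarrow> (real \<Rightarrow> 'e) \<Rightarrow> real \<Rightarrow> 'e" where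
  "curvature_operator At A N a b \<gamma> U t =
     (let w = velocity At {a..b} \<gamma> t in curvature At A N (\<gamma> t, w) w (U t) w)"

definition second_cov_along ::
  "('m::topological_space, 'e::euclidean_space) chart set \<Rightarrow> ('m, 'e) conn \<Rightarrow>
     real \<Rightarrow> real \<Rightarrow> (real \<Rightarrow> 'm) \<Rightarrow> (real \<Rightarrow> 'e) \<Rightarrow> real \<Rightarrow> 'e" where
  "second_cov_along At N a b \<gamma> J =
     (let D = cov_along At N {a..b} \<gamma> (velocity At {a..b} \<gamma>) in D (D J))"

definition jacobi_equation ::
  "('m::topological_space, 'e::euclidean_space) chart set \<Rightarrow> ('m \<times> 'e) set \<Rightarrow> ('m, 'e) conn \<Rightarrow>
     real \<Rightarrow> real \<Rightarrow> (real \<Rightarrow> 'm) \<Rightarrow> (real \<Rightarrow> 'e) \<Rightarrow> bool" where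
  "jacobi_equation At A N a b \<gamma> J \<longleftrightarrow>
     (\<forall>t\<in>{a..b}. second_cov_along At N a b \<gamma> J t = curvature_operator At A N a b \<gamma> J t)"

end

theory Submission
  imports Defs
begin

text \<open>
  In a chart a connection is a smooth family of bilinear maps \<open>\<Gamma>\<^sub>v\<close>, and \<open>Q = \<Gamma>' - \<Gamma>\<close> satisfies
  \<open>Q\<^sub>v(v,u) = 0\<close> for all \<open>v \<in> A\<close>.  Differentiating this identity in \<open>v\<close> in the direction \<open>w\<close> gives
  \<open>(\<partial>\<^sup>\<nu>Q)\<^sub>v(v,u,w) = - Q\<^sub>v(w,u)\<close>; with \<open>u = v\<close> and the symmetry of \<open>Q\<close> the right-hand side vanishes,
  which is the claim on \<open>P'\<close>.  In the coordinate expression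
  \<open>R\<^sub>v(X,Y)Z = \<partial>\<^sub>x\<Gamma>(Y,Z)X - \<partial>\<^sup>\<nu>\<Gamma>(Y,Z,\<Gamma>(X,v)) + \<Gamma>(X,\<Gamma>(Y,Z)) - (X \<leftrightarrow> Y)\<close>
  with \<open>X = Z = v\<close> the contributions of \<open>Q\<close> reduce to \<open>Q(\<Gamma>(v,v),Y) - Q(Y,\<Gamma>(v,v)) = 0\<close>.  The covariant
  derivatives along an auto-parallel curve with reference vector its velocity agree because
  \<open>\<Gamma>'\<^sub>v(v,u) = \<Gamma>\<^sub>v(v,u)\<close>.  That Jacobi fields solve the Jacobi equation comes from differentiating the
  auto-parallel equation of a variation with respect to its parameter.
\<close>

section \<open>Calculus of smooth maps\<close>

text \<open>The objects rest on choices made anew at every point: preferred charts, fields through a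
  vector, globalized germs, an admissible extension. These choices need not vary smoothly with the
  point, so hardly anything can be differentiated in the form in which it is stored. The coordinate
  formulas are therefore proved in an arbitrary chart around the point, which stays fixed while the
  point moves. Tensoriality shows that a chosen field enters only through its value at the base
  point; since connections act on global fields, localising them takes smooth bump functions.
  Changing the chart brings in second derivatives of the transition maps: their symmetry removes
  them from the Lie bracket, and in the covariant derivative along a curve they are absorbed by the
  transformation law of the Christoffel maps. The same symmetry cancels the second derivatives of Z
  in the curvature and exchanges the two parameters of a variation.\<close>

lemma frechet_derivative_cong_open:
  assumes "open S" "x \<in> S" "\<And>y. y \<in> S \<Longrightarrow> f y = g y"
  shows "frechet_derivative f (at x) = frechet_derivative g (at x)"
proof -
  have "(f has_derivative D) (at x) \<longleftrightarrow> (g has_derivative D) (at x)" for D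
    using has_derivative_transform_within_open[of f D x UNIV S g]
      has_derivative_transform_within_open[of g D x UNIV S f] assms by auto
  then show ?thesis
    by (simp add: frechet_derivative_def)
qed

lemma Ck_on_cong:
  assumes "open S" "Ck_on n S f" "\<And>x. x \<in> S \<Longrightarrow> f x = g x"
  shows "Ck_on n S g"
  using assms(2,3)
proof (induction n arbitrary: f g)
  case 0
  then show ?case
    by (simp cong: continuous_on_cong)
next
  case (Suc n)
  have D: "frechet_derivative f (at x) = frechet_derivative g (at x)" if "x \<in> S" for x
    by (rule frechet_derivative_cong_open[OF assms(1) that Suc.prems(2)])
  have "(g has_derivative frechet_derivative f (at x)) (at x)" if "x \<in> S" for x
    using Suc.prems that assms(1) has_derivative_transform_within_open[of f _ x UNIV S g]
    by (auto simp: frechet_derivative_works)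
  moreover have "Ck_on n S (\<lambda>x. frechet_derivative g (at x) h)" for h
  proof (rule Suc.IH)
    show "Ck_on n S (\<lambda>x. frechet_derivative f (at x) h)" using Suc.prems(1) by simp
  qed (simp only: D)
  ultimately show ?case
    by (auto simp: differentiable_def)
qed

text \<open>\<open>Ck_on\<close> is phrased with the selected \<open>frechet_derivative\<close>;
  this rule accepts any explicit formula for the derivative, so that the sum, product and chain
  rules can drive the inductions on the order.\<close>

lemma Ck_on_SucI:
  assumes "open S" "\<And>x. x \<in> S \<Longrightarrow> (f has_derivative f' x) (at x)"
    and "\<And>h. Ck_on n S (\<lambda>x. f' x h)"
  shows "Ck_on (Suc n) S f"
proof -
  have "f' x h = frechet_derivative f (at x) h" if "x \<in> S" for x h
    by (rule fun_cong[OF frechet_derivative_at[OF assms(2)[OF that]]])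
  then have "Ck_on n S (\<lambda>x. frechet_derivative f (at x) h)" for h
    by (rule Ck_on_cong[OF assms(1) assms(3)[of h]])
  with assms(2) show ?thesis
    by (auto simp: differentiable_def)
qed

lemma Ck_on_SucD:
  assumes "Ck_on (Suc n) S f"
  shows "\<And>x. x \<in> S \<Longrightarrow> (f has_derivative frechet_derivative f (at x)) (at x)"
    and "\<And>h. Ck_on n S (\<lambda>x. frechet_derivative f (at x) h)"
  using assms by (auto simp: frechet_derivative_works)

lemma Ck_on_subset: "Ck_on n S f \<Longrightarrow> T \<subseteq> S \<Longrightarrow> Ck_on n T f"
  by (induction n arbitrary: f) (auto intro: continuous_on_subset)

lemma Ck_on_imp_continuous_on: "Ck_on n S f \<Longrightarrow> continuous_on S f"
  by (cases n)
    (auto intro!: continuous_at_imp_continuous_on differentiable_imp_continuous_within)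

lemma Ck_on_Suc_imp: "Ck_on (Suc n) S f \<Longrightarrow> Ck_on n S f"
  by (induction n arbitrary: f)
    (use Ck_on_imp_continuous_on Ck_on.simps in blast, auto)

lemma Ck_on_local:
  assumes "\<And>x. x \<in> S \<Longrightarrow> \<exists>T. open T \<and> x \<in> T \<and> Ck_on n T f"
  shows "Ck_on n S f"
  using assms
proof (induction n arbitrary: f)
  case 0
  then show ?case
    by (simp add: continuous_on_eq_continuous_within)
      (metis at_within_open continuous_at_imp_continuous_at_within)
next
  case (Suc n)
  then have "Ck_on n S (\<lambda>x. frechet_derivative f (at x) h)" for h
    by (intro Suc.IH) fastforce
  with Suc.prems show ?case by fastforce
qed

lemma Ck_on_const: "open S \<Longrightarrow> Ck_on n S (\<lambda>_. c)"
  by (induction n arbitrary: c) (auto intro!: Ck_on_SucI has_derivative_const)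

lemma Ck_on_bounded_linear:
  assumes "bounded_linear L" "open S" "Ck_on n S f"
  shows "Ck_on n S (\<lambda>x. L (f x))"
  using assms(3)
proof (induction n arbitrary: f)
  case 0
  then show ?case
    using assms(1) by (simp add: bounded_linear.continuous_on)
next
  case (Suc n)
  show ?case
    by (rule Ck_on_SucI[OF assms(2) bounded_linear.has_derivative[OF assms(1)]])
      (use Suc.IH Ck_on_SucD[OF Suc.prems] in auto)
qed

lemma Ck_on_add:
  assumes "open S" "Ck_on n S f" "Ck_on n S g"
  shows "Ck_on n S (\<lambda>x. f x + g x)"
  using assms(2,3)
proof (induction n arbitrary: f g)
  case 0
  then show ?case by (auto intro: continuous_intros)
next
  case (Suc n)
  show ?case
    by (rule Ck_on_SucI[OF assms(1) has_derivative_add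
          [OF Ck_on_SucD(1)[OF Suc.prems(1)] Ck_on_SucD(1)[OF Suc.prems(2)]]])
      (auto intro: Suc.IH Ck_on_SucD(2)[OF Suc.prems(1)] Ck_on_SucD(2)[OF Suc.prems(2)])
qed

lemma Ck_on_sum:
  assumes "open S" "\<And>i. i \<in> I \<Longrightarrow> Ck_on n S (f i)"
  shows "Ck_on n S (\<lambda>x. \<Sum>i\<in>I. f i x)"
  using assms(2)
  by (induction I rule: infinite_finite_induct) (auto intro!: Ck_on_add Ck_on_const assms(1))

lemma Ck_on_bilinear:
  assumes "bounded_bilinear B" "open S" "Ck_on n S f" "Ck_on n S g"
  shows "Ck_on n S (\<lambda>x. B (f x) (g x))"
  using assms(3,4)
proof (induction n arbitrary: f g)
  case 0
  then show ?case using bounded_bilinear.continuous_on[OF assms(1)] by auto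
next
  case (Suc n)
  note f = Ck_on_SucD[OF Suc.prems(1)] Ck_on_Suc_imp[OF Suc.prems(1)]
  note g = Ck_on_SucD[OF Suc.prems(2)] Ck_on_Suc_imp[OF Suc.prems(2)]
  show ?case
  proof (rule Ck_on_SucI[OF assms(2)])
    show "((\<lambda>x. B (f x) (g x)) has_derivative (\<lambda>h. B (f x) (frechet_derivative g (at x) h) +
      B (frechet_derivative f (at x) h) (g x))) (at x)" if "x \<in> S" for x
      using bounded_bilinear.FDERIV[OF assms(1) f(1) g(1)] that by auto
    show "Ck_on n S (\<lambda>x. B (f x) (frechet_derivative g (at x) h) +
      B (frechet_derivative f (at x) h) (g x))" for h
      by (intro Ck_on_add Suc.IH f g assms(2))
  qed
qed

lemma linear_basis_expansion:
  fixes L :: "'a::euclidean_space \<Rightarrow> 'b::real_vector"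
  assumes "linear L"
  shows "L k = (\<Sum>i\<in>Basis. (k \<bullet> i) *\<^sub>R L i)"
proof -
  have "L k = L (\<Sum>i\<in>Basis. (k \<bullet> i) *\<^sub>R i)"
    by (simp add: euclidean_representation)
  also have "\<dots> = (\<Sum>i\<in>Basis. (k \<bullet> i) *\<^sub>R L i)"
    by (simp add: linear_sum[OF assms] linear_cmul[OF assms])
  finally show ?thesis .
qed

text \<open>By the chain rule the derivative in a fixed direction h evaluates Df at g x in the
  direction Dg h, which moves with x, while the induction hypothesis covers fixed directions only.
  Expanding over \<open>Basis\<close> leaves fixed directions with varying coefficients; this is
  where the intermediate space has to be Euclidean.\<close>

lemma Ck_on_compose:
  fixes g :: "'a::real_normed_vector \<Rightarrow> 'b::euclidean_space" and f :: "'b \<Rightarrow> 'c::real_normed_vector"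
  assumes "open S" "open T" "g ` S \<subseteq> T" "Ck_on n S g" "Ck_on n T f"
  shows "Ck_on n S (\<lambda>x. f (g x))"
  using assms(4,5)
proof (induction n arbitrary: f)
  case 0
  then show ?case using assms(3) by (auto intro: continuous_on_compose2)
next
  case (Suc n)
  note f = Ck_on_SucD[OF Suc.prems(2)]
  note g = Ck_on_SucD[OF Suc.prems(1)] Ck_on_Suc_imp[OF Suc.prems(1)]
  let ?D = "\<lambda>x h. \<Sum>i\<in>Basis. (frechet_derivative g (at x) h \<bullet> i) *\<^sub>R frechet_derivative f (at (g x)) i"
  show ?case
  proof (rule Ck_on_SucI[OF assms(1)])
    fix x assume x: "x \<in> S"
    have gx: "g x \<in> T" using x assms(3) by auto
    have "((\<lambda>x. f (g x)) has_derivative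
        (\<lambda>h. frechet_derivative f (at (g x)) (frechet_derivative g (at x) h))) (at x)"
      using diff_chain_at[OF g(1)[OF x] f(1)[OF gx]] by (simp add: o_def)
    moreover have "(\<lambda>h. frechet_derivative f (at (g x)) (frechet_derivative g (at x) h)) = ?D x"
      by (rule ext) (rule linear_basis_expansion[OF has_derivative_linear[OF f(1)[OF gx]]])
    ultimately show "((\<lambda>x. f (g x)) has_derivative ?D x) (at x)" by simp
  next
    fix h
    show "Ck_on n S (\<lambda>x. ?D x h)"
      by (rule Ck_on_sum[OF assms(1)], rule Ck_on_bilinear[OF bounded_bilinear_scaleR assms(1)])
        (rule Ck_on_bounded_linear[OF bounded_linear_inner_left assms(1) g(2)], rule Suc.IH[OF g(3) f(2)])
  qed
qed

named_theorems smooth_intros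

lemma smooth_on_cong:
  "open S \<Longrightarrow> smooth_on S f \<Longrightarrow> (\<And>x. x \<in> S \<Longrightarrow> f x = g x) \<Longrightarrow> smooth_on S g"
  by (auto simp: smooth_on_def intro: Ck_on_cong)

lemma smooth_on_subset: "smooth_on S f \<Longrightarrow> T \<subseteq> S \<Longrightarrow> smooth_on T f"
  by (auto simp: smooth_on_def intro: Ck_on_subset)

lemma smooth_on_local:
  assumes "\<And>x. x \<in> S \<Longrightarrow> \<exists>T. open T \<and> x \<in> T \<and> smooth_on T f"
  shows "smooth_on S f"
  using assms unfolding smooth_on_def by (metis Ck_on_local)

lemma smooth_on_imp_continuous_on: "smooth_on S f \<Longrightarrow> continuous_on S f"
  by (auto simp: smooth_on_def intro: Ck_on_imp_continuous_on)

lemma smooth_on_has_derivative: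
  "smooth_on S f \<Longrightarrow> x \<in> S \<Longrightarrow> (f has_derivative frechet_derivative f (at x)) (at x)"
  unfolding smooth_on_def by (metis Ck_on_SucD(1))

lemma smooth_on_directional:
  "smooth_on S f \<Longrightarrow> smooth_on S (\<lambda>x. frechet_derivative f (at x) h)"
  unfolding smooth_on_def by (metis Ck_on_SucD(2))

lemma smooth_on_const [smooth_intros]: "open S \<Longrightarrow> smooth_on S (\<lambda>_. c)"
  by (auto simp: smooth_on_def intro: Ck_on_const)

lemma smooth_on_bounded_linear:
  "bounded_linear L \<Longrightarrow> open S \<Longrightarrow> smooth_on S f \<Longrightarrow> smooth_on S (\<lambda>x. L (f x))"
  by (auto simp: smooth_on_def intro: Ck_on_bounded_linear)

lemma smooth_on_bilinear:
  "bounded_bilinear B \<Longrightarrow> open S \<Longrightarrow> smooth_on S f \<Longrightarrow> smooth_on S g \<Longrightarrow> smooth_on S (\<lambda>x. B (f x) (g x))"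
  by (auto simp: smooth_on_def intro: Ck_on_bilinear)

lemmas smooth_on_scaleR [smooth_intros] = smooth_on_bilinear[OF bounded_bilinear_scaleR]
lemmas smooth_on_mult [smooth_intros] = smooth_on_bilinear[OF bounded_bilinear_mult]
lemmas smooth_on_inner [smooth_intros] = smooth_on_bilinear[OF bounded_bilinear_inner]
lemmas smooth_on_minus [smooth_intros] =
  smooth_on_bounded_linear[OF bounded_linear_minus[OF bounded_linear_ident]]

lemma smooth_on_add [smooth_intros]:
  "open S \<Longrightarrow> smooth_on S f \<Longrightarrow> smooth_on S g \<Longrightarrow> smooth_on S (\<lambda>x. f x + g x)"
  by (auto simp: smooth_on_def intro: Ck_on_add)

lemma smooth_on_diff [smooth_intros]:
  "open S \<Longrightarrow> smooth_on S f \<Longrightarrow> smooth_on S g \<Longrightarrow> smooth_on S (\<lambda>x. f x - g x)"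
  using smooth_on_add[of S f "\<lambda>x. - g x"] smooth_on_minus[of S g] by simp

lemma smooth_on_sum [smooth_intros]:
  "open S \<Longrightarrow> (\<And>i. i \<in> I \<Longrightarrow> smooth_on S (f i)) \<Longrightarrow> smooth_on S (\<lambda>x. \<Sum>i\<in>I. f i x)"
  by (auto simp: smooth_on_def intro: Ck_on_sum)

lemma smooth_on_ident [smooth_intros]: "open S \<Longrightarrow> smooth_on S (\<lambda>x. x)"
  unfolding smooth_on_def
proof
  fix n assume S: "open S"
  show "Ck_on n S (\<lambda>x. x)"
    by (cases n) (use S in \<open>auto intro!: Ck_on_SucI has_derivative_ident Ck_on_const\<close>)
qed

lemma smooth_on_Pair [smooth_intros]:
  assumes S: "open S" and f: "smooth_on S f" and g: "smooth_on S g"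
  shows "smooth_on S (\<lambda>x. (f x, g x))"
proof -
  have L: "bounded_linear (\<lambda>a. (a, 0))" and R: "bounded_linear (\<lambda>a. (0, a))"
    by (rule bounded_linear_Pair[OF bounded_linear_ident bounded_linear_zero],
        rule bounded_linear_Pair[OF bounded_linear_zero bounded_linear_ident])
  have "smooth_on S (\<lambda>x. (f x, 0) + (0, g x))"
    by (rule smooth_on_add[OF S smooth_on_bounded_linear[OF L S f] smooth_on_bounded_linear[OF R S g]])
  then show ?thesis by simp
qed

lemma smooth_on_compose:
  fixes g :: "'a::real_normed_vector \<Rightarrow> 'b::euclidean_space"
  assumes "smooth_on T f" "smooth_on S g" "open S" "open T" "g ` S \<subseteq> T"
  shows "smooth_on S (\<lambda>x. f (g x))"
  unfolding smooth_on_def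
proof
  show "Ck_on n S (\<lambda>x. f (g x))" for n
    by (rule Ck_on_compose[OF assms(3-5)]) (use assms(1,2) in \<open>simp_all add: smooth_on_def\<close>)
qed

lemma smooth_on_linear_frechet_derivative:
  "smooth_on S f \<Longrightarrow> x \<in> S \<Longrightarrow> linear (frechet_derivative f (at x))"
  using smooth_on_has_derivative has_derivative_linear by blast

text \<open>The direction moves with the point, so the derivatives in the fixed basis directions are
  recombined with smooth coefficients.\<close>

lemma smooth_on_frechet_derivative [smooth_intros]:
  fixes f :: "'a::euclidean_space \<Rightarrow> 'b::real_normed_vector"
  assumes "open S" "smooth_on S f" "smooth_on S g"
  shows "smooth_on S (\<lambda>x. frechet_derivative f (at x) (g x))"
proof (rule smooth_on_cong[OF assms(1)])
  show "smooth_on S (\<lambda>x. \<Sum>i\<in>Basis. (g x \<bullet> i) *\<^sub>R frechet_derivative f (at x) i)"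
    by (intro smooth_intros smooth_on_directional assms)
  show "(\<Sum>i\<in>Basis. (g x \<bullet> i) *\<^sub>R frechet_derivative f (at x) i) = frechet_derivative f (at x) (g x)"
    if "x \<in> S" for x
    by (rule linear_basis_expansion[OF smooth_on_linear_frechet_derivative[OF assms(2) that], symmetric])
qed

section \<open>Symmetry of second derivatives\<close>

text \<open>Two mean value theorems: along h for the increment a -> f(x + a h + t k) - f(x + a h),
  and along k for the directional derivative in direction h.\<close>

lemma second_difference_mvt:
  fixes f :: "'a::real_normed_vector \<Rightarrow> real"
  assumes f: "smooth_on S f" and t: "0 < t"
    and in_S: "\<And>a b. 0 \<le> a \<Longrightarrow> a \<le> t \<Longrightarrow> 0 \<le> b \<Longrightarrow> b \<le> t \<Longrightarrow> x + a *\<^sub>R h + b *\<^sub>R k \<in> S"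
  shows "\<exists>a b. 0 < a \<and> a < t \<and> 0 < b \<and> b < t \<and>
    f (x + t *\<^sub>R h + t *\<^sub>R k) - f (x + t *\<^sub>R h) - f (x + t *\<^sub>R k) + f x =
    t * t * frechet_derivative (\<lambda>y. frechet_derivative f (at y) h) (at (x + a *\<^sub>R h + b *\<^sub>R k)) k"
proof -
  define Dh where "Dh y = frechet_derivative f (at y) h" for y
  have Dh: "smooth_on S Dh" unfolding Dh_def by (rule smooth_on_directional[OF f])
  have lin: "linear (frechet_derivative g (at y))" if "smooth_on S g" "y \<in> S" for y and g :: "'a \<Rightarrow> real"
    using smooth_on_linear_frechet_derivative that by blast
  have d1: "((\<lambda>a. f (x + a *\<^sub>R h + b *\<^sub>R k)) has_real_derivative Dh (x + a *\<^sub>R h + b *\<^sub>R k)) (at a)"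
    if "0 \<le> a" "a \<le> t" "0 \<le> b" "b \<le> t" for a b
  proof -
    have "((\<lambda>a. x + a *\<^sub>R h + b *\<^sub>R k) has_derivative (\<lambda>s. s *\<^sub>R h)) (at a)"
      by (auto intro!: derivative_eq_intros)
    from diff_chain_at[OF this smooth_on_has_derivative[OF f in_S[OF that]]]
    show ?thesis
      using linear_cmul[OF lin[OF f in_S[OF that]]]
      by (simp add: o_def has_field_derivative_def Dh_def mult.commute[of _ "frechet_derivative _ _ _"])
  qed
  have d2: "((\<lambda>b. Dh (x + a *\<^sub>R h + b *\<^sub>R k)) has_real_derivative
      frechet_derivative Dh (at (x + a *\<^sub>R h + b *\<^sub>R k)) k) (at b)"
    if "0 \<le> a" "a \<le> t" "0 \<le> b" "b \<le> t" for a b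
  proof -
    have "((\<lambda>b. x + a *\<^sub>R h + b *\<^sub>R k) has_derivative (\<lambda>s. s *\<^sub>R k)) (at b)"
      by (auto intro!: derivative_eq_intros)
    from diff_chain_at[OF this smooth_on_has_derivative[OF Dh in_S[OF that]]]
    show ?thesis
      using linear_cmul[OF lin[OF Dh in_S[OF that]]]
      by (simp add: o_def has_field_derivative_def mult.commute[of _ "frechet_derivative _ _ _"])
  qed
  have "\<exists>a. a > 0 \<and> a < t \<and>
      (f (x + t *\<^sub>R h + t *\<^sub>R k) - f (x + t *\<^sub>R h + 0 *\<^sub>R k)) - (f (x + 0 *\<^sub>R h + t *\<^sub>R k) - f (x + 0 *\<^sub>R h + 0 *\<^sub>R k))
      = (t - 0) * (Dh (x + a *\<^sub>R h + t *\<^sub>R k) - Dh (x + a *\<^sub>R h + 0 *\<^sub>R k))"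
    by (rule MVT2[OF t]) (intro DERIV_diff d1; use t in simp)
  then obtain a where a: "0 < a" "a < t"
    "f (x + t *\<^sub>R h + t *\<^sub>R k) - f (x + t *\<^sub>R h) - f (x + t *\<^sub>R k) + f x =
      t * (Dh (x + a *\<^sub>R h + t *\<^sub>R k) - Dh (x + a *\<^sub>R h + 0 *\<^sub>R k))"
    by auto
  have "\<exists>b. b > 0 \<and> b < t \<and> Dh (x + a *\<^sub>R h + t *\<^sub>R k) - Dh (x + a *\<^sub>R h + 0 *\<^sub>R k)
      = (t - 0) * frechet_derivative Dh (at (x + a *\<^sub>R h + b *\<^sub>R k)) k"
    by (rule MVT2[OF t]) (intro d2; use a in simp)
  then obtain b where "0 < b" "b < t" "Dh (x + a *\<^sub>R h + t *\<^sub>R k) - Dh (x + a *\<^sub>R h + 0 *\<^sub>R k)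
      = t * frechet_derivative Dh (at (x + a *\<^sub>R h + b *\<^sub>R k)) k"
    by auto
  with a show ?thesis
    unfolding Dh_def[abs_def] by (metis (no_types, lifting) mult.assoc)
qed

text \<open>The second difference does not change when h and k are exchanged, so the two mixed
  derivatives agree at two points arbitrarily close to x. If they differed at x, continuity with
  half the gap as tolerance would give a contradiction.\<close>

lemma second_derivative_symmetric_real:
  fixes f :: "'a::real_normed_vector \<Rightarrow> real"
  assumes S: "open S" "x \<in> S" and f: "smooth_on S f"
  shows "frechet_derivative (\<lambda>y. frechet_derivative f (at y) h) (at x) k =
         frechet_derivative (\<lambda>y. frechet_derivative f (at y) k) (at x) h"
proof (rule ccontr)
  let ?P = "\<lambda>y. frechet_derivative (\<lambda>y. frechet_derivative f (at y) h) (at y) k"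
  let ?Q = "\<lambda>y. frechet_derivative (\<lambda>y. frechet_derivative f (at y) k) (at y) h"
  assume "?P x \<noteq> ?Q x"
  then have e: "dist (?P x) (?Q x) / 2 > 0" by simp
  have cont: "isCont ?P x" "isCont ?Q x"
    using smooth_on_imp_continuous_on[OF smooth_on_directional[OF smooth_on_directional[OF f]]] S
    by (simp_all add: continuous_on_eq_continuous_at)
  obtain d1 where d1: "d1 > 0" "\<And>y. dist y x < d1 \<Longrightarrow> dist (?P y) (?P x) < dist (?P x) (?Q x) / 2"
    using cont(1) e unfolding continuous_at_eps_delta by blast
  obtain d2 where d2: "d2 > 0" "\<And>y. dist y x < d2 \<Longrightarrow> dist (?Q y) (?Q x) < dist (?P x) (?Q x) / 2"
    using cont(2) e unfolding continuous_at_eps_delta by blast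
  obtain d3 where d3: "d3 > 0" "ball x d3 \<subseteq> S" using S open_contains_ball by blast
  define d where "d = min d1 (min d2 d3)"
  have d: "d > 0" using d1 d2 d3 by (simp add: d_def)
  \<comment> \<open>With this t every point x + a h + b k with a, b in [0, t] lies within d/2 of x;
    the summand 1 keeps the denominator positive when h and k vanish.\<close>
  define t where "t = d / (2 * (norm h + norm k + 1))"
  have t: "t > 0" using d by (simp add: t_def add_nonneg_pos)
  have near: "dist (x + a *\<^sub>R h + b *\<^sub>R k) x < d" if "0 \<le> a" "a \<le> t" "0 \<le> b" "b \<le> t" for a b
  proof -
    have "dist (x + a *\<^sub>R h + b *\<^sub>R k) x = norm (a *\<^sub>R h + b *\<^sub>R k)"
      by (simp add: dist_norm)
    also have "\<dots> \<le> a * norm h + b * norm k"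
      using that by (metis abs_of_nonneg norm_scaleR norm_triangle_ineq)
    also have "\<dots> \<le> t * norm h + t * norm k"
      using that by (intro add_mono mult_right_mono) auto
    also have "\<dots> \<le> t * (norm h + norm k + 1)" using t by (simp add: algebra_simps)
    also have "\<dots> = d / 2"
    proof -
      have "norm h + norm k + 1 \<noteq> 0" by (smt (verit) norm_ge_zero)
      then show ?thesis unfolding t_def by (simp only: times_divide_eq_left) (simp add: field_simps)
    qed
    finally show ?thesis using d by simp
  qed
  have in_S: "x + a *\<^sub>R h + b *\<^sub>R k \<in> S" if "0 \<le> a" "a \<le> t" "0 \<le> b" "b \<le> t" for a b
    using near[OF that] d3 by (auto simp: d_def dist_commute mem_ball)
  have in_S': "x + a *\<^sub>R k + b *\<^sub>R h \<in> S" if "0 \<le> a" "a \<le> t" "0 \<le> b" "b \<le> t" for a b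
    using in_S[of b a] that by (simp add: add_ac)
  obtain a b where ab: "0 < a" "a < t" "0 < b" "b < t"
    "f (x + t *\<^sub>R h + t *\<^sub>R k) - f (x + t *\<^sub>R h) - f (x + t *\<^sub>R k) + f x = t * t * ?P (x + a *\<^sub>R h + b *\<^sub>R k)"
    using second_difference_mvt[OF f t in_S] by auto
  obtain a' b' where ab': "0 < a'" "a' < t" "0 < b'" "b' < t"
    "f (x + t *\<^sub>R k + t *\<^sub>R h) - f (x + t *\<^sub>R k) - f (x + t *\<^sub>R h) + f x = t * t * ?Q (x + a' *\<^sub>R k + b' *\<^sub>R h)"
    using second_difference_mvt[OF f t in_S'] by auto
  have comm: "x + t *\<^sub>R k + t *\<^sub>R h = x + t *\<^sub>R h + t *\<^sub>R k" by simp
  have "t * t * ?P (x + a *\<^sub>R h + b *\<^sub>R k) = t * t * ?Q (x + a' *\<^sub>R k + b' *\<^sub>R h)"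
    unfolding ab(5)[symmetric] ab'(5)[symmetric] comm by simp
  then have "?P (x + a *\<^sub>R h + b *\<^sub>R k) = ?Q (x + a' *\<^sub>R k + b' *\<^sub>R h)"
    using t by simp
  moreover have "dist (?P (x + a *\<^sub>R h + b *\<^sub>R k)) (?P x) < dist (?P x) (?Q x) / 2"
    by (rule d1) (use near[of a b] ab in \<open>simp add: d_def\<close>)
  moreover have "dist (?Q (x + a' *\<^sub>R k + b' *\<^sub>R h)) (?Q x) < dist (?P x) (?Q x) / 2"
    by (rule d2) (use near[of b' a'] ab' in \<open>simp add: d_def add_ac\<close>)
  ultimately show False
    by (metis dist_triangle_half_r less_irrefl)
qed

lemma second_derivative_symmetric:
  fixes f :: "'a::real_normed_vector \<Rightarrow> 'b::euclidean_space"
  assumes S: "open S" "x \<in> S" and f: "smooth_on S f"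
  shows "frechet_derivative (\<lambda>y. frechet_derivative f (at y) h) (at x) k =
         frechet_derivative (\<lambda>y. frechet_derivative f (at y) k) (at x) h"
proof (rule euclidean_eqI)
  fix i :: 'b
  have D: "frechet_derivative (\<lambda>y. g y \<bullet> i) (at y) = (\<lambda>h. frechet_derivative g (at y) h \<bullet> i)"
    if "smooth_on S g" "y \<in> S" for g y
    by (rule frechet_derivative_at[OF has_derivative_inner_left[OF smooth_on_has_derivative[OF that]],
          symmetric])
  have DD: "frechet_derivative (\<lambda>y. frechet_derivative (\<lambda>y. f y \<bullet> i) (at y) h) (at x) k
      = frechet_derivative (\<lambda>y. frechet_derivative f (at y) h) (at x) k \<bullet> i" for h k
  proof -
    have "frechet_derivative (\<lambda>y. frechet_derivative (\<lambda>y. f y \<bullet> i) (at y) h) (at x) =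
        frechet_derivative (\<lambda>y. frechet_derivative f (at y) h \<bullet> i) (at x)"
      by (rule frechet_derivative_cong_open[OF S], rule fun_cong[OF D[OF f]])
    also have "\<dots> = (\<lambda>k. frechet_derivative (\<lambda>y. frechet_derivative f (at y) h) (at x) k \<bullet> i)"
      by (rule D[OF smooth_on_directional[OF f] S(2)])
    finally show ?thesis by (rule fun_cong)
  qed
  have "smooth_on S (\<lambda>y. f y \<bullet> i)"
    by (rule smooth_on_bounded_linear[OF bounded_linear_inner_left S(1) f])
  from second_derivative_symmetric_real[OF S this, of h k]
  show "frechet_derivative (\<lambda>y. frechet_derivative f (at y) h) (at x) k \<bullet> i =
    frechet_derivative (\<lambda>y. frechet_derivative f (at y) k) (at x) h \<bullet> i"
    unfolding DD .
qed

section \<open>Bump functions and global extension of fields\<close>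

text \<open>The flat function exp(-1/x), extended by zero, is the case k = 0. The powers of 1/x are
  included because the derivative of member k is a combination of members k+1 and k+2; smoothness is
  then one induction on the order, general in k.\<close>

definition exp_inv_pow :: "nat \<Rightarrow> real \<Rightarrow> real" where
  "exp_inv_pow k x = (if x \<le> 0 then 0 else (1 / x) ^ k / exp (1 / x))"

lemma exp_inv_pow_tendsto_0: "(exp_inv_pow k \<longlongrightarrow> 0) (at 0)"
proof -
  have "filterlim (\<lambda>x::real. 1 / x) at_top (at_right 0)"
    using filterlim_inverse_at_top_right by (simp add: inverse_eq_divide)
  from filterlim_compose[OF tendsto_power_div_exp_0 this]
  have "((\<lambda>x. (1 / x) ^ k / exp (1 / x)) \<longlongrightarrow> 0) (at_right (0::real))" .
  then have "(exp_inv_pow k \<longlongrightarrow> 0) (at_right 0)"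
    by (rule Lim_transform_eventually)
      (auto simp: exp_inv_pow_def eventually_at_filter)
  moreover have "(exp_inv_pow k \<longlongrightarrow> 0) (at_left 0)"
    by (rule tendsto_eventually) (auto simp: exp_inv_pow_def eventually_at_filter)
  ultimately show ?thesis by (simp add: filterlim_split_at)
qed

lemma exp_inv_pow_has_derivative:
  "(exp_inv_pow k has_derivative (\<lambda>h. h * (exp_inv_pow (k + 2) x - real k * exp_inv_pow (k + 1) x))) (at x)"
proof -
  consider "x < 0" | "x = 0" | "x > 0" by linarith
  then show ?thesis
  proof cases
    case 1
    have "((\<lambda>_. 0) has_derivative (\<lambda>h. h * (exp_inv_pow (k + 2) x - real k * exp_inv_pow (k + 1) x))) (at x)"
      using 1 by (auto simp: exp_inv_pow_def)
    then show ?thesis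
      by (rule has_derivative_transform_within_open[of _ _ _ _ "{..<0}"]) (use 1 in \<open>auto simp: exp_inv_pow_def\<close>)
  next
    case 2
    \<comment> \<open>The difference quotient of member k at 0 is member k+1, which tends to
      0.\<close>
    have "((\<lambda>h. exp_inv_pow (Suc k) h) \<longlongrightarrow> 0) (at 0)" by (rule exp_inv_pow_tendsto_0)
    then have "((\<lambda>h. (exp_inv_pow k (0 + h) - exp_inv_pow k 0) / h) \<longlongrightarrow> 0) (at 0)"
      by (rule Lim_transform_eventually) (auto simp: exp_inv_pow_def eventually_at_filter)
    then have "(exp_inv_pow k has_field_derivative 0) (at 0)"
      by (simp add: DERIV_def)
    moreover have "(\<lambda>h. h * (exp_inv_pow (k + 2) x - real k * exp_inv_pow (k + 1) x)) = (*) 0"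
      using 2 by (auto simp: exp_inv_pow_def)
    ultimately show ?thesis
      using 2 by (simp only: has_field_derivative_def)
  next
    case 3
    have "((\<lambda>x. (1 / x) ^ k / exp (1 / x)) has_real_derivative
        exp_inv_pow (k + 2) x - real k * exp_inv_pow (k + 1) x) (at x)"
      using 3 by (cases k)
        (auto intro!: derivative_eq_intros simp: exp_inv_pow_def divide_simps power2_eq_square, simp_all add: field_simps,
          metis One_nat_def power_eq_if)
    then have "((\<lambda>x. (1 / x) ^ k / exp (1 / x)) has_derivative
        (\<lambda>h. h * (exp_inv_pow (k + 2) x - real k * exp_inv_pow (k + 1) x))) (at x)"
      by (simp only: has_field_derivative_def mult_commute_abs)
    then show ?thesis
      by (rule has_derivative_transform_within_open[of _ _ _ _ "{0<..}"]) (use 3 in \<open>auto simp: exp_inv_pow_def\<close>)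
  qed
qed

lemma smooth_exp_inv_pow: "smooth_on UNIV (exp_inv_pow k)"
  unfolding smooth_on_def
proof
  show "Ck_on n UNIV (exp_inv_pow k)" for n
  proof (induction n arbitrary: k)
    case 0
    then show ?case
      using exp_inv_pow_has_derivative has_derivative_continuous
      by (simp add: continuous_on_eq_continuous_at) blast
  next
    case (Suc n)
    have "Ck_on n UNIV (\<lambda>x. (- real k) * exp_inv_pow (k + 1) x)"
      by (rule Ck_on_bounded_linear[OF bounded_linear_mult_right open_UNIV Suc])
    from Ck_on_add[OF open_UNIV Suc[of "k+2"] this]
    have "Ck_on n UNIV (\<lambda>x. h * (exp_inv_pow (k + 2) x - real k * exp_inv_pow (k + 1) x))" for h
      using Ck_on_bounded_linear[OF bounded_linear_mult_right[of h] open_UNIV] by auto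
    then show ?case
      by (intro Ck_on_SucI[OF open_UNIV exp_inv_pow_has_derivative])
  qed
qed

lemma smooth_cutoff:
  obtains \<phi> :: "real \<Rightarrow> real"
  where "smooth_on UNIV \<phi>" "\<And>x. x \<le> 0 \<Longrightarrow> \<phi> x = 1" "\<And>x. x \<ge> 1 \<Longrightarrow> \<phi> x = 0"
proof
  let ?e = "exp_inv_pow 0"
  \<comment> \<open>For x >= 1 the inner argument e(1) - e(x) is nonpositive, so the outer flat
    function vanishes; for x <= 0 it equals e(1) > 0, and the last factor normalises the value to
    1.\<close>
  let ?\<phi> = "\<lambda>x. ?e (?e 1 - ?e x) * inverse (?e (?e 1))"
  show "smooth_on UNIV ?\<phi>"
    by (intro smooth_on_mult smooth_on_const smooth_on_compose[OF smooth_exp_inv_pow] smooth_on_diff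
        smooth_exp_inv_pow) auto
  show "?\<phi> x = 1" if "x \<le> 0" for x
    using that by (simp add: exp_inv_pow_def)
  show "?\<phi> x = 0" if "x \<ge> 1" for x
  proof -
    have "?e 1 \<le> ?e x" using that by (simp add: exp_inv_pow_def divide_simps)
    then show ?thesis by (simp add: exp_inv_pow_def)
  qed
qed

lemma smooth_bump:
  fixes a :: "'e::euclidean_space"
  assumes "r > 0"
  obtains B :: "'e \<Rightarrow> real"
  where "smooth_on UNIV B" "\<And>x. dist x a \<le> r \<Longrightarrow> B x = 1" "\<And>x. dist x a \<ge> 2 * r \<Longrightarrow> B x = 0"
proof -
  obtain \<phi> :: "real \<Rightarrow> real"
    where \<phi>: "smooth_on UNIV \<phi>" "\<And>x. x \<le> 0 \<Longrightarrow> \<phi> x = 1" "\<And>x. x \<ge> 1 \<Longrightarrow> \<phi> x = 0"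
    by (rule smooth_cutoff) blast
  \<comment> \<open>The squared distance is smooth at a, unlike the distance itself. After scaling
    and shifting it is at most 0 within radius r and at least 3 beyond 2r, hence in the two constant
    ranges of the cutoff.\<close>
  let ?q = "\<lambda>x. inverse (r * r) * ((x - a) \<bullet> (x - a)) - 1"
  have q: "?q x = (dist x a / r)\<^sup>2 - 1" for x
    using assms by (simp add: dist_norm dot_square_norm power2_eq_square divide_simps)
  show ?thesis
  proof
    have "smooth_on UNIV ?q"
      by (intro smooth_intros) auto
    then show "smooth_on UNIV (\<lambda>x. \<phi> (?q x))"
      by (rule smooth_on_compose[OF \<phi>(1)]) auto
    show "\<phi> (?q x) = 1" if "dist x a \<le> r" for x
    proof (rule \<phi>(2))
      have "dist x a / r \<le> 1" using that assms by simp
      then have "(dist x a / r)\<^sup>2 \<le> 1" using assms by (simp add: power_le_one)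
      then show "?q x \<le> 0" unfolding q by simp
    qed
    show "\<phi> (?q x) = 0" if "dist x a \<ge> 2 * r" for x
    proof (rule \<phi>(3))
      have "dist x a / r \<ge> 2" using that assms by (simp add: field_simps)
      then have "(dist x a / r)\<^sup>2 \<ge> 2\<^sup>2" by (intro power_mono) auto
      then show "1 \<le> ?q x" unfolding q by simp
    qed
  qed
qed

section \<open>Charts of the manifold and tangent vectors in coordinates\<close>

abbreviation transition :: "('m, 'e) chart \<Rightarrow> ('m, 'e) chart \<Rightarrow> 'e \<Rightarrow> 'e" where
  "transition c c' \<equiv> snd c' \<circ> chart_inv c"

locale smooth_manifold =
  fixes At :: "('m::{t2_space,second_countable_topology}, 'e::euclidean_space) chart set"
  assumes atlas: "smooth_atlas At"
begin

lemma chart_homeomorphism: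
  "c \<in> At \<Longrightarrow> homeomorphism (fst c) (snd c ` fst c) (snd c) (chart_inv c)"
  using atlas by (auto simp: smooth_atlas_def)

lemma open_chart_domain: "c \<in> At \<Longrightarrow> open (fst c)"
  using atlas by (auto simp: smooth_atlas_def)

lemma open_chart_image: "c \<in> At \<Longrightarrow> open (snd c ` fst c)"
  using atlas by (auto simp: smooth_atlas_def)

lemma chart_inv_chart [simp]: "c \<in> At \<Longrightarrow> p \<in> fst c \<Longrightarrow> chart_inv c (snd c p) = p"
  using chart_homeomorphism by (auto simp: homeomorphism_def)

lemma chart_chart_inv [simp]: "c \<in> At \<Longrightarrow> x \<in> snd c ` fst c \<Longrightarrow> snd c (chart_inv c x) = x"
  using chart_homeomorphism by (auto simp: homeomorphism_def)

lemma continuous_on_chart: "c \<in> At \<Longrightarrow> continuous_on (fst c) (snd c)"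
  using chart_homeomorphism by (auto simp: homeomorphism_def)

lemma continuous_on_chart_inv: "c \<in> At \<Longrightarrow> continuous_on (snd c ` fst c) (chart_inv c)"
  using chart_homeomorphism by (auto simp: homeomorphism_def)

lemma chart_image_eq:
  "c \<in> At \<Longrightarrow> snd c ` (W \<inter> fst c) = {x \<in> snd c ` fst c. chart_inv c x \<in> W}"
  by force

lemma open_chart_image_Int: "c \<in> At \<Longrightarrow> open W \<Longrightarrow> open (snd c ` (W \<inter> fst c))"
  using continuous_open_preimage[OF continuous_on_chart_inv open_chart_image, of c W]
  by (simp add: chart_image_eq Collect_conj_eq vimage_def)

lemma open_chart_image_subset: "c \<in> At \<Longrightarrow> open W \<Longrightarrow> W \<subseteq> fst c \<Longrightarrow> open (snd c ` W)"
  using open_chart_image_Int[of c W] by (simp add: Int_absorb2)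

lemma open_chart_preimage: "c \<in> At \<Longrightarrow> open O' \<Longrightarrow> open {q \<in> fst c. snd c q \<in> O'}"
  using continuous_open_preimage[OF continuous_on_chart open_chart_domain, of c O']
  by (simp add: Int_def vimage_def)

lemma chart_at: "chart_at At p \<in> At" "p \<in> fst (chart_at At p)"
proof -
  have "\<exists>c. c \<in> At \<and> p \<in> fst c" using atlas unfolding smooth_atlas_def by blast
  from someI_ex[OF this] show "chart_at At p \<in> At" "p \<in> fst (chart_at At p)"
    by (auto simp: chart_at_def)
qed

lemma smooth_transition:
  "c \<in> At \<Longrightarrow> c' \<in> At \<Longrightarrow> smooth_on (snd c ` (fst c \<inter> fst c')) (transition c c')"
  using atlas by (auto simp: smooth_atlas_def)

lemma open_overlap: "c \<in> At \<Longrightarrow> c' \<in> At \<Longrightarrow> open (snd c ` (fst c \<inter> fst c'))"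
  by (intro open_chart_image_subset open_Int open_chart_domain) auto

lemma transition_has_derivative:
  "c \<in> At \<Longrightarrow> c' \<in> At \<Longrightarrow> p \<in> fst c \<Longrightarrow> p \<in> fst c' \<Longrightarrow>
    (transition c c' has_derivative tangent_trans c c' p) (at (snd c p))"
  unfolding tangent_trans_def using smooth_transition by (rule smooth_on_has_derivative) auto

lemma linear_tangent_trans:
  "c \<in> At \<Longrightarrow> c' \<in> At \<Longrightarrow> p \<in> fst c \<Longrightarrow> p \<in> fst c' \<Longrightarrow> linear (tangent_trans c c' p)"
  using transition_has_derivative has_derivative_linear by blast

lemma tangent_trans_compose:
  assumes "c \<in> At" "c' \<in> At" "c'' \<in> At" "p \<in> fst c" "p \<in> fst c'" "p \<in> fst c''"
  shows "tangent_trans c' c'' p (tangent_trans c c' p x) = tangent_trans c c'' p x"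
proof -
  have "(transition c' c'' has_derivative tangent_trans c' c'' p) (at (transition c c' (snd c p)))"
    using transition_has_derivative[OF assms(2,3,5,6)] assms by simp
  from diff_chain_at[OF transition_has_derivative[OF assms(1,2,4,5)] this]
  have "(transition c' c'' \<circ> transition c c' has_derivative
      tangent_trans c' c'' p \<circ> tangent_trans c c' p) (at (snd c p))" .
  then have "(transition c c'' has_derivative
      tangent_trans c' c'' p \<circ> tangent_trans c c' p) (at (snd c p))"
    by (rule has_derivative_transform_within_open[OF _ open_overlap[OF assms(1,2)]])
      (use assms in auto)
  from has_derivative_unique[OF this transition_has_derivative[OF assms(1,3,4,6)]]
  show ?thesis by (simp add: fun_eq_iff)
qed

lemma tangent_trans_same: "c \<in> At \<Longrightarrow> p \<in> fst c \<Longrightarrow> tangent_trans c c p x = x"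
proof -
  assume c: "c \<in> At" "p \<in> fst c"
  have "((\<lambda>x. x) has_derivative (\<lambda>x. x)) (at (snd c p))" by simp
  then have "(transition c c has_derivative (\<lambda>x. x)) (at (snd c p))"
    by (rule has_derivative_transform_within_open[OF _ open_chart_image[OF c(1)]]) (use c in auto)
  from has_derivative_unique[OF this transition_has_derivative[OF c(1) c(1) c(2) c(2)]]
  show ?thesis by (simp add: fun_eq_iff)
qed

lemma to_from_chart [simp]: "c \<in> At \<Longrightarrow> p \<in> fst c \<Longrightarrow> to_chart At c p (from_chart At c p x) = x"
  unfolding to_chart_def from_chart_def
  by (subst tangent_trans_compose) (auto simp: chart_at tangent_trans_same)

lemma from_to_chart [simp]: "c \<in> At \<Longrightarrow> p \<in> fst c \<Longrightarrow> from_chart At c p (to_chart At c p x) = x"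
  unfolding to_chart_def from_chart_def
  by (subst tangent_trans_compose) (auto simp: chart_at tangent_trans_same)

lemma linear_to_chart: "c \<in> At \<Longrightarrow> p \<in> fst c \<Longrightarrow> linear (to_chart At c p)"
  unfolding to_chart_def by (intro linear_tangent_trans chart_at)

lemma linear_from_chart: "c \<in> At \<Longrightarrow> p \<in> fst c \<Longrightarrow> linear (from_chart At c p)"
  unfolding from_chart_def by (intro linear_tangent_trans chart_at)

lemma to_chart_change:
  "c \<in> At \<Longrightarrow> c' \<in> At \<Longrightarrow> p \<in> fst c \<Longrightarrow> p \<in> fst c' \<Longrightarrow>
    to_chart At c' p x = tangent_trans c c' p (to_chart At c p x)"
  unfolding to_chart_def by (subst tangent_trans_compose) (auto simp: chart_at)

lemma to_chart_chart_at [simp]: "to_chart At (chart_at At p) p x = x"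
  unfolding to_chart_def by (rule tangent_trans_same) (rule chart_at)+

lemma from_chart_chart_at [simp]: "from_chart At (chart_at At p) p x = x"
  unfolding from_chart_def by (rule tangent_trans_same) (rule chart_at)+

lemma to_chart_inject: "c \<in> At \<Longrightarrow> p \<in> fst c \<Longrightarrow> to_chart At c p x = to_chart At c p y \<longleftrightarrow> x = y"
  by (metis from_to_chart)

lemma local_rep_chart: "c \<in> At \<Longrightarrow> p \<in> fst c \<Longrightarrow> local_rep At c X (snd c p) = to_chart At c p (X p)"
  by (simp add: local_rep_def)

lemma local_rep_change:
  assumes "c \<in> At" "c' \<in> At" "p \<in> fst c" "p \<in> fst c'"
  shows "local_rep At c' X (snd c' p) =
    frechet_derivative (transition c c') (at (snd c p)) (local_rep At c X (snd c p))"
  using to_chart_change[OF assms, of "X p"] assms by (simp add: local_rep_chart tangent_trans_def)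

section \<open>Smooth functions and vector fields: one chart around each point suffices\<close>

lemma smooth_funI:
  assumes "\<And>p. \<exists>c\<in>At. \<exists>V. open V \<and> p \<in> V \<and> V \<subseteq> fst c \<and> smooth_on (snd c ` V) (f \<circ> chart_inv c)"
  shows "smooth_fun At f"
  unfolding smooth_fun_def
proof (intro ballI smooth_on_local)
  fix c' y assume c': "c' \<in> At" and y: "y \<in> snd c' ` fst c'"
  then obtain q where q: "q \<in> fst c'" "y = snd c' q" by auto
  obtain c V where c: "c \<in> At" "open V" "q \<in> V" "V \<subseteq> fst c" "smooth_on (snd c ` V) (f \<circ> chart_inv c)"
    using assms[of q] by auto
  have o: "open (snd c' ` (V \<inter> fst c'))" by (rule open_chart_image_Int[OF c' c(2)])
  have tr: "smooth_on (snd c' ` (V \<inter> fst c')) (transition c' c)"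
    by (rule smooth_on_subset[OF smooth_transition[OF c' c(1)]]) (use c(4) in auto)
  have "smooth_on (snd c' ` (V \<inter> fst c')) (\<lambda>x. (f \<circ> chart_inv c) (transition c' c x))"
    by (rule smooth_on_compose[OF c(5) tr o open_chart_image_subset[OF c(1,2,4)]])
      (use c c' in auto)
  then have "smooth_on (snd c' ` (V \<inter> fst c')) (f \<circ> chart_inv c')"
    by (rule smooth_on_cong[OF o]) (use c c' in auto)
  with o q c show "\<exists>T. open T \<and> y \<in> T \<and> smooth_on T (f \<circ> chart_inv c')" by blast
qed

text \<open>The definition quantifies over all charts. Components in another chart are the Jacobian
  of the transition map applied to the given ones, composed with the reverse transition, so
  smoothness in one chart near the point carries over.\<close>

lemma vector_field_onI:
  assumes "\<And>p. p \<in> \<Omega> \<Longrightarrow>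
    \<exists>c\<in>At. \<exists>V. open V \<and> p \<in> V \<and> V \<subseteq> fst c \<and> smooth_on (snd c ` V) (local_rep At c X)"
  shows "vector_field_on At \<Omega> X"
  unfolding vector_field_on_def
proof (intro ballI smooth_on_local)
  fix c' y assume c': "c' \<in> At" and y: "y \<in> snd c' ` (\<Omega> \<inter> fst c')"
  then obtain q where q: "q \<in> fst c'" "q \<in> \<Omega>" "y = snd c' q" by auto
  obtain c V where c: "c \<in> At" "open V" "q \<in> V" "V \<subseteq> fst c" "smooth_on (snd c ` V) (local_rep At c X)"
    using assms[OF q(2)] by auto
  have o: "open (snd c' ` (V \<inter> fst c'))" by (rule open_chart_image_Int[OF c' c(2)])
  have tr: "smooth_on (snd c' ` (V \<inter> fst c')) (transition c' c)"
    by (rule smooth_on_subset[OF smooth_transition[OF c' c(1)]]) (use c(4) in auto)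
  have o2: "open (snd c ` (V \<inter> fst c'))"
    by (rule open_chart_image_subset[OF c(1)]) (use c open_chart_domain[OF c'] in auto)
  have "smooth_on (snd c ` (V \<inter> fst c')) (\<lambda>x. frechet_derivative (transition c c') (at x) (local_rep At c X x))"
    by (rule smooth_on_frechet_derivative[OF o2 smooth_on_subset[OF smooth_transition[OF c(1) c']]
          smooth_on_subset[OF c(5)]]) (use c in auto)
  then have "smooth_on (snd c' ` (V \<inter> fst c')) (\<lambda>x. (\<lambda>x. frechet_derivative (transition c c') (at x) (local_rep At c X x)) (transition c' c x))"
    by (rule smooth_on_compose[OF _ tr o o2]) (use c c' in auto)
  then have "smooth_on (snd c' ` (V \<inter> fst c')) (local_rep At c' X)"
  proof (rule smooth_on_cong[OF o])
    fix x assume "x \<in> snd c' ` (V \<inter> fst c')"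
    then obtain p where p: "p \<in> V" "p \<in> fst c'" "x = snd c' p" by auto
    show "frechet_derivative (transition c c') (at (transition c' c x)) (local_rep At c X (transition c' c x)) =
      local_rep At c' X x"
      using local_rep_change[OF c(1) c', of p X] p c c' by auto
  qed
  with o q c show "\<exists>T. open T \<and> y \<in> T \<and> smooth_on T (local_rep At c' X)" by blast
qed

lemma vector_field_onD:
  "vector_field_on At \<Omega> X \<Longrightarrow> c \<in> At \<Longrightarrow> smooth_on (snd c ` (\<Omega> \<inter> fst c)) (local_rep At c X)"
  by (auto simp: vector_field_on_def)

lemma vector_fieldD: "vector_field At X \<Longrightarrow> c \<in> At \<Longrightarrow> smooth_on (snd c ` fst c) (local_rep At c X)"
  using vector_field_onD[of UNIV X c] by simp

lemma vector_field_on_chartI: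
  assumes "c \<in> At" "open V" "V \<subseteq> fst c" "smooth_on (snd c ` V) g"
    and "\<And>q. q \<in> V \<Longrightarrow> to_chart At c q (X q) = g (snd c q)"
  shows "vector_field_on At V X"
proof (rule vector_field_onI)
  have "smooth_on (snd c ` V) (local_rep At c X)"
    by (rule smooth_on_cong[OF open_chart_image_subset[OF assms(1-3)] assms(4)])
      (use assms in \<open>auto simp: local_rep_chart\<close>)
  then show "\<exists>c\<in>At. \<exists>V. open V \<and> p \<in> V \<and> V \<subseteq> fst c \<and> smooth_on (snd c ` V) (local_rep At c X)"
    if "p \<in> V" for p using assms that by blast
qed

section \<open>Bump functions on the manifold, extension of local fields, tensoriality\<close>

lemma manifold_bump:
  assumes "open W" "p \<in> W"
  obtains f K U where "smooth_fun At f" "closed K" "K \<subseteq> W" "\<And>q. q \<notin> K \<Longrightarrow> f q = 0"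
    "open U" "p \<in> U" "\<And>q. q \<in> U \<Longrightarrow> f q = (1::real)"
proof -
  define c where "c = chart_at At p"
  have c: "c \<in> At" "p \<in> fst c" by (auto simp: c_def chart_at)
  have "open (snd c ` (W \<inter> fst c))" "snd c p \<in> snd c ` (W \<inter> fst c)"
    using open_chart_image_Int c assms by auto
  then obtain e where e: "e > 0" "cball (snd c p) e \<subseteq> snd c ` (W \<inter> fst c)"
    by (meson open_contains_cball)
  have e': "cball (snd c p) e \<subseteq> snd c ` fst c" using e by auto
  obtain B where B: "smooth_on UNIV B" "\<And>x. dist x (snd c p) \<le> e/2 \<Longrightarrow> B x = (1::real)"
      "\<And>x. dist x (snd c p) \<ge> 2 * (e/2) \<Longrightarrow> B x = 0"
    using smooth_bump[of "e/2" "snd c p"] e by auto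
  define K where "K = chart_inv c ` cball (snd c p) e"
  define f where "f q = (if q \<in> fst c then B (snd c q) else 0)" for q
  have "compact K"
    unfolding K_def by (rule compact_continuous_image)
      (use continuous_on_subset[OF continuous_on_chart_inv[OF c(1)] e'] in auto)
  \<comment> \<open>The Hausdorff property enters here. It makes the complement of K open, and this
    complement together with the chart domain covers M, so smoothness of f can be checked on each of
    the two.\<close>
  then have K: "closed K" by (rule compact_imp_closed)
  have KW: "K \<subseteq> W" using e(2) c(1) by (force simp: K_def)
  have f0: "f q = 0" if "q \<notin> K" for q
  proof (cases "q \<in> fst c")
    case True
    then have "snd c q \<notin> cball (snd c p) e"
      using that c by (metis K_def chart_inv_chart imageI)
    then show ?thesis using True B(3)[of "snd c q"] by (simp add: f_def dist_commute)
  qed (simp add: f_def)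
  have "smooth_fun At f"
  proof (rule smooth_funI)
    fix q
    show "\<exists>c\<in>At. \<exists>V. open V \<and> q \<in> V \<and> V \<subseteq> fst c \<and> smooth_on (snd c ` V) (f \<circ> chart_inv c)"
    proof (cases "q \<in> fst c")
      case True
      have "smooth_on (snd c ` fst c) (f \<circ> chart_inv c)"
        by (rule smooth_on_cong[OF open_chart_image[OF c(1)] smooth_on_subset[OF B(1)]])
          (use c in \<open>auto simp: f_def\<close>)
      with True c open_chart_domain show ?thesis by blast
    next
      case False
      then have q: "q \<notin> K" using e' c by (auto simp: K_def)
      define c' where "c' = chart_at At q"
      have c': "c' \<in> At" "q \<in> fst c'" by (auto simp: c'_def chart_at)
      have o: "open (fst c' - K)" using K open_chart_domain[OF c'(1)] by auto
      have "smooth_on (snd c' ` (fst c' - K)) (f \<circ> chart_inv c')"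
        by (rule smooth_on_cong[OF _ smooth_on_const[of _ 0]])
          (use c' f0 open_chart_image_subset[OF c'(1) o] in auto)
      with o q c' show ?thesis by blast
    qed
  qed
  moreover have "open {q \<in> fst c. snd c q \<in> ball (snd c p) (e/2)}"
    using open_chart_preimage[OF c(1)] by blast
  ultimately show ?thesis
    using that[of f K "{q \<in> fst c. snd c q \<in> ball (snd c p) (e/2)}"] K KW f0 c e B(2)
    by (auto simp: f_def dist_commute)
qed

lemma smooth_fun_const: "smooth_fun At (\<lambda>_. k)"
  by (auto simp: smooth_fun_def o_def intro!: smooth_on_const open_chart_image)

lemma smooth_funD: "smooth_fun At f \<Longrightarrow> c \<in> At \<Longrightarrow> smooth_on (snd c ` fst c) (f \<circ> chart_inv c)"
  by (auto simp: smooth_fun_def)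

lemma vector_field_on_scaled:
  assumes f: "smooth_fun At f" and X: "vector_field_on At \<Omega> X" and \<Omega>: "open \<Omega>"
  shows "vector_field_on At \<Omega> (\<lambda>q. f q *\<^sub>R X q)"
  unfolding vector_field_on_def
proof
  fix c assume c: "c \<in> At"
  have o: "open (snd c ` (\<Omega> \<inter> fst c))" using open_chart_image_Int c \<Omega> .
  have "smooth_on (snd c ` (\<Omega> \<inter> fst c)) (\<lambda>x. (f \<circ> chart_inv c) x *\<^sub>R local_rep At c X x)"
    by (rule smooth_on_scaleR[OF o smooth_on_subset[OF smooth_funD[OF f c]] vector_field_onD[OF X c]]) auto
  then show "smooth_on (snd c ` (\<Omega> \<inter> fst c)) (local_rep At c (\<lambda>q. f q *\<^sub>R X q))"
    by (rule smooth_on_cong[OF o]) (use c in \<open>auto simp: local_rep_chart linear_cmul[OF linear_to_chart]\<close>)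
qed

lemma vector_field_scaled: "smooth_fun At f \<Longrightarrow> vector_field At X \<Longrightarrow> vector_field At (\<lambda>q. f q *\<^sub>R X q)"
  using vector_field_on_scaled by blast

lemma vector_field_add:
  assumes "vector_field At X" "vector_field At Y"
  shows "vector_field At (\<lambda>q. X q + Y q)"
  unfolding vector_field_on_def
proof
  fix c assume c: "c \<in> At"
  have "smooth_on (snd c ` fst c) (\<lambda>x. local_rep At c X x + local_rep At c Y x)"
    by (rule smooth_on_add[OF open_chart_image[OF c] vector_fieldD[OF assms(1) c] vector_fieldD[OF assms(2) c]])
  then have "smooth_on (snd c ` fst c) (local_rep At c (\<lambda>q. X q + Y q))"
    by (rule smooth_on_cong[OF open_chart_image[OF c]])
      (use c in \<open>auto simp: local_rep_chart linear_add[OF linear_to_chart]\<close>)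
  then show "smooth_on (snd c ` (UNIV \<inter> fst c)) (local_rep At c (\<lambda>q. X q + Y q))" by simp
qed

lemma vector_field_zero: "vector_field At (\<lambda>_. 0)"
  unfolding vector_field_on_def
proof
  fix c assume c: "c \<in> At"
  show "smooth_on (snd c ` (UNIV \<inter> fst c)) (local_rep At c (\<lambda>_. 0))"
    by (rule smooth_on_cong[OF _ smooth_on_const[of _ 0]])
      (use c open_chart_image[OF c] in \<open>auto simp: local_rep_chart linear_0[OF linear_to_chart]\<close>)
qed

lemma vector_field_sum:
  "(\<And>i. i \<in> I \<Longrightarrow> vector_field At (X i)) \<Longrightarrow> vector_field At (\<lambda>q. \<Sum>i\<in>I. X i q)"
  by (induction I rule: infinite_finite_induct) (auto intro!: vector_field_add vector_field_zero)

text \<open>Outside \<Omega> the values of X are arbitrary, but f annihilates them. Since K is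
  closed, \<Omega> and the complement of K form an open cover on whose members smoothness is seen
  directly.\<close>

lemma vector_field_cutoff:
  assumes f: "smooth_fun At f" and K: "closed K" "K \<subseteq> \<Omega>" "\<And>q. q \<notin> K \<Longrightarrow> f q = 0"
    and X: "vector_field_on At \<Omega> X" and \<Omega>: "open \<Omega>"
  shows "vector_field At (\<lambda>q. f q *\<^sub>R X q)"
proof (rule vector_field_onI)
  fix q
  define c where "c = chart_at At q"
  have c: "c \<in> At" "q \<in> fst c" by (auto simp: c_def chart_at)
  show "\<exists>c\<in>At. \<exists>V. open V \<and> q \<in> V \<and> V \<subseteq> fst c \<and> smooth_on (snd c ` V) (local_rep At c (\<lambda>q. f q *\<^sub>R X q))"
  proof (cases "q \<in> \<Omega>")
    case True
    with vector_field_onD[OF vector_field_on_scaled[OF f X \<Omega>] c(1)] c \<Omega> open_chart_domain[OF c(1)]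
    show ?thesis by blast
  next
    case False
    have o: "open (fst c - K)" using K open_chart_domain[OF c(1)] by auto
    have "smooth_on (snd c ` (fst c - K)) (local_rep At c (\<lambda>q. f q *\<^sub>R X q))"
      by (rule smooth_on_cong[OF _ smooth_on_const[of _ 0]])
        (use c K(3) open_chart_image_subset[OF c(1) o] in
          \<open>auto simp: local_rep_chart linear_0[OF linear_to_chart]\<close>)
    with o False K c show ?thesis by blast
  qed
qed

text \<open>The covering argument of \<open>vector_field_cutoff\<close>; off the chart domain
  \<open>g (snd c q)\<close> is an arbitrary number multiplied by zero.\<close>

lemma smooth_fun_cutoff:
  assumes f: "smooth_fun At f" and K: "closed K" "K \<subseteq> fst c" "\<And>q. q \<notin> K \<Longrightarrow> f q = 0"
    and g: "smooth_on (snd c ` fst c) g" and c: "c \<in> At"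
  shows "smooth_fun At (\<lambda>q. f q * g (snd c q))"
proof (rule smooth_funI)
  fix q
  show "\<exists>c'\<in>At. \<exists>V. open V \<and> q \<in> V \<and> V \<subseteq> fst c' \<and> smooth_on (snd c' ` V) ((\<lambda>q. f q * g (snd c q)) \<circ> chart_inv c')"
  proof (cases "q \<in> fst c")
    case True
    have "smooth_on (snd c ` fst c) (\<lambda>x. (f \<circ> chart_inv c) x * g x)"
      by (rule smooth_on_mult[OF open_chart_image[OF c] smooth_funD[OF f c] g])
    then have "smooth_on (snd c ` fst c) ((\<lambda>q. f q * g (snd c q)) \<circ> chart_inv c)"
      by (rule smooth_on_cong[OF open_chart_image[OF c]]) (use c in auto)
    then show ?thesis using True c open_chart_domain by blast
  next
    case False
    define c' where "c' = chart_at At q"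
    have c': "c' \<in> At" "q \<in> fst c'" by (auto simp: c'_def chart_at)
    have o: "open (fst c' - K)" using K open_chart_domain[OF c'(1)] by auto
    have "smooth_on (snd c' ` (fst c' - K)) ((\<lambda>q. f q * g (snd c q)) \<circ> chart_inv c')"
      by (rule smooth_on_cong[OF _ smooth_on_const[of _ 0]])
        (use c' K(3) open_chart_image_subset[OF c'(1) o] in auto)
    with o False K c' show ?thesis by blast
  qed
qed

text \<open>The existence statement behind the choices in \<open>globalize\<close> and
  \<open>field_through\<close>: multiply by a bump function that is 1 near p.\<close>

lemma extend_field:
  assumes "vector_field_on At \<Omega> X" "open \<Omega>" "p \<in> \<Omega>"
  shows "\<exists>X'. vector_field At X' \<and> (\<exists>W. open W \<and> p \<in> W \<and> (\<forall>q\<in>W. X' q = X q))"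
proof -
  obtain f K U where f: "smooth_fun At f" "closed K" "K \<subseteq> \<Omega>" "\<And>q. q \<notin> K \<Longrightarrow> f q = 0"
    "open U" "p \<in> U" "\<And>q. q \<in> U \<Longrightarrow> f q = (1::real)"
    using manifold_bump[OF assms(2,3)] by blast
  from vector_field_cutoff[OF f(1-4) assms(1,2)] f(5-7) show ?thesis
    by (intro exI[of _ "\<lambda>q. f q *\<^sub>R X q"]) auto
qed

lemma globalize:
  assumes "vector_field_on At \<Omega> X" "open \<Omega>" "p \<in> \<Omega>"
  obtains W where "vector_field At (globalize At p X)" "open W" "p \<in> W" "\<And>q. q \<in> W \<Longrightarrow> globalize At p X q = X q"
  using someI_ex[OF extend_field[OF assms]] unfolding globalize_def by blast

lemma coord_field_on: "c \<in> At \<Longrightarrow> vector_field_on At (fst c) (coord_field At c b)"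
  by (rule vector_field_on_chartI[of c _ "\<lambda>_. b"])
    (auto simp: coord_field_def intro!: open_chart_domain smooth_on_const open_chart_image)

lemma field_through: "vector_field At (field_through At p x)" "field_through At p x p = x"
proof -
  define c where "c = chart_at At p"
  have c: "c \<in> At" "p \<in> fst c" by (auto simp: c_def chart_at)
  from extend_field[OF coord_field_on[OF c(1), of x] open_chart_domain[OF c(1)] c(2)]
  have "\<exists>X. vector_field At X \<and> X p = x"
    by (auto simp: coord_field_def) (auto simp: c_def)
  from someI_ex[OF this] show "vector_field At (field_through At p x)" "field_through At p x p = x"
    by (auto simp: field_through_def)
qed

text \<open>A bump function \<open>f\<close> at \<open>p\<close> supported in a chart gives \<open>f\<^sup>2 X = \<Sum>\<^sub>i (f X\<^sup>i) (f \<partial>\<^sub>i)\<close> with factors that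
  are globally smooth.\<close>

lemma tensorial_vanish:
  assumes add: "\<And>X Y. vector_field At X \<Longrightarrow> vector_field At Y \<Longrightarrow> T (\<lambda>q. X q + Y q) = T X + T Y"
    and scale: "\<And>f X. smooth_fun At f \<Longrightarrow> vector_field At X \<Longrightarrow> T (\<lambda>q. f q *\<^sub>R X q) = f p *\<^sub>R T X"
    and X: "vector_field At X" "X p = 0"
  shows "T X = (0 :: 'v::real_vector)"
proof -
  define c where "c = chart_at At p"
  have c: "c \<in> At" "p \<in> fst c" by (auto simp: c_def chart_at)
  obtain f K U where f: "smooth_fun At f" "closed K" "K \<subseteq> fst c" "\<And>q. q \<notin> K \<Longrightarrow> f q = 0"
    "open U" "p \<in> U" "\<And>q. q \<in> U \<Longrightarrow> f q = (1::real)"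
    using manifold_bump[OF open_chart_domain[OF c(1)] c(2)] by blast
  define E where "E i = (\<lambda>q. f q *\<^sub>R coord_field At c i q)" for i
  define \<xi> where "\<xi> i q = f q * (local_rep At c X (snd c q) \<bullet> i)" for i q
  have E: "vector_field At (E i)" for i
    unfolding E_def by (rule vector_field_cutoff[OF f(1-4) coord_field_on[OF c(1)] open_chart_domain[OF c(1)]])
  have \<xi>: "smooth_fun At (\<xi> i)" for i
    unfolding \<xi>_def
    by (rule smooth_fun_cutoff[OF f(1-4) _ c(1)], assumption)
      (rule smooth_on_bounded_linear[OF bounded_linear_inner_left open_chart_image[OF c(1)] vector_fieldD[OF X(1) c(1)]])
  have T0: "T (\<lambda>_. 0) = 0" using add[OF vector_field_zero vector_field_zero] by simp
  have Tsum: "T (\<lambda>q. \<Sum>i\<in>I. Z i q) = (\<Sum>i\<in>I. T (Z i))" if "finite I" "\<And>i. vector_field At (Z i)" for I :: "'e set" and Z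
    using that(1)
    by (induction I) (auto simp: T0 add[OF that(2) vector_field_sum[OF that(2)]])
  have fX: "f q *\<^sub>R f q *\<^sub>R X q = (\<Sum>i\<in>Basis. \<xi> i q *\<^sub>R E i q)" for q
  proof (cases "q \<in> fst c")
    case True
    let ?L = "local_rep At c X (snd c q)"
    have "X q = from_chart At c q ?L" using True c by (simp add: local_rep_chart)
    also have "\<dots> = (\<Sum>i\<in>Basis. (?L \<bullet> i) *\<^sub>R from_chart At c q i)"
      by (rule linear_basis_expansion[OF linear_from_chart[OF c(1) True]])
    finally have *: "X q = (\<Sum>i\<in>Basis. (?L \<bullet> i) *\<^sub>R from_chart At c q i)" .
    show ?thesis
      by (subst *) (simp add: \<xi>_def E_def coord_field_def scaleR_sum_right mult_ac)
  next
    case False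
    then have "f q = 0" using f by auto
    then show ?thesis by (simp add: E_def)
  qed
  have \<xi>p: "\<xi> i p = 0" for i
    using c X(2) by (simp add: \<xi>_def local_rep_chart linear_0[OF linear_to_chart])
  have "T (\<lambda>q. f q *\<^sub>R f q *\<^sub>R X q) = f p *\<^sub>R f p *\<^sub>R T X"
    using scale[OF f(1) vector_field_scaled[OF f(1) X(1)]] scale[OF f(1) X(1)] by simp
  then have "T X = T (\<lambda>q. f q *\<^sub>R f q *\<^sub>R X q)" using f by simp
  also have "\<dots> = T (\<lambda>q. \<Sum>i\<in>Basis. \<xi> i q *\<^sub>R E i q)" by (simp only: fX)
  also have "\<dots> = (\<Sum>i\<in>Basis. T (\<lambda>q. \<xi> i q *\<^sub>R E i q))"
    by (rule Tsum) (auto intro: vector_field_scaled \<xi> E)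
  also have "\<dots> = 0" by (simp add: scale[OF \<xi> E] \<xi>p)
  finally show ?thesis .
qed

text \<open>The selected field through x need not depend linearly on x. It may be replaced by any
  field with the same value at p, in particular by a sum or a multiple of selected fields, and this
  yields the linearity.\<close>

lemma tensorial:
  assumes add: "\<And>X Y. vector_field At X \<Longrightarrow> vector_field At Y \<Longrightarrow> T (\<lambda>q. X q + Y q) = T X + T Y"
    and scale: "\<And>f X. smooth_fun At f \<Longrightarrow> vector_field At X \<Longrightarrow> T (\<lambda>q. f q *\<^sub>R X q) = f p *\<^sub>R T X"
  shows "vector_field At X \<Longrightarrow> vector_field At Y \<Longrightarrow> X p = Y p \<Longrightarrow> T X = (T Y :: 'v::real_vector)"
    and "linear (\<lambda>x. T (field_through At p x))"
proof -
  show *: "T X = T Y" if X: "vector_field At X" and Y: "vector_field At Y" and eq: "X p = Y p" for X Y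
  proof -
    have mY: "vector_field At (\<lambda>q. (-1) *\<^sub>R Y q)"
      by (rule vector_field_scaled[OF smooth_fun_const Y])
    have "T (\<lambda>q. X q + (-1) *\<^sub>R Y q) = 0"
      by (rule tensorial_vanish[OF add scale vector_field_add[OF X mY]]) (use eq in auto)
    then show ?thesis
      using add[OF X mY] scale[OF smooth_fun_const[of "-1"] Y] by simp
  qed
  show "linear (\<lambda>x. T (field_through At p x))"
  proof (rule linearI)
    show "T (field_through At p (x + y)) = T (field_through At p x) + T (field_through At p y)" for x y
      unfolding add[OF field_through(1) field_through(1), symmetric]
      by (rule *) (auto intro: field_through vector_field_add simp: field_through(2))
    show "T (field_through At p (k *\<^sub>R x)) = k *\<^sub>R T (field_through At p x)" for k x
      unfolding scale[OF smooth_fun_const field_through(1), symmetric]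
      by (rule *) (auto intro: field_through vector_field_scaled smooth_fun_const simp: field_through(2))
  qed
qed

end

section \<open>Anisotropic connections in a chart\<close>

text \<open>A product rule in which differentiability of L is given for each frozen argument. Finite
  dimension of \<open>'b\<close> reduces the moving argument to the finitely many basis
  vectors.\<close>

lemma has_derivative_linear_family:
  fixes g :: "'a::real_normed_vector \<Rightarrow> 'b::euclidean_space" and L :: "'a \<Rightarrow> 'b \<Rightarrow> 'c::real_normed_vector"
  assumes S: "open S" "x \<in> S" and lin: "\<And>u. u \<in> S \<Longrightarrow> linear (L u)"
    and L: "\<And>h. ((\<lambda>u. L u h) has_derivative L' h) (at x)"
    and g: "(g has_derivative g') (at x)"
  shows "((\<lambda>u. L u (g u)) has_derivative (\<lambda>k. L' (g x) k + L x (g' k))) (at x)"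
proof -
  have expand: "L u h = (\<Sum>i\<in>Basis. (h \<bullet> i) *\<^sub>R L u i)" if "u \<in> S" for u h
    by (rule linear_basis_expansion[OF lin[OF that]])
  have "((\<lambda>u. \<Sum>i\<in>Basis. (g x \<bullet> i) *\<^sub>R L u i) has_derivative (\<lambda>k. \<Sum>i\<in>Basis. (g x \<bullet> i) *\<^sub>R L' i k)) (at x)"
    by (intro has_derivative_sum has_derivative_scaleR_right L)
  then have "((\<lambda>u. L u (g x)) has_derivative (\<lambda>k. \<Sum>i\<in>Basis. (g x \<bullet> i) *\<^sub>R L' i k)) (at x)"
    by (rule has_derivative_transform_within_open[OF _ S]) (rule expand[symmetric])
  \<comment> \<open>The expansion of L' over the basis comes from uniqueness of the
    derivative.\<close>
  from has_derivative_unique[OF L this]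
  have L'g: "L' (g x) k = (\<Sum>i\<in>Basis. (g x \<bullet> i) *\<^sub>R L' i k)" for k by simp
  have "((\<lambda>u. \<Sum>i\<in>Basis. (g u \<bullet> i) *\<^sub>R L u i) has_derivative
      (\<lambda>k. \<Sum>i\<in>Basis. (g x \<bullet> i) *\<^sub>R L' i k + (g' k \<bullet> i) *\<^sub>R L x i)) (at x)"
    by (intro has_derivative_sum has_derivative_scaleR has_derivative_inner_left L g)
  moreover have "(\<Sum>i\<in>Basis. (g x \<bullet> i) *\<^sub>R L' i k + (g' k \<bullet> i) *\<^sub>R L x i) = L' (g x) k + L x (g' k)" for k
    by (simp only: sum.distrib L'g expand[OF S(2), of "g' k"])
  ultimately have "((\<lambda>u. \<Sum>i\<in>Basis. (g u \<bullet> i) *\<^sub>R L u i) has_derivative (\<lambda>k. L' (g x) k + L x (g' k))) (at x)"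
    by simp
  then show ?thesis
    by (rule has_derivative_transform_within_open[OF _ S]) (rule expand[symmetric])
qed

lemma has_derivative_bilinear_family:
  fixes a :: "'a::real_normed_vector \<Rightarrow> 'b::euclidean_space" and b :: "'a \<Rightarrow> 'd::euclidean_space"
    and g :: "'a \<Rightarrow> 'b \<Rightarrow> 'd \<Rightarrow> 'c::real_normed_vector"
  assumes S: "open S" "x \<in> S"
    and lin: "\<And>u \<eta>. u \<in> S \<Longrightarrow> linear (\<lambda>\<xi>. g u \<xi> \<eta>)" "\<And>u \<xi>. u \<in> S \<Longrightarrow> linear (g u \<xi>)"
    and g: "\<And>\<xi> \<eta>. ((\<lambda>u. g u \<xi> \<eta>) has_derivative g' \<xi> \<eta>) (at x)"
    and a: "(a has_derivative a') (at x)" and b: "(b has_derivative b') (at x)"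
  shows "((\<lambda>u. g u (a u) (b u)) has_derivative
    (\<lambda>k. g' (a x) (b x) k + g x (a' k) (b x) + g x (a x) (b' k))) (at x)"
  by (rule has_derivative_linear_family[OF S lin(2) _ b], assumption)
    (rule has_derivative_linear_family[OF S lin(1) g a])

section \<open>Second-order changes of chart; Lie bracket and directional derivative in any
  chart\<close>

context smooth_manifold
begin

text \<open>The inhomogeneous term in the transformation laws for derivatives of vector fields, for
  derivatives of fields along curves and for Christoffel maps.\<close>

definition hessian :: "('m, 'e) chart \<Rightarrow> ('m, 'e) chart \<Rightarrow> 'm \<Rightarrow> 'e \<Rightarrow> 'e \<Rightarrow> 'e" where
  "hessian c c' p k l =
    frechet_derivative (\<lambda>u. frechet_derivative (transition c c') (at u) l) (at (snd c p)) k"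

lemma hessian_symmetric:
  assumes "c \<in> At" "c' \<in> At" "p \<in> fst c" "p \<in> fst c'"
  shows "hessian c c' p k l = hessian c c' p l k"
  unfolding hessian_def
  by (rule second_derivative_symmetric[OF open_overlap[OF assms(1,2)] _ smooth_transition[OF assms(1,2)]])
    (use assms in auto)

text \<open>Derivative of the fibre part of the tangent map of the transition. It is composed below
  with vector fields and with fields along curves.\<close>

lemma transition_derivative_apply:
  assumes c: "c \<in> At" "c' \<in> At" "p \<in> fst c" "p \<in> fst c'"
  shows "((\<lambda>z. frechet_derivative (transition c c') (at (fst z)) (snd z)) has_derivative
    (\<lambda>k. hessian c c' p (fst k) b + tangent_trans c c' p (snd k))) (at (snd c p, b))"
proof -
  let ?S = "snd c ` (fst c \<inter> fst c')"
  have S: "open (?S \<times> (UNIV :: 'e set))" "(snd c p, b) \<in> ?S \<times> UNIV"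
    using c open_overlap[OF c(1,2)] by (auto simp: open_Times)
  have d: "((\<lambda>z. frechet_derivative (transition c c') (at (fst z)) h) has_derivative
      (\<lambda>k. hessian c c' p (fst k) h)) (at (snd c p, b))" for h
  proof -
    have "((\<lambda>u. frechet_derivative (transition c c') (at u) h) has_derivative
        (\<lambda>k. hessian c c' p k h)) (at (fst (snd c p, b)))"
      unfolding hessian_def fst_conv
      by (rule smooth_on_has_derivative[OF smooth_on_directional[OF smooth_transition[OF c(1,2)]]])
        (use c in auto)
    from has_derivative_compose[OF has_derivative_fst[OF has_derivative_ident] this]
    show ?thesis by simp
  qed
  have l: "linear (frechet_derivative (transition c c') (at (fst u)))" if "u \<in> ?S \<times> UNIV" for u :: "'e \<times> 'e"
    using smooth_on_linear_frechet_derivative[OF smooth_transition[OF c(1,2)]] that by auto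
  from has_derivative_linear_family[OF S l d has_derivative_snd[OF has_derivative_ident]]
  show ?thesis by (simp add: tangent_trans_def)
qed

lemma local_rep_has_derivative:
  "vector_field At X \<Longrightarrow> c \<in> At \<Longrightarrow> p \<in> fst c \<Longrightarrow>
    (local_rep At c X has_derivative frechet_derivative (local_rep At c X) (at (snd c p))) (at (snd c p))"
  by (rule smooth_on_has_derivative[OF vector_fieldD]) auto

text \<open>On the overlap one map has two expressions: the components in c' composed with the
  transition, differentiated by the chain rule, and the Jacobian applied to the components in c,
  differentiated by the product rule.\<close>

lemma local_rep_derivative_change:
  assumes c: "c \<in> At" "c' \<in> At" "p \<in> fst c" "p \<in> fst c'" and X: "vector_field At X"
  shows "frechet_derivative (local_rep At c' X) (at (snd c' p)) (tangent_trans c c' p k) =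
    hessian c c' p k (local_rep At c X (snd c p)) +
    tangent_trans c c' p (frechet_derivative (local_rep At c X) (at (snd c p)) k)"
proof -
  let ?S = "snd c ` (fst c \<inter> fst c')" and ?X = "local_rep At c X" and ?X' = "local_rep At c' X"
  have "(?X' has_derivative frechet_derivative ?X' (at (snd c' p))) (at (transition c c' (snd c p)))"
    using local_rep_has_derivative[OF X c(2,4)] c by simp
  from has_derivative_compose[OF transition_has_derivative[OF c] this]
  have 1: "((\<lambda>x. ?X' (transition c c' x)) has_derivative
      (\<lambda>k. frechet_derivative ?X' (at (snd c' p)) (tangent_trans c c' p k))) (at (snd c p))" .
  have "((\<lambda>x. (x, ?X x)) has_derivative (\<lambda>k. (k, frechet_derivative ?X (at (snd c p)) k))) (at (snd c p))"
    by (intro has_derivative_Pair has_derivative_ident local_rep_has_derivative[OF X c(1,3)])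
  from has_derivative_compose[OF this transition_derivative_apply[OF c]]
  have "((\<lambda>x. frechet_derivative (transition c c') (at x) (?X x)) has_derivative
      (\<lambda>k. hessian c c' p k (?X (snd c p)) + tangent_trans c c' p (frechet_derivative ?X (at (snd c p)) k))) (at (snd c p))"
    by simp
  then have "((\<lambda>x. ?X' (transition c c' x)) has_derivative
      (\<lambda>k. hessian c c' p k (?X (snd c p)) + tangent_trans c c' p (frechet_derivative ?X (at (snd c p)) k))) (at (snd c p))"
  proof (rule has_derivative_transform_within_open[OF _ open_overlap[OF c(1,2)]])
    show "snd c p \<in> ?S" using c by auto
    fix x assume "x \<in> ?S"
    then obtain q where "q \<in> fst c" "q \<in> fst c'" "x = snd c q" by auto
    then show "frechet_derivative (transition c c') (at x) (?X x) = ?X' (transition c c' x)"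
      using local_rep_change[OF c(1,2), of q X] c by simp
  qed
  from has_derivative_unique[OF 1 this] show ?thesis by (rule fun_cong)
qed

text \<open>The bracket is defined through the preferred chart at p. Passing to c adds one Hessian
  term to each of the two derivatives, and by symmetry these cancel.\<close>

lemma lie_bracket_rep:
  assumes c: "c \<in> At" "p \<in> fst c" and X: "vector_field At X" and Y: "vector_field At Y"
  shows "to_chart At c p (lie_bracket At X Y p) =
    frechet_derivative (local_rep At c Y) (at (snd c p)) (local_rep At c X (snd c p)) -
    frechet_derivative (local_rep At c X) (at (snd c p)) (local_rep At c Y (snd c p))"
proof -
  define c0 where "c0 = chart_at At p"
  have c0: "c0 \<in> At" "p \<in> fst c0" by (auto simp: c0_def chart_at)
  have rep: "local_rep At c Z (snd c p) = tangent_trans c0 c p (local_rep At c0 Z (snd c0 p))" for Z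
    using local_rep_change[OF c0(1) c(1) c0(2) c(2)] by (simp add: tangent_trans_def)
  have l: "linear (tangent_trans c0 c p)" by (rule linear_tangent_trans[OF c0(1) c(1) c0(2) c(2)])
  have "to_chart At c p (lie_bracket At X Y p) = tangent_trans c0 c p
      (frechet_derivative (local_rep At c0 Y) (at (snd c0 p)) (local_rep At c0 X (snd c0 p)) -
       frechet_derivative (local_rep At c0 X) (at (snd c0 p)) (local_rep At c0 Y (snd c0 p)))"
    unfolding lie_bracket_def Let_def to_chart_def by (simp add: c0_def)
  then show ?thesis
    unfolding rep local_rep_derivative_change[OF c0(1) c(1) c0(2) c(2) X]
      local_rep_derivative_change[OF c0(1) c(1) c0(2) c(2) Y] linear_diff[OF l]
    using hessian_symmetric[OF c0(1) c(1) c0(2) c(2)] by simp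
qed

lemma vector_field_lie_bracket:
  assumes X: "vector_field At X" and Y: "vector_field At Y"
  shows "vector_field At (lie_bracket At X Y)"
  unfolding vector_field_on_def
proof
  fix c assume c: "c \<in> At"
  let ?S = "snd c ` fst c"
  have "smooth_on ?S (\<lambda>x. frechet_derivative (local_rep At c Y) (at x) (local_rep At c X x) -
      frechet_derivative (local_rep At c X) (at x) (local_rep At c Y x))"
    by (intro smooth_on_diff smooth_on_frechet_derivative open_chart_image[OF c] vector_fieldD c X Y)
  then have "smooth_on ?S (local_rep At c (lie_bracket At X Y))"
    by (rule smooth_on_cong[OF open_chart_image[OF c]])
      (use c in \<open>auto simp: local_rep_chart lie_bracket_rep[OF _ _ X Y]\<close>)
  then show "smooth_on (snd c ` (UNIV \<inter> fst c)) (local_rep At c (lie_bracket At X Y))" by simp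
qed

lemma dir_deriv_rep:
  assumes c: "c \<in> At" "p \<in> fst c" and f: "smooth_fun At f"
  shows "dir_deriv At X f p = frechet_derivative (f \<circ> chart_inv c) (at (snd c p)) (local_rep At c X (snd c p))"
proof -
  define c0 where "c0 = chart_at At p"
  have c0: "c0 \<in> At" "p \<in> fst c0" by (auto simp: c0_def chart_at)
  have "(f \<circ> chart_inv c has_derivative frechet_derivative (f \<circ> chart_inv c) (at (snd c p)))
      (at (transition c0 c (snd c0 p)))"
    using smooth_on_has_derivative[OF smooth_funD[OF f c(1)]] c c0 by simp
  from diff_chain_at[OF transition_has_derivative[OF c0(1) c(1) c0(2) c(2)] this]
  have "((f \<circ> chart_inv c) \<circ> transition c0 c has_derivative
      frechet_derivative (f \<circ> chart_inv c) (at (snd c p)) \<circ> tangent_trans c0 c p) (at (snd c0 p))" .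
  then have "(f \<circ> chart_inv c0 has_derivative
      frechet_derivative (f \<circ> chart_inv c) (at (snd c p)) \<circ> tangent_trans c0 c p) (at (snd c0 p))"
    by (rule has_derivative_transform_within_open[OF _ open_overlap[OF c0(1) c(1)]]) (use c c0 in auto)
  from frechet_derivative_at[OF this]
  show ?thesis
    using c by (simp add: dir_deriv_def Let_def c0_def local_rep_chart to_chart_def flip: c0_def)
      (metis c0_def comp_apply)
qed

end

section \<open>Coordinates on the tangent bundle, the domain A and anisotropic fields\<close>

definition bundle_point :: "('m, 'e::real_normed_vector) chart set \<Rightarrow> ('m, 'e) chart \<Rightarrow> 'e \<times> 'e \<Rightarrow> 'm \<times> 'e" where
  "bundle_point At c z = (chart_inv c (fst z), from_chart At c (chart_inv c (fst z)) (snd z))"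

definition field_rep ::
  "('m, 'e::real_normed_vector) chart set \<Rightarrow> ('m, 'e) chart \<Rightarrow> ('m \<times> 'e \<Rightarrow> 'e) \<Rightarrow> 'e \<times> 'e \<Rightarrow> 'e" where
  "field_rep At c Y z = to_chart At c (chart_inv c (fst z)) (Y (bundle_point At c z))"

text \<open>The bilinear map with components \<open>\<Gamma>\<^sup>k\<^sub>i\<^sub>j(v)\<close>, where \<open>z\<close> are the coordinates of \<open>v\<close>.\<close>

definition christoffel_map ::
  "('m, 'e::real_normed_vector) chart set \<Rightarrow> ('m, 'e) conn \<Rightarrow> ('m, 'e) chart \<Rightarrow> 'e \<times> 'e \<Rightarrow> 'e \<Rightarrow> 'e \<Rightarrow> 'e" where
  "christoffel_map At N c z \<xi> \<eta> =
     (let p = chart_inv c (fst z);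
          X = field_through At p (from_chart At c p \<xi>); Y = field_through At p (from_chart At c p \<eta>)
      in to_chart At c p (N (bundle_point At c z) X Y)
         - frechet_derivative (local_rep At c Y) (at (fst z)) (local_rep At c X (fst z)))"

locale aniso_manifold = smooth_manifold At
  for At :: "('m::{t2_space,second_countable_topology}, 'e::euclidean_space) chart set" +
  fixes A :: "('m \<times> 'e) set"
  assumes domain: "aniso_domain At A"
begin

text \<open>Openness of \<open>A\<close> in the tangent bundle means exactly that these sets are
  open, so all differentiation in both base and fibre takes place on them.\<close>

definition coord_domain :: "('m, 'e) chart \<Rightarrow> ('e \<times> 'e) set" where
  "coord_domain c = snd (tangent_chart At c) ` (A \<inter> fst (tangent_chart At c))"

lemma open_coord_domain: "c \<in> At \<Longrightarrow> open (coord_domain c)"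
  using domain by (auto simp: aniso_domain_def atlas_open_def tangent_atlas_def coord_domain_def)

lemma coord_domain_iff:
  assumes "c \<in> At"
  shows "z \<in> coord_domain c \<longleftrightarrow> fst z \<in> snd c ` fst c \<and> bundle_point At c z \<in> A"
proof
  assume "z \<in> coord_domain c"
  then show "fst z \<in> snd c ` fst c \<and> bundle_point At c z \<in> A"
    using assms by (auto simp: coord_domain_def tangent_chart_def bundle_point_def)
next
  assume *: "fst z \<in> snd c ` fst c \<and> bundle_point At c z \<in> A"
  then have "z = snd (tangent_chart At c) (bundle_point At c z)" "bundle_point At c z \<in> fst (tangent_chart At c)"
    using assms by (auto simp: tangent_chart_def bundle_point_def prod_eq_iff)
  with * show "z \<in> coord_domain c" unfolding coord_domain_def by blast
qed

text \<open>\<open>aniso_field\<close> is stated with the abstract inverse of the bundle chart; this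
  replaces it by the explicit formula.\<close>

lemma chart_inv_tangent_chart:
  assumes "c \<in> At" "fst z \<in> snd c ` fst c"
  shows "chart_inv (tangent_chart At c) z = bundle_point At c z"
  unfolding chart_inv_def
proof (rule inv_into_f_eq)
  show "inj_on (snd (tangent_chart At c)) (fst (tangent_chart At c))"
    using assms(1) by (auto simp: inj_on_def tangent_chart_def to_chart_inject)
      (metis chart_inv_chart to_chart_inject)+
  show "bundle_point At c z \<in> fst (tangent_chart At c)" "snd (tangent_chart At c) (bundle_point At c z) = z"
    using assms by (auto simp: tangent_chart_def bundle_point_def prod_eq_iff)
qed

lemma bundle_point_coords:
  "c \<in> At \<Longrightarrow> fst v \<in> fst c \<Longrightarrow> bundle_point At c (snd c (fst v), to_chart At c (fst v) (snd v)) = v"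
  by (simp add: bundle_point_def)

lemma coords_in_domain:
  "c \<in> At \<Longrightarrow> fst v \<in> fst c \<Longrightarrow> v \<in> A \<Longrightarrow> (snd c (fst v), to_chart At c (fst v) (snd v)) \<in> coord_domain c"
  by (simp add: coord_domain_iff bundle_point_coords)

lemma smooth_field_rep:
  assumes "aniso_field At A Y" "c \<in> At"
  shows "smooth_on (coord_domain c) (field_rep At c Y)"
proof (rule smooth_on_cong[OF open_coord_domain[OF assms(2)]])
  show "smooth_on (coord_domain c)
    (\<lambda>x. to_chart At c (fst (chart_inv (tangent_chart At c) x)) (Y (chart_inv (tangent_chart At c) x)))"
    using assms by (auto simp: aniso_field_def coord_domain_def Let_def)
  show "to_chart At c (fst (chart_inv (tangent_chart At c) z)) (Y (chart_inv (tangent_chart At c) z)) = field_rep At c Y z"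
    if "z \<in> coord_domain c" for z
    using that assms(2) by (simp add: coord_domain_iff chart_inv_tangent_chart field_rep_def)
      (simp add: bundle_point_def)
qed

lemma vshift_bundle_point:
  assumes "c \<in> At" "fst z \<in> snd c ` fst c"
  shows "vshift (bundle_point At c z) t w =
    bundle_point At c (z + t *\<^sub>R (0, to_chart At c (chart_inv c (fst z)) w))"
proof -
  have p: "chart_inv c (fst z) \<in> fst c" using assms by auto
  show ?thesis
    using p assms(1) linear_from_chart[OF assms(1) p]
    by (simp add: vshift_def bundle_point_def linear_add linear_cmul)
qed

text \<open>A vertical shift keeps the base point. In coordinates it is therefore a straight motion
  in the fibre variable, and the return to the preferred chart is a single fixed linear map.\<close>

lemma vert_has_derivative:
  assumes Y: "aniso_field At A Y" and c: "c \<in> At" and z: "z \<in> coord_domain c"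
  defines "p \<equiv> chart_inv c (fst z)"
  shows "((\<lambda>t. Y (vshift (bundle_point At c z) t w)) has_vector_derivative
    from_chart At c p (frechet_derivative (field_rep At c Y) (at z) (0, to_chart At c p w))) (at 0)"
proof -
  have zd: "fst z \<in> snd c ` fst c" using z c by (simp add: coord_domain_iff)
  then have p: "p \<in> fst c" using c by (auto simp: p_def)
  let ?F = "field_rep At c Y" and ?w = "(0, to_chart At c p w) :: 'e \<times> 'e"
  have "((\<lambda>t. z + t *\<^sub>R ?w) has_derivative (\<lambda>t. t *\<^sub>R ?w)) (at 0)"
    by (auto intro!: derivative_eq_intros)
  moreover have "(?F has_derivative frechet_derivative ?F (at z)) (at (z + 0 *\<^sub>R ?w))"
    using smooth_on_has_derivative[OF smooth_field_rep[OF Y c] z] by (simp flip: zero_prod_def)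
  ultimately have "((\<lambda>t. ?F (z + t *\<^sub>R ?w)) has_derivative (\<lambda>t. frechet_derivative ?F (at z) (t *\<^sub>R ?w))) (at 0)"
    by (rule has_derivative_compose)
  then have "((\<lambda>t. ?F (z + t *\<^sub>R ?w)) has_vector_derivative frechet_derivative ?F (at z) ?w) (at 0)"
    by (simp only: has_vector_derivative_def
        linear_cmul[OF smooth_on_linear_frechet_derivative[OF smooth_field_rep[OF Y c] z]])
  moreover have "bounded_linear (from_chart At c p)"
    using linear_from_chart[OF c p] by (simp add: linear_linear)
  ultimately have "((\<lambda>t. from_chart At c p (?F (z + t *\<^sub>R ?w))) has_vector_derivative
      from_chart At c p (frechet_derivative ?F (at z) ?w)) (at 0)"
    using bounded_linear.has_vector_derivative by blast
  moreover have "from_chart At c p (?F (z + t *\<^sub>R ?w)) = Y (vshift (bundle_point At c z) t w)" for t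
    using p c by (simp add: vshift_bundle_point[OF c zd] field_rep_def p_def)
  ultimately show ?thesis by simp
qed

end

section \<open>Christoffel maps of an anisotropic connection\<close>

locale aniso_conn = aniso_manifold At A
  for At :: "('m::{t2_space,second_countable_topology}, 'e::euclidean_space) chart set"
    and A :: "('m \<times> 'e) set" +
  fixes N :: "('m, 'e) conn"
  assumes connection: "aniso_connection At A N"
begin

abbreviation gam where "gam \<equiv> christoffel_map At N"

lemma conn_add_right:
  "v \<in> A \<Longrightarrow> vector_field At X \<Longrightarrow> vector_field At Y \<Longrightarrow> vector_field At Z \<Longrightarrow>
    N v X (\<lambda>p. Y p + Z p) = N v X Y + N v X Z"
  using connection unfolding aniso_connection_def by blast

lemma conn_scale_right:
  "v \<in> A \<Longrightarrow> smooth_fun At f \<Longrightarrow> vector_field At X \<Longrightarrow> vector_field At Y \<Longrightarrow>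
    N v X (\<lambda>p. f p *\<^sub>R Y p) = dir_deriv At X f (fst v) *\<^sub>R Y (fst v) + f (fst v) *\<^sub>R N v X Y"
  using connection unfolding aniso_connection_def by blast

lemma conn_combine_left:
  "v \<in> A \<Longrightarrow> smooth_fun At f \<Longrightarrow> smooth_fun At h \<Longrightarrow> vector_field At X \<Longrightarrow> vector_field At Y \<Longrightarrow>
    vector_field At Z \<Longrightarrow>
    N v (\<lambda>p. f p *\<^sub>R X p + h p *\<^sub>R Y p) Z = f (fst v) *\<^sub>R N v X Z + h (fst v) *\<^sub>R N v Y Z"
  using connection unfolding aniso_connection_def by blast

lemma aniso_field_conn: "vector_field At X \<Longrightarrow> vector_field At Y \<Longrightarrow> aniso_field At A (\<lambda>v. N v X Y)"
  using connection unfolding aniso_connection_def by blast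

lemma conn_add_left:
  "v \<in> A \<Longrightarrow> vector_field At X \<Longrightarrow> vector_field At Y \<Longrightarrow> vector_field At Z \<Longrightarrow>
    N v (\<lambda>p. X p + Y p) Z = N v X Z + N v Y Z"
  using conn_combine_left[of v "\<lambda>_. 1" "\<lambda>_. 1" X Y Z] by (simp add: smooth_fun_const)

lemma conn_scale_left:
  "v \<in> A \<Longrightarrow> smooth_fun At f \<Longrightarrow> vector_field At X \<Longrightarrow> vector_field At Z \<Longrightarrow>
    N v (\<lambda>p. f p *\<^sub>R X p) Z = f (fst v) *\<^sub>R N v X Z"
  using conn_combine_left[of v f "\<lambda>_. 0" X X Z] by (simp add: smooth_fun_const)

lemma local_rep_add_eq:
  "c \<in> At \<Longrightarrow> x \<in> snd c ` fst c \<Longrightarrow> local_rep At c (\<lambda>q. X q + Y q) x = local_rep At c X x + local_rep At c Y x"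
  by (auto simp: local_rep_chart linear_add[OF linear_to_chart])

lemma local_rep_scaled_eq:
  "c \<in> At \<Longrightarrow> x \<in> snd c ` fst c \<Longrightarrow>
    local_rep At c (\<lambda>q. f q *\<^sub>R X q) x = (f \<circ> chart_inv c) x *\<^sub>R local_rep At c X x"
  by (auto simp: local_rep_chart linear_cmul[OF linear_to_chart])

text \<open>The difference between the connection and the flat connection of a chart is tensorial.\<close>

definition conn_defect :: "('m, 'e) chart \<Rightarrow> 'm \<times> 'e \<Rightarrow> ('m \<Rightarrow> 'e) \<Rightarrow> ('m \<Rightarrow> 'e) \<Rightarrow> 'e" where
  "conn_defect c v X Y = to_chart At c (fst v) (N v X Y)
    - frechet_derivative (local_rep At c Y) (at (snd c (fst v))) (local_rep At c X (snd c (fst v)))"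

lemma conn_defect_left:
  assumes v: "v \<in> A" and c: "c \<in> At" "fst v \<in> fst c" and Z: "vector_field At Z"
  shows "vector_field At X \<Longrightarrow> vector_field At Y \<Longrightarrow>
      conn_defect c v (\<lambda>q. X q + Y q) Z = conn_defect c v X Z + conn_defect c v Y Z"
    and "smooth_fun At f \<Longrightarrow> vector_field At X \<Longrightarrow>
      conn_defect c v (\<lambda>q. f q *\<^sub>R X q) Z = f (fst v) *\<^sub>R conn_defect c v X Z"
proof -
  have l: "linear (frechet_derivative (local_rep At c Z) (at (snd c (fst v))))"
    using local_rep_has_derivative[OF Z c] has_derivative_linear by blast
  note lt = linear_to_chart[OF c]
  have x: "snd c (fst v) \<in> snd c ` fst c" using c by auto
  show "conn_defect c v (\<lambda>q. X q + Y q) Z = conn_defect c v X Z + conn_defect c v Y Z"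
    if "vector_field At X" "vector_field At Y"
    by (simp add: conn_defect_def conn_add_left[OF v that Z] linear_add[OF lt]
        local_rep_add_eq[OF c(1) x] linear_add[OF l])
  show "conn_defect c v (\<lambda>q. f q *\<^sub>R X q) Z = f (fst v) *\<^sub>R conn_defect c v X Z"
    if "smooth_fun At f" "vector_field At X"
    using c by (simp add: conn_defect_def conn_scale_left[OF v that Z] linear_cmul[OF lt]
        local_rep_scaled_eq[OF c(1) x] linear_cmul[OF l] algebra_simps)
qed

text \<open>The term X(f) Y from the Leibniz rule of the connection is also what differentiating the
  components of f Y produces; the two cancel, so the defect is function-linear in this argument
  too.\<close>

lemma conn_defect_right:
  assumes v: "v \<in> A" and c: "c \<in> At" "fst v \<in> fst c" and X: "vector_field At X"
  shows "vector_field At Y \<Longrightarrow> vector_field At Z \<Longrightarrow>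
      conn_defect c v X (\<lambda>q. Y q + Z q) = conn_defect c v X Y + conn_defect c v X Z"
    and "smooth_fun At f \<Longrightarrow> vector_field At Y \<Longrightarrow>
      conn_defect c v X (\<lambda>q. f q *\<^sub>R Y q) = f (fst v) *\<^sub>R conn_defect c v X Y"
proof -
  note lt = linear_to_chart[OF c]
  have x: "snd c (fst v) \<in> snd c ` fst c" using c by auto
  show "conn_defect c v X (\<lambda>q. Y q + Z q) = conn_defect c v X Y + conn_defect c v X Z"
    if Y: "vector_field At Y" and Z: "vector_field At Z"
  proof -
    have "(local_rep At c (\<lambda>q. Y q + Z q) has_derivative
       (\<lambda>k. frechet_derivative (local_rep At c Y) (at (snd c (fst v))) k + frechet_derivative (local_rep At c Z) (at (snd c (fst v))) k))
       (at (snd c (fst v)))"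
      by (rule has_derivative_transform_within_open[OF has_derivative_add[OF local_rep_has_derivative[OF Y c]
          local_rep_has_derivative[OF Z c]] open_chart_image[OF c(1)] x])
        (simp add: local_rep_add_eq[OF c(1)])
    from frechet_derivative_at[OF this, symmetric] show ?thesis
      by (simp add: conn_defect_def conn_add_right[OF v X Y Z] linear_add[OF lt])
  qed
  show "conn_defect c v X (\<lambda>q. f q *\<^sub>R Y q) = f (fst v) *\<^sub>R conn_defect c v X Y"
    if f: "smooth_fun At f" and Y: "vector_field At Y"
  proof -
    have "(local_rep At c (\<lambda>q. f q *\<^sub>R Y q) has_derivative
       (\<lambda>k. (f \<circ> chart_inv c) (snd c (fst v)) *\<^sub>R frechet_derivative (local_rep At c Y) (at (snd c (fst v))) k +
          frechet_derivative (f \<circ> chart_inv c) (at (snd c (fst v))) k *\<^sub>R local_rep At c Y (snd c (fst v))))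
       (at (snd c (fst v)))"
      by (rule has_derivative_transform_within_open[OF has_derivative_scaleR[OF
          smooth_on_has_derivative[OF smooth_funD[OF f c(1)] x] local_rep_has_derivative[OF Y c]]
          open_chart_image[OF c(1)] x])
        (simp add: local_rep_scaled_eq[OF c(1)])
    from frechet_derivative_at[OF this, symmetric] show ?thesis
      using c by (simp add: conn_defect_def conn_scale_right[OF v f X Y] linear_add[OF lt] linear_cmul[OF lt]
        dir_deriv_rep[OF c f] local_rep_chart algebra_simps)
  qed
qed

lemma gam_conn_defect:
  assumes "c \<in> At" "z \<in> coord_domain c"
  defines "p \<equiv> chart_inv c (fst z)"
  shows "gam c z \<xi> \<eta> = conn_defect c (bundle_point At c z)
    (field_through At p (from_chart At c p \<xi>)) (field_through At p (from_chart At c p \<eta>))"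
  using assms by (simp add: christoffel_map_def conn_defect_def Let_def coord_domain_iff)
    (simp add: bundle_point_def)

text \<open>Since the defect is tensorial in both arguments, X and Y can be exchanged for the fields
  that \<open>christoffel_map\<close> selects through their values. The formula holds in every chart
  around the base point.\<close>

lemma conn_rep:
  assumes c: "c \<in> At" and z: "z \<in> coord_domain c" and X: "vector_field At X" and Y: "vector_field At Y"
  shows "to_chart At c (chart_inv c (fst z)) (N (bundle_point At c z) X Y) =
    frechet_derivative (local_rep At c Y) (at (fst z)) (local_rep At c X (fst z)) +
    gam c z (local_rep At c X (fst z)) (local_rep At c Y (fst z))"
proof -
  define p where "p = chart_inv c (fst z)"
  define v where "v = bundle_point At c z"
  have v: "v \<in> A" "fst v = p" "fst z \<in> snd c ` fst c"
    using z c by (auto simp: coord_domain_iff v_def bundle_point_def p_def)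
  have p: "p \<in> fst c" "snd c p = fst z" using v(3) c by (auto simp: p_def)
  have c': "fst v \<in> fst c" using p v by simp
  let ?X = "field_through At (fst v) (X (fst v))" and ?Y = "field_through At (fst v) (Y (fst v))"
  have "conn_defect c v X Y = conn_defect c v ?X Y"
    by (rule tensorial(1)[of "\<lambda>X. conn_defect c v X Y" "fst v"])
      (auto intro: conn_defect_left[OF v(1) c c' Y] X field_through simp: field_through(2))
  also have "\<dots> = conn_defect c v ?X ?Y"
    by (rule tensorial(1)[of "conn_defect c v ?X" "fst v"])
      (auto intro: conn_defect_right[OF v(1) c c'] Y field_through simp: field_through(2))
  also have "\<dots> = gam c z (local_rep At c X (fst z)) (local_rep At c Y (fst z))"
    using p c by (simp add: gam_conn_defect[OF c z] p(2)[symmetric] local_rep_chart v(2) flip: v_def p_def)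
  finally show ?thesis
    by (simp add: conn_defect_def v(2) p(2) diff_eq_eq add.commute flip: v_def p_def)
qed

lemma linear_gam:
  assumes c: "c \<in> At" and z: "z \<in> coord_domain c"
  shows "linear (\<lambda>\<xi>. gam c z \<xi> \<eta>)" "linear (gam c z \<xi>)"
proof -
  define p where "p = chart_inv c (fst z)"
  define v where "v = bundle_point At c z"
  have v: "v \<in> A" "fst v = p" "fst z \<in> snd c ` fst c"
    using z c by (auto simp: coord_domain_iff v_def bundle_point_def p_def)
  have p: "p \<in> fst c" using v(3) c by (auto simp: p_def)
  have c': "fst v \<in> fst c" using p v by simp
  let ?E = "\<lambda>\<xi>. field_through At p (from_chart At c p \<xi>)"
  have "linear (\<lambda>x. conn_defect c v (field_through At p x) (?E \<eta>))"
    by (rule tensorial(2)[of "\<lambda>X. conn_defect c v X (?E \<eta>)" p])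
      (auto simp: conn_defect_left[OF v(1) c c' field_through(1)] v(2))
  from linear_compose[OF linear_from_chart[OF c p] this]
  show "linear (\<lambda>\<xi>. gam c z \<xi> \<eta>)"
    by (simp add: o_def gam_conn_defect[OF c z] v_def p_def)
  have "linear (\<lambda>x. conn_defect c v (?E \<xi>) (field_through At p x))"
    by (rule tensorial(2)[of "conn_defect c v (?E \<xi>)" p])
      (auto simp: conn_defect_right[OF v(1) c c' field_through(1)] v(2))
  from linear_compose[OF linear_from_chart[OF c p] this]
  have "linear (\<lambda>\<eta>. gam c z \<xi> \<eta>)"
    by (simp add: o_def gam_conn_defect[OF c z] v_def p_def)
  then show "linear (gam c z \<xi>)" by simp
qed

text \<open>The components are constant on a whole neighbourhood of p, so the flat derivative in
  \<open>conn_rep\<close> vanishes there and not merely at p.\<close>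

lemma local_rep_globalized_coord:
  assumes c: "c \<in> At" "p \<in> fst c"
  obtains S where "open S" "snd c p \<in> S" "S \<subseteq> snd c ` fst c"
    "\<And>x. x \<in> S \<Longrightarrow> local_rep At c (globalize At p (coord_field At c b)) x = b"
    "\<And>x. x \<in> S \<Longrightarrow> frechet_derivative (local_rep At c (globalize At p (coord_field At c b))) (at x) = (\<lambda>_. 0)"
    "vector_field At (globalize At p (coord_field At c b))"
proof -
  obtain W where W: "vector_field At (globalize At p (coord_field At c b))" "open W" "p \<in> W"
    "\<And>q. q \<in> W \<Longrightarrow> globalize At p (coord_field At c b) q = coord_field At c b q"
    using globalize[OF coord_field_on[OF c(1)] open_chart_domain[OF c(1)] c(2)] by blast
  let ?S = "snd c ` (W \<inter> fst c)"
  have S: "open ?S" by (rule open_chart_image_Int[OF c(1) W(2)])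
  have eq: "local_rep At c (globalize At p (coord_field At c b)) x = b" if "x \<in> ?S" for x
    using that c W(4) by (auto simp: local_rep_chart coord_field_def)
  have "frechet_derivative (local_rep At c (globalize At p (coord_field At c b))) (at x) = (\<lambda>_. 0)" if "x \<in> ?S" for x
    using frechet_derivative_cong_open[OF S that, of _ "\<lambda>_. b"] eq by (simp add: frechet_derivative_const)
  with that[of ?S] S eq W c show ?thesis by auto
qed

text \<open>\<open>christoffel_map\<close> selects its fields anew at each base point, so its
  definition shows no smoothness. Near a given z one fixed pair of globalized coordinate fields
  computes it at all points at once, and the connection applied to a fixed pair is smooth.\<close>

lemma smooth_gam:
  assumes c: "c \<in> At"
  shows "smooth_on (coord_domain c) (\<lambda>z. gam c z \<xi> \<eta>)"
proof (rule smooth_on_local)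
  fix z assume z: "z \<in> coord_domain c"
  define p where "p = chart_inv c (fst z)"
  have p: "p \<in> fst c" "snd c p = fst z" using z c by (auto simp: coord_domain_iff p_def)
  let ?E = "\<lambda>b. globalize At p (coord_field At c b)"
  obtain S where S: "open S" "snd c p \<in> S" "S \<subseteq> snd c ` fst c" "\<And>x. x \<in> S \<Longrightarrow> local_rep At c (?E \<xi>) x = \<xi>"
    "vector_field At (?E \<xi>)"
    using local_rep_globalized_coord[OF c p(1), of \<xi>] by metis
  obtain S' where S': "open S'" "snd c p \<in> S'" "\<And>x. x \<in> S' \<Longrightarrow> local_rep At c (?E \<eta>) x = \<eta>"
    "\<And>x. x \<in> S' \<Longrightarrow> frechet_derivative (local_rep At c (?E \<eta>)) (at x) = (\<lambda>_. 0)" "vector_field At (?E \<eta>)"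
    using local_rep_globalized_coord[OF c p(1), of \<eta>] by metis
  let ?T = "coord_domain c \<inter> (S \<inter> S') \<times> UNIV"
  have T: "open ?T"
    using open_coord_domain[OF c] S(1) S'(1) by (intro open_Int open_Times) auto
  have "smooth_on ?T (field_rep At c (\<lambda>v. N v (?E \<xi>) (?E \<eta>)))"
    by (rule smooth_on_subset[OF smooth_field_rep[OF aniso_field_conn[OF S(5) S'(5)] c]]) auto
  then have "smooth_on ?T (\<lambda>z. gam c z \<xi> \<eta>)"
    by (rule smooth_on_cong[OF T])
      (auto simp: field_rep_def conn_rep[OF c _ S(5) S'(5)] S(4) S'(3,4))
  moreover have "z \<in> ?T" using z p S(2) S'(2) by (cases z) auto
  ultimately show "\<exists>T. open T \<and> z \<in> T \<and> smooth_on T (\<lambda>z. gam c z \<xi> \<eta>)"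
    using T by blast
qed

text \<open>In a chart the bracket is exactly the difference of the two flat derivative terms, so
  vanishing torsion leaves the antisymmetric part of the Christoffel map equal to zero.\<close>

lemma gam_symmetric:
  assumes tf: "torsion_free At A N" and c: "c \<in> At" and z: "z \<in> coord_domain c"
  shows "gam c z \<xi> \<eta> = gam c z \<eta> \<xi>"
proof -
  define p where "p = chart_inv c (fst z)"
  have p: "p \<in> fst c" "snd c p = fst z" and v: "bundle_point At c z \<in> A"
    using z c by (auto simp: coord_domain_iff p_def)
  let ?X = "field_through At p (from_chart At c p \<xi>)" and ?Y = "field_through At p (from_chart At c p \<eta>)"
  have rep: "local_rep At c ?X (fst z) = \<xi>" "local_rep At c ?Y (fst z) = \<eta>"
    using p c by (simp_all add: p(2)[symmetric] local_rep_chart field_through(2))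
  have "N (bundle_point At c z) ?X ?Y - N (bundle_point At c z) ?Y ?X - lie_bracket At ?X ?Y p = 0"
    using tf v field_through(1) unfolding torsion_free_def torsion_def p_def
    by (metis bundle_point_def fst_conv)
  then have "N (bundle_point At c z) ?X ?Y = N (bundle_point At c z) ?Y ?X + lie_bracket At ?X ?Y p" by (simp add: algebra_simps)
  then have "to_chart At c p (N (bundle_point At c z) ?X ?Y) =
      to_chart At c p (N (bundle_point At c z) ?Y ?X) + to_chart At c p (lie_bracket At ?X ?Y p)"
    by (simp add: linear_add[OF linear_to_chart[OF c p(1)]])
  then show ?thesis
    using conn_rep[OF c z field_through(1) field_through(1), of p "from_chart At c p \<xi>" p "from_chart At c p \<eta>"]
      conn_rep[OF c z field_through(1) field_through(1), of p "from_chart At c p \<eta>" p "from_chart At c p \<xi>"]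
      lie_bracket_rep[OF c p(1) field_through(1)[of p "from_chart At c p \<xi>"] field_through(1)[of p "from_chart At c p \<eta>"]]
    by (simp add: rep p(2) flip: p_def)
qed

text \<open>Both sides come from the same vector \<open>N v X Y\<close> read in two charts; the flat
  derivatives differ by the Hessian term of \<open>local_rep_derivative_change\<close>.\<close>

lemma gam_change:
  assumes c: "c \<in> At" "c' \<in> At" "fst v \<in> fst c" "fst v \<in> fst c'" and v: "v \<in> A"
  shows "tangent_trans c c' (fst v) (gam c (snd c (fst v), to_chart At c (fst v) (snd v)) \<xi> \<eta>) =
    gam c' (snd c' (fst v), to_chart At c' (fst v) (snd v)) (tangent_trans c c' (fst v) \<xi>) (tangent_trans c c' (fst v) \<eta>)
    + hessian c c' (fst v) \<xi> \<eta>"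
proof -
  let ?p = "fst v"
  let ?X = "field_through At ?p (from_chart At c ?p \<xi>)" and ?Y = "field_through At ?p (from_chart At c ?p \<eta>)"
  have rep: "local_rep At c ?X (snd c ?p) = \<xi>" "local_rep At c ?Y (snd c ?p) = \<eta>"
    "local_rep At c' ?X (snd c' ?p) = tangent_trans c c' ?p \<xi>" "local_rep At c' ?Y (snd c' ?p) = tangent_trans c c' ?p \<eta>"
    using c by (simp_all add: local_rep_chart field_through(2) to_chart_change[OF c])
  have "to_chart At c' ?p (N v ?X ?Y) = tangent_trans c c' ?p (to_chart At c ?p (N v ?X ?Y))"
    by (rule to_chart_change[OF c])
  then show ?thesis
    using conn_rep[OF c(1) coords_in_domain[OF c(1) c(3) v] field_through(1) field_through(1), of ?p "from_chart At c ?p \<xi>" ?p "from_chart At c ?p \<eta>"]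
      conn_rep[OF c(2) coords_in_domain[OF c(2) c(4) v] field_through(1) field_through(1), of ?p "from_chart At c ?p \<xi>" ?p "from_chart At c ?p \<eta>"]
    using c by (simp add: bundle_point_coords rep local_rep_derivative_change[OF c field_through(1)]
        linear_add[OF linear_tangent_trans[OF c]])
qed

end

section \<open>Curvature in a chart\<close>

lemma has_vector_derivative_compose:
  assumes "(f has_vector_derivative d) (at t within S)" "(g has_derivative g') (at (f t))"
  shows "((\<lambda>\<tau>. g (f \<tau>)) has_vector_derivative g' d) (at t within S)"
  using has_derivative_compose[OF assms(1)[unfolded has_vector_derivative_def] assms(2)]
    linear_cmul[OF has_derivative_linear[OF assms(2)]]
  by (simp add: has_vector_derivative_def)

context aniso_manifold
begin

lemma coord_domainD:
  assumes "c \<in> At" "z \<in> coord_domain c"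
  shows "chart_inv c (fst z) \<in> fst c" "snd c (chart_inv c (fst z)) = fst z"
    "fst z \<in> snd c ` fst c" "bundle_point At c z \<in> A" "fst (bundle_point At c z) = chart_inv c (fst z)"
    "to_chart At c (chart_inv c (fst z)) (snd (bundle_point At c z)) = snd z"
  using assms by (auto simp: coord_domain_iff) (auto simp: bundle_point_def)

text \<open>Justifies the choice made in \<open>conn_aniso\<close>. The field with constant
  components in a chart stays in \<open>A\<close> near the base point because the coordinate domain
  is open.\<close>

lemma admissible_extension_exists:
  assumes v: "v \<in> A"
  shows "\<exists>V. admissible_extension At A v V"
proof -
  define c where "c = chart_at At (fst v)"
  have c: "c \<in> At" "fst v \<in> fst c" by (auto simp: c_def chart_at)
  define y where "y = to_chart At c (fst v) (snd v)"
  define \<Omega> where "\<Omega> = {q \<in> fst c. snd c q \<in> (\<lambda>x. (x, y)) -` coord_domain c}"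
  have "open ((\<lambda>x. (x, y)) -` coord_domain c)"
    by (intro open_vimage open_coord_domain c continuous_intros)
  then have o: "open \<Omega>" unfolding \<Omega>_def by (rule open_chart_preimage[OF c(1)])
  have "fst v \<in> \<Omega>"
    using coords_in_domain[OF c v] c by (simp add: \<Omega>_def y_def)
  moreover have "vector_field_on At \<Omega> (coord_field At c y)"
    by (rule vector_field_on_chartI[OF c(1) o, of "\<lambda>_. y"])
      (use c open_chart_image_subset[OF c(1) o] in \<open>auto simp: \<Omega>_def coord_field_def intro: smooth_on_const\<close>)
  moreover have "(q, coord_field At c y q) \<in> A" if "q \<in> \<Omega>" for q
  proof -
    have "(snd c q, y) \<in> coord_domain c" using that by (simp add: \<Omega>_def)
    from coord_domainD(4)[OF c(1) this] show ?thesis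
      using that c by (simp add: bundle_point_def coord_field_def \<Omega>_def)
  qed
  moreover have "coord_field At c y (fst v) = snd v"
    using c by (simp add: coord_field_def y_def)
  ultimately show ?thesis
    unfolding admissible_extension_def using o by blast
qed

end

context aniso_conn
begin

text \<open>The arguments \<xi> and \<eta> are frozen. A direction (h, 0) differentiates along M in
  the chart, and (0, w) gives the vertical derivative.\<close>

definition dgam :: "('m, 'e) chart \<Rightarrow> 'e \<times> 'e \<Rightarrow> 'e \<Rightarrow> 'e \<Rightarrow> 'e \<times> 'e \<Rightarrow> 'e" where
  "dgam c z \<xi> \<eta> = frechet_derivative (\<lambda>z. gam c z \<xi> \<eta>) (at z)"

lemma gam_has_derivative:
  "c \<in> At \<Longrightarrow> z \<in> coord_domain c \<Longrightarrow> ((\<lambda>z. gam c z \<xi> \<eta>) has_derivative dgam c z \<xi> \<eta>) (at z)"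
  unfolding dgam_def by (rule smooth_on_has_derivative[OF smooth_gam])

lemma linear_dgam: "c \<in> At \<Longrightarrow> z \<in> coord_domain c \<Longrightarrow> linear (dgam c z \<xi> \<eta>)"
  using gam_has_derivative has_derivative_linear by blast

text \<open>The derivatives of the extension \<open>V\<close> of \<open>v\<close> cancel.\<close>

lemma conn_aniso_rep:
  assumes c: "c \<in> At" and z: "z \<in> coord_domain c" and X: "vector_field At X" and Y: "aniso_field At A Y"
  defines "p \<equiv> chart_inv c (fst z)"
  shows "to_chart At c p (conn_aniso At A N (bundle_point At c z) X Y) =
    frechet_derivative (field_rep At c Y) (at z)
      (local_rep At c X (fst z), - gam c z (local_rep At c X (fst z)) (snd z))
    + gam c z (local_rep At c X (fst z)) (field_rep At c Y z)"
proof -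
  define v where "v = bundle_point At c z"
  note d = coord_domainD[OF c z]
  have p: "p \<in> fst c" "snd c p = fst z" "fst v = p" "v \<in> A" "to_chart At c p (snd v) = snd z"
    using d by (simp_all add: p_def v_def)
  define V where "V = (SOME V. admissible_extension At A v V)"
  have "admissible_extension At A v V"
    unfolding V_def using admissible_extension_exists[OF p(4)] by (rule someI_ex)
  then obtain \<Omega> where \<Omega>: "open \<Omega>" "p \<in> \<Omega>" "vector_field_on At \<Omega> V" "\<And>q. q \<in> \<Omega> \<Longrightarrow> (q, V q) \<in> A"
    and Vp: "V p = snd v"
    unfolding admissible_extension_def p(3) by auto
  let ?F = "field_rep At c Y" and ?V = "local_rep At c V" and ?x = "fst z"
  let ?X = "local_rep At c X ?x"
  let ?S = "snd c ` (\<Omega> \<inter> fst c)"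
  have S: "open ?S" "?x \<in> ?S"
    using open_chart_image_Int[OF c \<Omega>(1)] \<Omega>(2) p(1,2) by (auto intro: rev_image_eqI)
  have Vx: "?V ?x = snd z" using p c Vp by (metis local_rep_chart)
  have smV: "smooth_on ?S ?V" by (rule vector_field_onD[OF \<Omega>(3) c])
  note smF = smooth_field_rep[OF Y c]
  let ?DF = "frechet_derivative ?F (at z)" and ?DV = "frechet_derivative ?V (at ?x)"
  have DV: "(?V has_derivative ?DV) (at ?x)" by (rule smooth_on_has_derivative[OF smV S(2)])
  have DF: "(?F has_derivative ?DF) (at z)" by (rule smooth_on_has_derivative[OF smF z])
  have lDF: "linear ?DF" using DF has_derivative_linear by blast
  have inD: "(x, ?V x) \<in> coord_domain c" if "x \<in> ?S" for x
  proof -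
    from that obtain q where q: "q \<in> \<Omega>" "q \<in> fst c" "x = snd c q" by auto
    then show ?thesis using coords_in_domain[OF c, of "(q, V q)"] \<Omega>(4) c by (simp add: local_rep_chart)
  qed

  obtain W1 where W1: "vector_field At (globalize At p V)" "open W1" "p \<in> W1" "\<And>q. q \<in> W1 \<Longrightarrow> globalize At p V q = V q"
    using globalize[OF \<Omega>(3,1,2)] by blast
  \<comment> \<open>\<open>globalize\<close> fixes only the germ at p, which is enough to determine
    the value and the first derivative of the components there.\<close>
  have germ: "frechet_derivative (local_rep At c G) (at ?x) = frechet_derivative g (at ?x)"
    "local_rep At c G ?x = g ?x"
    if W: "open W" "p \<in> W" and g: "\<And>q. q \<in> W \<Longrightarrow> q \<in> fst c \<Longrightarrow> to_chart At c q (G q) = g (snd c q)" for G W g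
  proof -
    have "?x \<in> snd c ` (W \<inter> fst c)" using W p(1,2) by (auto intro: rev_image_eqI)
    then show "frechet_derivative (local_rep At c G) (at ?x) = frechet_derivative g (at ?x)"
      by (rule frechet_derivative_cong_open[OF open_chart_image_Int[OF c W(1)]])
        (use g c in \<open>auto simp: local_rep_chart\<close>)
    show "local_rep At c G ?x = g ?x" using g[OF W(2) p(1)] c p by (metis local_rep_chart)
  qed
  have W1rep: "to_chart At c p (N v X (globalize At p V)) = ?DV ?X + gam c z ?X (snd z)"
    using conn_rep[OF c z X W1(1)] germ[OF W1(2,3), of "globalize At p V" ?V] W1(4) c Vx
    by (simp add: local_rep_chart flip: p_def v_def)

  let ?W = "\<lambda>q. Y (q, V q)"
  have Wq: "to_chart At c q (?W q) = ?F (snd c q, ?V (snd c q))" if "q \<in> fst c" for q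
    using that c by (simp add: field_rep_def bundle_point_def local_rep_chart)
  have smW: "smooth_on ?S (\<lambda>x. ?F (x, ?V x))"
    by (rule smooth_on_compose[OF smF smooth_on_Pair[OF S(1) smooth_on_ident[OF S(1)] smV] S(1) open_coord_domain[OF c]])
      (use inD in auto)
  have "vector_field_on At (\<Omega> \<inter> fst c) ?W"
    by (rule vector_field_on_chartI[OF c _ _ smW]) (use Wq \<Omega>(1) open_chart_domain[OF c] in auto)
  then obtain W2 where W2: "vector_field At (globalize At p ?W)" "open W2" "p \<in> W2" "\<And>q. q \<in> W2 \<Longrightarrow> globalize At p ?W q = ?W q"
    using globalize[of "\<Omega> \<inter> fst c" ?W p] \<Omega>(1,2) p(1) open_chart_domain[OF c] by blast
  have "((\<lambda>x. (x, ?V x)) has_derivative (\<lambda>k. (k, ?DV k))) (at ?x)"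
    by (intro has_derivative_Pair has_derivative_ident DV)
  moreover have "(?F has_derivative ?DF) (at (?x, ?V ?x))" using DF by (simp add: Vx)
  ultimately have "((\<lambda>x. ?F (x, ?V x)) has_derivative (\<lambda>k. ?DF (k, ?DV k))) (at ?x)"
    by (rule has_derivative_compose)
  from frechet_derivative_at[OF this, symmetric]
  have W2rep: "to_chart At c p (N v X (globalize At p ?W)) = ?DF (?X, ?DV ?X) + gam c z ?X (?F z)"
    using conn_rep[OF c z X W2(1)] germ[OF W2(2,3), of "globalize At p ?W" "\<lambda>x. ?F (x, ?V x)"] W2(4) Wq Vx
    by (simp flip: p_def v_def)

  have "vector_derivative (\<lambda>t. Y (vshift v t w)) (at 0) = from_chart At c p (?DF (0, to_chart At c p w))" for w
    unfolding v_def p_def by (rule vector_derivative_at[OF vert_has_derivative[OF Y c z]])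
  then have vert: "to_chart At c p (vert_deriv Y v w) = ?DF (0, to_chart At c p w)" for w
    using c p by (simp add: vert_deriv_def)

  have "to_chart At c p (conn_aniso At A N v X Y) =
      to_chart At c p (N v X (globalize At p ?W)) - to_chart At c p (vert_deriv Y v (N v X (globalize At p V)))"
    by (simp add: conn_aniso_def Let_def p(3) linear_diff[OF linear_to_chart[OF c p(1)]] flip: V_def)
  also have "\<dots> = ?DF (?X, ?DV ?X) - ?DF (0, ?DV ?X + gam c z ?X (snd z)) + gam c z ?X (?F z)"
    by (simp add: W2rep vert W1rep)
  also have "?DF (?X, ?DV ?X) - ?DF (0, ?DV ?X + gam c z ?X (snd z)) = ?DF (?X, - gam c z ?X (snd z))"
    by (simp flip: linear_diff[OF lDF])
  finally show ?thesis by (simp add: v_def)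
qed

text \<open>The pair \<open>(a, - gam c z a (snd z))\<close> is the horizontal lift of a at z. Using
  it as direction merges the base derivative and the vertical correction of the curvature formula
  into one application of \<open>dgam\<close>.\<close>

definition curvature_map :: "('m, 'e) chart \<Rightarrow> 'e \<times> 'e \<Rightarrow> 'e \<Rightarrow> 'e \<Rightarrow> 'e \<Rightarrow> 'e" where
  "curvature_map c z a b d =
     dgam c z b d (a, - gam c z a (snd z)) + gam c z a (gam c z b d)
     - dgam c z a d (b, - gam c z b (snd z)) - gam c z b (gam c z a d)"

text \<open>Product rule applied to \<open>conn_rep\<close>. The vertical direction l appears only
  in \<open>dgam\<close>, because Y and Z are fields on M and do not depend on the fibre
  variable.\<close>

lemma conn_field_rep_derivative:
  assumes c: "c \<in> At" and z: "z \<in> coord_domain c" and Y: "vector_field At Y" and Z: "vector_field At Z"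
  shows "frechet_derivative (field_rep At c (\<lambda>w. N w Y Z)) (at z) (k, l) =
    frechet_derivative (\<lambda>u. frechet_derivative (local_rep At c Z) (at u) (local_rep At c Y (fst z))) (at (fst z)) k
    + frechet_derivative (local_rep At c Z) (at (fst z)) (frechet_derivative (local_rep At c Y) (at (fst z)) k)
    + dgam c z (local_rep At c Y (fst z)) (local_rep At c Z (fst z)) (k, l)
    + gam c z (frechet_derivative (local_rep At c Y) (at (fst z)) k) (local_rep At c Z (fst z))
    + gam c z (local_rep At c Y (fst z)) (frechet_derivative (local_rep At c Z) (at (fst z)) k)"
proof -
  let ?Y = "local_rep At c Y" and ?Z = "local_rep At c Z" and ?x = "fst z"
  let ?DY = "frechet_derivative ?Y (at ?x)" and ?DZ = "frechet_derivative ?Z (at ?x)"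
  let ?S = "snd c ` fst c"
  note d = coord_domainD[OF c z]
  note S = open_chart_image[OF c]
  have Y': "(?Y has_derivative ?DY) (at ?x)" and Z': "(?Z has_derivative ?DZ) (at ?x)"
    using smooth_on_has_derivative[OF vector_fieldD[OF Y c] d(3)] smooth_on_has_derivative[OF vector_fieldD[OF Z c] d(3)] .
  have fst': "(fst has_derivative fst) (at z)" by (rule has_derivative_fst[OF has_derivative_ident])
  have "((\<lambda>u. frechet_derivative ?Z (at u) (?Y u)) has_derivative
      (\<lambda>k. frechet_derivative (\<lambda>u. frechet_derivative ?Z (at u) (?Y ?x)) (at ?x) k + ?DZ (?DY k))) (at ?x)"
    by (rule has_derivative_linear_family[OF S d(3) _ _ Y'])
      (use smooth_on_linear_frechet_derivative[OF vector_fieldD[OF Z c]]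
        smooth_on_has_derivative[OF smooth_on_directional[OF vector_fieldD[OF Z c]] d(3)] in auto)
  from has_derivative_compose[OF fst' this]
  have 1: "((\<lambda>w. frechet_derivative ?Z (at (fst w)) (?Y (fst w))) has_derivative
      (\<lambda>k. frechet_derivative (\<lambda>u. frechet_derivative ?Z (at u) (?Y ?x)) (at ?x) (fst k) + ?DZ (?DY (fst k)))) (at z)" .
  have 2: "((\<lambda>w. gam c w (?Y (fst w)) (?Z (fst w))) has_derivative
      (\<lambda>k. dgam c z (?Y ?x) (?Z ?x) k + gam c z (?DY (fst k)) (?Z ?x) + gam c z (?Y ?x) (?DZ (fst k)))) (at z)"
    by (rule has_derivative_bilinear_family[OF open_coord_domain[OF c] z linear_gam[OF c]
        gam_has_derivative[OF c z] has_derivative_compose[OF fst' Y'] has_derivative_compose[OF fst' Z']])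
  have "(field_rep At c (\<lambda>w. N w Y Z) has_derivative
      (\<lambda>k. (frechet_derivative (\<lambda>u. frechet_derivative ?Z (at u) (?Y ?x)) (at ?x) (fst k) + ?DZ (?DY (fst k)))
        + (dgam c z (?Y ?x) (?Z ?x) k + gam c z (?DY (fst k)) (?Z ?x) + gam c z (?Y ?x) (?DZ (fst k))))) (at z)"
    by (rule has_derivative_transform_within_open[OF has_derivative_add[OF 1 2] open_coord_domain[OF c] z])
      (simp add: field_rep_def conn_rep[OF c _ Y Z])
  from frechet_derivative_at[OF this, symmetric] show ?thesis by (simp add: add_ac)
qed

text \<open>All derivatives of the fields cancel: the second derivatives of Z by symmetry, the terms
  with DY(X) - DX(Y) against the bracket term, and each Christoffel term containing DZ against its
  counterpart with X and Y exchanged.\<close>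

lemma curvature_on_fields_rep:
  assumes c: "c \<in> At" and z: "z \<in> coord_domain c"
    and X: "vector_field At X" and Y: "vector_field At Y" and Z: "vector_field At Z"
  defines "p \<equiv> chart_inv c (fst z)"
  shows "to_chart At c p (curvature_on_fields At A N (bundle_point At c z) X Y Z) =
    curvature_map c z (local_rep At c X (fst z)) (local_rep At c Y (fst z)) (local_rep At c Z (fst z))"
proof -
  note d = coord_domainD[OF c z]
  have p: "p \<in> fst c" "snd c p = fst z" using d by (simp_all add: p_def)
  let ?x = "fst z" and ?X = "local_rep At c X (fst z)" and ?Y = "local_rep At c Y (fst z)" and ?Z = "local_rep At c Z (fst z)"
  let ?DX = "frechet_derivative (local_rep At c X) (at ?x)"
    and ?DY = "frechet_derivative (local_rep At c Y) (at ?x)" and ?DZ = "frechet_derivative (local_rep At c Z) (at ?x)"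
  have br: "local_rep At c (lie_bracket At X Y) ?x = ?DY ?X - ?DX ?Y"
    using lie_bracket_rep[OF c p(1) X Y] c p by (metis local_rep_chart)
  have sym: "frechet_derivative (\<lambda>u. frechet_derivative (local_rep At c Z) (at u) ?Y) (at ?x) ?X =
      frechet_derivative (\<lambda>u. frechet_derivative (local_rep At c Z) (at u) ?X) (at ?x) ?Y"
    by (rule second_derivative_symmetric[OF open_chart_image[OF c] d(3) vector_fieldD[OF Z c]])
  have lZ: "linear ?DZ"
    using smooth_on_linear_frechet_derivative[OF vector_fieldD[OF Z c] d(3)] .
  note lg = linear_gam[OF c z]
  have F: "field_rep At c (\<lambda>w. N w U V) z = frechet_derivative (local_rep At c V) (at ?x) (local_rep At c U ?x)
      + gam c z (local_rep At c U ?x) (local_rep At c V ?x)" if "vector_field At U" "vector_field At V" for U V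
    by (simp add: field_rep_def conn_rep[OF c z that])
  show ?thesis
    unfolding curvature_on_fields_def curvature_map_def linear_diff[OF linear_to_chart[OF c p(1)]]
    unfolding p_def conn_aniso_rep[OF c z X aniso_field_conn[OF Y Z]] conn_aniso_rep[OF c z Y aniso_field_conn[OF X Z]]
      conn_field_rep_derivative[OF c z Y Z] conn_field_rep_derivative[OF c z X Z]
      conn_rep[OF c z vector_field_lie_bracket[OF X Y] Z] F[OF Y Z] F[OF X Z] br
      linear_diff[OF lZ] linear_add[OF lg(2)] linear_diff[OF lg(1)] sym
    by (simp add: algebra_simps)
qed

lemma curvature_rep:
  assumes c: "c \<in> At" "fst v \<in> fst c" and v: "v \<in> A"
  shows "to_chart At c (fst v) (curvature At A N v a b d) =
    curvature_map c (snd c (fst v), to_chart At c (fst v) (snd v))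
      (to_chart At c (fst v) a) (to_chart At c (fst v) b) (to_chart At c (fst v) d)"
  using curvature_on_fields_rep[OF c(1) coords_in_domain[OF c v] field_through(1) field_through(1) field_through(1),
      of "fst v" a "fst v" b "fst v" d] c
  by (simp add: curvature_def bundle_point_coords local_rep_chart field_through(2))

end

section \<open>Fields along curves in a chart\<close>

context smooth_manifold
begin

text \<open>The curve is controlled through its coordinates in c: continuity keeps them in the open
  image of the overlap, and injectivity of the chart leads back to the points.\<close>

lemma eventually_in_chart:
  assumes c: "c \<in> At" "c' \<in> At" "\<gamma> t \<in> fst c" "\<gamma> t \<in> fst c'"
    and ev: "\<forall>\<^sub>F \<tau> in at t within S. \<gamma> \<tau> \<in> fst c"
    and \<gamma>: "((\<lambda>\<tau>. snd c (\<gamma> \<tau>)) has_vector_derivative d) (at t within S)"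
  shows "\<forall>\<^sub>F \<tau> in at t within S. \<gamma> \<tau> \<in> fst c'"
proof -
  have "((\<lambda>\<tau>. snd c (\<gamma> \<tau>)) \<longlongrightarrow> snd c (\<gamma> t)) (at t within S)"
    using has_vector_derivative_continuous[OF \<gamma>] by (simp add: continuous_within)
  then have "\<forall>\<^sub>F \<tau> in at t within S. snd c (\<gamma> \<tau>) \<in> snd c ` (fst c \<inter> fst c')"
    by (rule topological_tendstoD) (use c open_overlap in auto)
  with ev show ?thesis
  proof eventually_elim
    case (elim \<tau>)
    then obtain q where q: "q \<in> fst c" "q \<in> fst c'" "snd c (\<gamma> \<tau>) = snd c q" by auto
    with elim c(1) have "\<gamma> \<tau> = q" by (metis chart_inv_chart)
    with q show ?case by simp
  qed
qed

lemma curve_chart_change: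
  assumes c: "c \<in> At" "c' \<in> At" "\<gamma> t \<in> fst c" "\<gamma> t \<in> fst c'" and t: "t \<in> S"
    and ev: "\<forall>\<^sub>F \<tau> in at t within S. \<gamma> \<tau> \<in> fst c"
    and \<gamma>: "((\<lambda>\<tau>. snd c (\<gamma> \<tau>)) has_vector_derivative d) (at t within S)"
  shows "((\<lambda>\<tau>. snd c' (\<gamma> \<tau>)) has_vector_derivative tangent_trans c c' (\<gamma> t) d) (at t within S)"
  using has_vector_derivative_compose[OF \<gamma> transition_has_derivative[OF c]]
  unfolding has_vector_derivative_def
proof (rule has_derivative_transform_eventually)
  show "\<forall>\<^sub>F \<tau> in at t within S. transition c c' (snd c (\<gamma> \<tau>)) = snd c' (\<gamma> \<tau>)"
    using ev by eventually_elim (use c in simp)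
qed (use c t in auto)

lemma field_chart_change:
  assumes c: "c \<in> At" "c' \<in> At" "\<gamma> t \<in> fst c" "\<gamma> t \<in> fst c'" and t: "t \<in> S"
    and ev: "\<forall>\<^sub>F \<tau> in at t within S. \<gamma> \<tau> \<in> fst c"
    and \<gamma>: "((\<lambda>\<tau>. snd c (\<gamma> \<tau>)) has_vector_derivative d) (at t within S)"
    and X: "((\<lambda>\<tau>. to_chart At c (\<gamma> \<tau>) (X \<tau>)) has_vector_derivative e) (at t within S)"
  shows "((\<lambda>\<tau>. to_chart At c' (\<gamma> \<tau>) (X \<tau>)) has_vector_derivative
    hessian c c' (\<gamma> t) d (to_chart At c (\<gamma> t) (X t)) + tangent_trans c c' (\<gamma> t) e) (at t within S)"
proof -
  note ev' = eventually_in_chart[OF c ev \<gamma>]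
  let ?h = "\<lambda>\<tau>. frechet_derivative (transition c c') (at (snd c (\<gamma> \<tau>))) (to_chart At c (\<gamma> \<tau>) (X \<tau>))"
  have eq: "?h \<tau> = to_chart At c' (\<gamma> \<tau>) (X \<tau>)" if "\<gamma> \<tau> \<in> fst c" "\<gamma> \<tau> \<in> fst c'" for \<tau>
    using to_chart_change[OF c(1,2) that] by (simp add: tangent_trans_def)
  have "((\<lambda>\<tau>. (snd c (\<gamma> \<tau>), to_chart At c (\<gamma> \<tau>) (X \<tau>))) has_vector_derivative (d, e)) (at t within S)"
    by (rule has_vector_derivative_Pair[OF \<gamma> X])
  from has_vector_derivative_compose[OF this transition_derivative_apply[OF c]]
  have "(?h has_vector_derivative
      hessian c c' (\<gamma> t) d (to_chart At c (\<gamma> t) (X t)) + tangent_trans c c' (\<gamma> t) e) (at t within S)"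
    by simp
  then show ?thesis
    unfolding has_vector_derivative_def
  proof (rule has_derivative_transform_eventually)
    show "\<forall>\<^sub>F \<tau> in at t within S. ?h \<tau> = to_chart At c' (\<gamma> \<tau>) (X \<tau>)"
      using ev ev' by eventually_elim (rule eq)
  qed (use c t eq in auto)
qed

text \<open>\<open>velocity\<close> is stored at each parameter in the preferred chart of that
  point; only its components in one fixed chart can be differentiated along the curve.\<close>

lemma velocity_rep:
  assumes c: "c \<in> At" "\<gamma> t \<in> fst c" and t: "t \<in> S" "at t within S \<noteq> bot"
    and ev: "\<forall>\<^sub>F \<tau> in at t within S. \<gamma> \<tau> \<in> fst c"
    and \<gamma>: "((\<lambda>\<tau>. snd c (\<gamma> \<tau>)) has_vector_derivative d) (at t within S)"
  shows "to_chart At c (\<gamma> t) (velocity At S \<gamma> t) = d"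
proof -
  define c0 where "c0 = chart_at At (\<gamma> t)"
  have c0: "c0 \<in> At" "\<gamma> t \<in> fst c0" by (auto simp: c0_def chart_at)
  have "velocity At S \<gamma> t = tangent_trans c c0 (\<gamma> t) d"
    unfolding velocity_def c0_def[symmetric]
    by (rule vector_derivative_within[OF t(2) curve_chart_change[OF c(1) c0(1) c(2) c0(2) t(1) ev \<gamma>]])
  then show ?thesis
    using to_from_chart[OF c] by (simp only: from_chart_def c0_def)
qed

text \<open>\<open>smooth_map_into\<close> supplies some chart. Composition with a transition map,
  after shrinking the neighbourhood to the preimage of the overlap, gives a smooth local extension
  in a prescribed one.\<close>

lemma smooth_map_into_chart:
  assumes f: "smooth_map_into At S f" and x: "x \<in> S" and c: "c \<in> At" "f x \<in> fst c"
  obtains W G where "open W" "x \<in> W" "smooth_on W G" "\<And>y. y \<in> S \<inter> W \<Longrightarrow> f y \<in> fst c"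
    "\<And>y. y \<in> S \<inter> W \<Longrightarrow> snd c (f y) = G y"
proof -
  obtain c1 W G where c1: "c1 \<in> At" and W: "open W" "x \<in> W" "smooth_on W G" "f ` (S \<inter> W) \<subseteq> fst c1"
    "\<forall>y\<in>S \<inter> W. snd c1 (f y) = G y"
    using bspec[OF f[unfolded smooth_map_into_def] x] by metis
  let ?O = "snd c1 ` (fst c1 \<inter> fst c)"
  have O: "open ?O" by (rule open_overlap[OF c1 c(1)])
  let ?W = "W \<inter> G -` ?O"
  have oW: "open ?W"
    using continuous_open_preimage[OF smooth_on_imp_continuous_on[OF W(3)] W(1) O] .
  have fx: "f x \<in> fst c1" using W x by auto
  have inc: "f y \<in> fst c" if "y \<in> S \<inter> ?W" for y
  proof -
    have y: "f y \<in> fst c1" "snd c1 (f y) \<in> ?O" using that W(4,5) by auto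
    then obtain q where q: "q \<in> fst c1" "q \<in> fst c" "snd c1 (f y) = snd c1 q" by auto
    with y c1 have "f y = q" by (metis chart_inv_chart)
    with q show ?thesis by simp
  qed
  have "smooth_on ?W (\<lambda>y. transition c1 c (G y))"
    by (rule smooth_on_compose[OF smooth_transition[OF c1 c(1)] smooth_on_subset[OF W(3)] oW O]) auto
  moreover have "G x \<in> ?O" using bspec[OF W(5), of x] W(2) x fx c(2) by (metis IntI imageI)
  then have "x \<in> ?W" using W(2) by simp
  moreover have "snd c (f y) = transition c1 c (G y)" if "y \<in> S \<inter> ?W" for y
  proof -
    have "f y \<in> fst c1" "G y = snd c1 (f y)" using that W(4,5) by auto
    then show ?thesis using c1 by simp
  qed
  ultimately show ?thesis using that oW inc by blast
qed

end

context aniso_conn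
begin

lemma gam_basis_expansion:
  assumes "c \<in> At" "z \<in> coord_domain c"
  shows "gam c z a b = (\<Sum>i\<in>Basis. \<Sum>j\<in>Basis. ((a \<bullet> i) * (b \<bullet> j)) *\<^sub>R gam c z i j)"
proof -
  have "gam c z a b = (\<Sum>i\<in>Basis. (a \<bullet> i) *\<^sub>R gam c z i b)"
    by (rule linear_basis_expansion[OF linear_gam(1)[OF assms]])
  also have "\<dots> = (\<Sum>i\<in>Basis. (a \<bullet> i) *\<^sub>R (\<Sum>j\<in>Basis. (b \<bullet> j) *\<^sub>R gam c z i j))"
    by (intro sum.cong arg_cong2[of _ _ _ _ "(*\<^sub>R)"] refl linear_basis_expansion[OF linear_gam(2)[OF assms]])
  finally show ?thesis by (simp add: scaleR_sum_right)
qed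

lemma christoffel_rep:
  assumes c: "c \<in> At" "fst v \<in> fst c" and v: "v \<in> A"
  shows "christoffel At N c v i j k = gam c (snd c (fst v), to_chart At c (fst v) (snd v)) i j \<bullet> k"
proof -
  note rep = local_rep_globalized_coord[OF c]
  have i: "local_rep At c (globalize At (fst v) (coord_field At c i)) (snd c (fst v)) = i"
    "vector_field At (globalize At (fst v) (coord_field At c i))" for i
    using rep[of i] by metis+
  have dj: "frechet_derivative (local_rep At c (globalize At (fst v) (coord_field At c j))) (at (snd c (fst v))) = (\<lambda>_. 0)"
    using rep[of j] by metis
  show ?thesis
    using conn_rep[OF c(1) coords_in_domain[OF c v] i(2) i(2), of i j] c
    by (simp add: christoffel_def bundle_point_coords i(1) dj)
qed

text \<open>In the preferred chart of \<gamma>(t) the definition is kept with its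
  \<open>vector_derivative\<close> terms, so that two connections can be compared term by
  term.\<close>

lemma cov_along_at_chart_at:
  assumes v: "v \<in> A" "fst v = \<gamma> t"
  defines "c \<equiv> chart_at At (\<gamma> t)"
  shows "cov_along_at At N S \<gamma> v X t =
    vector_derivative (\<lambda>\<tau>. to_chart At c (\<gamma> \<tau>) (X \<tau>)) (at t within S) +
    gam c (snd c (fst v), snd v) (vector_derivative (\<lambda>\<tau>. snd c (\<gamma> \<tau>)) (at t within S)) (X t)"
proof -
  have c: "c \<in> At" "fst v \<in> fst c" by (auto simp: c_def chart_at v(2))
  have tc: "to_chart At c (fst v) x = x" "from_chart At c (\<gamma> t) x = x" for x by (simp_all add: c_def v(2))
  note z = coords_in_domain[OF c v(1), unfolded tc]
  let ?dX = "vector_derivative (\<lambda>\<tau>. to_chart At c (\<gamma> \<tau>) (X \<tau>)) (at t within S)"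
    and ?d = "vector_derivative (\<lambda>\<tau>. snd c (\<gamma> \<tau>)) (at t within S)"
  let ?w = "?dX + gam c (snd c (fst v), snd v) ?d (X t)"
  have "cov_along_at At N S \<gamma> v X t = (\<Sum>k\<in>Basis. (?w \<bullet> k) *\<^sub>R k)"
    unfolding cov_along_at_def Let_def c_def[symmetric] coord_field_def tc christoffel_rep[OF c v(1)]
      gam_basis_expansion[OF c(1) z, of ?d "X t"] tc(1)[unfolded v(2)]
    by (simp add: inner_add_left inner_sum_left)
  then show ?thesis by (simp add: euclidean_representation)
qed

text \<open>The Hessian term produced by \<open>field_chart_change\<close> is the inhomogeneous term
  of \<open>gam_change\<close>, so the whole expression transforms as a vector. This gives the value
  in any chart around \<gamma>(t).\<close>

lemma cov_along_at_rep:
  assumes v: "v \<in> A" "fst v = \<gamma> t"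
    and c: "c \<in> At" "\<gamma> t \<in> fst c" and t: "t \<in> S" "at t within S \<noteq> bot"
    and ev: "\<forall>\<^sub>F \<tau> in at t within S. \<gamma> \<tau> \<in> fst c"
    and \<gamma>: "((\<lambda>\<tau>. snd c (\<gamma> \<tau>)) has_vector_derivative d) (at t within S)"
    and X: "((\<lambda>\<tau>. to_chart At c (\<gamma> \<tau>) (X \<tau>)) has_vector_derivative e) (at t within S)"
  shows "to_chart At c (\<gamma> t) (cov_along_at At N S \<gamma> v X t) =
    e + gam c (snd c (\<gamma> t), to_chart At c (\<gamma> t) (snd v)) d (to_chart At c (\<gamma> t) (X t))"
proof -
  define c0 where "c0 = chart_at At (\<gamma> t)"
  have c0: "c0 \<in> At" "\<gamma> t \<in> fst c0" by (auto simp: c0_def chart_at)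
  note cc = c(1) c0(1) c(2) c0(2)
  have cv: "fst v \<in> fst c" "fst v \<in> fst c0" using c c0 v by simp_all
  let ?T = "tangent_trans c c0 (\<gamma> t)"
  have lT: "linear ?T" by (rule linear_tangent_trans[OF cc])
  have tc0: "to_chart At c0 (\<gamma> t) x = x" for x by (simp add: c0_def)
  have 1: "vector_derivative (\<lambda>\<tau>. snd c0 (\<gamma> \<tau>)) (at t within S) = ?T d"
    by (rule vector_derivative_within[OF t(2) curve_chart_change[OF cc t(1) ev \<gamma>]])
  have 2: "vector_derivative (\<lambda>\<tau>. to_chart At c0 (\<gamma> \<tau>) (X \<tau>)) (at t within S) =
      hessian c c0 (\<gamma> t) d (to_chart At c (\<gamma> t) (X t)) + ?T e"
    by (rule vector_derivative_within[OF t(2) field_chart_change[OF cc t(1) ev \<gamma> X]])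
  have 3: "X t = ?T (to_chart At c (\<gamma> t) (X t))"
    using to_chart_change[OF cc, of "X t"] by (simp add: tc0)
  have "cov_along_at At N S \<gamma> v X t = ?T (e +
      gam c (snd c (\<gamma> t), to_chart At c (\<gamma> t) (snd v)) d (to_chart At c (\<gamma> t) (X t)))"
    unfolding cov_along_at_chart_at[of v \<gamma> t, OF v, folded c0_def] 1 2 linear_add[OF lT]
    using gam_change[OF c(1) c0(1) cv v(1), of d "to_chart At c (\<gamma> t) (X t)"] 3
    by (simp add: v(2) tc0)
  then show ?thesis
    using to_from_chart[OF c] by (simp only: from_chart_def c0_def)
qed

end

section \<open>Jacobi fields\<close>

text \<open>Transfers the derivative of a smooth local extension to a function that agrees with it
  only on the parameter set; at the end points of an interval this is the one-sided
  derivative.\<close>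

lemma has_vector_derivative_transform_on:
  assumes "(g has_vector_derivative d) (at t)" "open U" "t \<in> U" "t \<in> S" "\<And>\<tau>. \<tau> \<in> S \<Longrightarrow> \<tau> \<in> U \<Longrightarrow> f \<tau> = g \<tau>"
  shows "(f has_vector_derivative d) (at t within S)"
proof -
  have "(g has_vector_derivative d) (at t within S)"
    by (rule has_vector_derivative_at_within[OF assms(1)])
  then show ?thesis
    unfolding has_vector_derivative_def
  proof (rule has_derivative_transform_eventually)
    show "\<forall>\<^sub>F \<tau> in at t within S. g \<tau> = f \<tau>"
      unfolding eventually_at_topological using assms(2,3,5) by metis
  qed (use assms in auto)
qed

lemma eventually_within_open:
  "open U \<Longrightarrow> t \<in> U \<Longrightarrow> (\<And>\<tau>. \<tau> \<in> S \<Longrightarrow> \<tau> \<in> U \<Longrightarrow> P \<tau>) \<Longrightarrow> \<forall>\<^sub>F \<tau> in at t within S. P \<tau>"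
  unfolding eventually_at_topological by blast

text \<open>\<open>vector_derivative\<close> is a selected value; equality on S gives the same
  candidate derivatives, hence the same selection.\<close>

lemma vector_derivative_cong_on:
  assumes "t \<in> S" "\<And>\<tau>. \<tau> \<in> S \<Longrightarrow> f \<tau> = g \<tau>"
  shows "vector_derivative f (at t within S) = vector_derivative g (at t within S)"
proof -
  have "(f has_vector_derivative d) (at t within S) \<longleftrightarrow> (g has_vector_derivative d) (at t within S)" for d
    unfolding has_vector_derivative_def
    using has_derivative_transform[of t S f g] has_derivative_transform[of t S g f] assms by metis
  then show ?thesis by (simp add: vector_derivative_def)
qed

lemma partial_has_vector_derivative:
  fixes F :: "real \<times> real \<Rightarrow> 'b::real_normed_vector"
  assumes "(F has_derivative F') (at (t, s))"
  shows "((\<lambda>\<tau>. F (\<tau>, s)) has_vector_derivative F' (1, 0)) (at t)"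
    and "((\<lambda>\<sigma>. F (t, \<sigma>)) has_vector_derivative F' (0, 1)) (at s)"
proof -
  have "((\<lambda>\<tau>. (\<tau>, s)) has_vector_derivative (1, 0)) (at t)"
    by (intro has_vector_derivative_Pair derivative_intros)
  from has_vector_derivative_compose[OF this assms]
  show "((\<lambda>\<tau>. F (\<tau>, s)) has_vector_derivative F' (1, 0)) (at t)" .
  have "((\<lambda>\<sigma>. (t, \<sigma>)) has_vector_derivative (0, 1)) (at s)"
    by (intro has_vector_derivative_Pair derivative_intros)
  from has_vector_derivative_compose[OF this assms]
  show "((\<lambda>\<sigma>. F (t, \<sigma>)) has_vector_derivative F' (0, 1)) (at s)" .
qed

lemma at_within_Icc_neq_bot: "a < b \<Longrightarrow> t \<in> {a..b::real} \<Longrightarrow> at t within {a..b} \<noteq> bot"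
  using trivial_limit_within[of t "{a..b}"] islimpt_Icc[of a b t] by auto

context aniso_conn
begin

text \<open>The fields X and Y are evaluated at an unchanged base point, so of the terms in
  \<open>conn_field_rep_derivative\<close> only \<open>dgam\<close> survives.\<close>

lemma conn_vert_has_derivative:
  assumes v: "v \<in> A" and X: "vector_field At X" and Y: "vector_field At Y"
  defines "c \<equiv> chart_at At (fst v)"
  shows "((\<lambda>t. N (vshift v t w) X Y) has_vector_derivative
    dgam c (snd c (fst v), snd v) (X (fst v)) (Y (fst v)) (0, w)) (at 0)"
proof -
  have c: "c \<in> At" "fst v \<in> fst c" by (auto simp: c_def chart_at)
  have tc: "to_chart At c (fst v) x = x" "from_chart At c (fst v) x = x" for x by (simp_all add: c_def)
  note z = coords_in_domain[OF c v, unfolded tc]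
  have rep: "local_rep At c Z (snd c (fst v)) = Z (fst v)" for Z
    using c tc by (simp add: local_rep_chart)
  have lin: "linear (frechet_derivative (local_rep At c Z) (at (snd c (fst v))))"
    "linear (frechet_derivative (\<lambda>u. frechet_derivative (local_rep At c Z) (at u) h) (at (snd c (fst v))))"
    if "vector_field At Z" for Z h
    using smooth_on_linear_frechet_derivative[OF vector_fieldD[OF that c(1)], of "snd c (fst v)"]
      smooth_on_linear_frechet_derivative[OF smooth_on_directional[OF vector_fieldD[OF that c(1)]], of "snd c (fst v)"]
      c(2) by auto
  have "frechet_derivative (field_rep At c (\<lambda>w. N w X Y)) (at (snd c (fst v), snd v)) (0, w) =
      dgam c (snd c (fst v), snd v) (X (fst v)) (Y (fst v)) (0, w)"
    using conn_field_rep_derivative[OF c(1) z X Y, of 0 w]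
    by (simp add: rep linear_0[OF lin(1)[OF X]] linear_0[OF lin(1)[OF Y]] linear_0[OF lin(2)[OF Y]]
        linear_0[OF linear_gam(1)[OF c(1) z]] linear_0[OF linear_gam(2)[OF c(1) z]])
  then show ?thesis
    using vert_has_derivative[OF aniso_field_conn[OF X Y] c(1) z, of w]
      bundle_point_coords[OF c] c by (simp add: tc)
qed

lemma conn_vert_deriv_rep:
  assumes v: "v \<in> A"
  defines "c \<equiv> chart_at At (fst v)"
  shows "conn_vert_deriv At N v a b w = dgam c (snd c (fst v), snd v) a b (0, w)"
  using vector_derivative_at[OF conn_vert_has_derivative[OF v field_through(1) field_through(1),
        of w "fst v" a "fst v" b]]
  by (simp add: conn_vert_deriv_def field_through(2) c_def)

lemma dgam_symmetric:
  assumes "torsion_free At A N" "c \<in> At" "z \<in> coord_domain c"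
  shows "dgam c z a b = dgam c z b a"
  unfolding dgam_def
  by (rule frechet_derivative_cong_open[OF open_coord_domain[OF assms(2)] assms(3)])
    (rule gam_symmetric[OF assms(1,2)])

text \<open>Differentiating the auto-parallel equation \<open>x\<^sub>t\<^sub>t + \<Gamma>(x\<^sub>t, x\<^sub>t) = 0\<close> of a variation in \<open>s\<close> gives
  the Jacobi equation up to \<open>\<partial>\<^sup>\<nu>\<Gamma>(x\<^sub>t, x\<^sub>t)\<close>, which is what the hypothesis on \<open>P\<close> removes.\<close>

lemma variation_jacobi_identity:
  fixes G Gt Gs Gtt Gst H :: "real \<times> real \<Rightarrow> 'e"
  assumes Gt_def: "Gt = (\<lambda>z. frechet_derivative G (at z) (1, 0))"
    and Gs_def: "Gs = (\<lambda>z. frechet_derivative G (at z) (0, 1))"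
    and Gtt_def: "Gtt = (\<lambda>z. frechet_derivative Gt (at z) (1, 0))"
    and Gst_def: "Gst = (\<lambda>z. frechet_derivative Gs (at z) (1, 0))"
    and H_def: "H = (\<lambda>z. Gst z + gam c (G z, Gt z) (Gt z) (Gs z))"
  assumes tf: "torsion_free At A N" and c: "c \<in> At"
    and W: "open W" "(t0, 0) \<in> W" and G: "smooth_on W G"
    and V: "open V" "0 \<in> V"
    and dom: "(G (t0, 0), Gt (t0, 0)) \<in> coord_domain c"
    and eqn: "\<And>s. s \<in> V \<Longrightarrow> Gtt (t0, s) + gam c (G (t0, s), Gt (t0, s)) (Gt (t0, s)) (Gt (t0, s)) = 0"
    and P: "\<And>w. dgam c (G (t0, 0), Gt (t0, 0)) (Gt (t0, 0)) (Gt (t0, 0)) (0, w) = 0"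
  shows "(H has_derivative frechet_derivative H (at (t0, 0))) (at (t0, 0))"
    and "frechet_derivative H (at (t0, 0)) (1, 0)
      + gam c (G (t0, 0), Gt (t0, 0)) (Gt (t0, 0)) (H (t0, 0)) =
      curvature_map c (G (t0, 0), Gt (t0, 0)) (Gt (t0, 0)) (Gs (t0, 0)) (Gt (t0, 0))"
proof -
  let ?z = "(t0, 0) :: real \<times> real"
  let ?y = "(G ?z, Gt ?z)"
  have sm: "smooth_on W Gt" "smooth_on W Gs" "smooth_on W Gtt" "smooth_on W Gst"
    unfolding Gt_def Gs_def Gtt_def Gst_def by (intro smooth_on_directional G)+
  note hd = smooth_on_has_derivative[OF _ W(2)]
  let ?DG = "frechet_derivative G (at ?z)" and ?DGt = "frechet_derivative Gt (at ?z)"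
    and ?DGs = "frechet_derivative Gs (at ?z)" and ?DGtt = "frechet_derivative Gtt (at ?z)"
    and ?DGst = "frechet_derivative Gst (at ?z)"
  let ?O = "W \<inter> (\<lambda>z. (G z, Gt z)) -` coord_domain c"
  have O: "open ?O"
    using continuous_open_preimage[OF _ W(1) open_coord_domain[OF c], of "\<lambda>z. (G z, Gt z)"]
      smooth_on_imp_continuous_on[OF G] smooth_on_imp_continuous_on[OF sm(1)]
    by (auto intro: continuous_intros)
  have zO: "?z \<in> ?O" using W(2) dom by simp
  have pair: "((\<lambda>z. (G z, Gt z)) has_derivative (\<lambda>k. (?DG k, ?DGt k))) (at ?z)"
    by (intro has_derivative_Pair hd G sm)
  have g: "((\<lambda>z. gam c (G z, Gt z) \<xi> \<eta>) has_derivative (\<lambda>k. dgam c ?y \<xi> \<eta> (?DG k, ?DGt k))) (at ?z)" for \<xi> \<eta>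
    by (rule has_derivative_compose[OF pair gam_has_derivative[OF c dom]])
  have lin: "linear (\<lambda>\<xi>. gam c (G u, Gt u) \<xi> \<eta>)" "linear (gam c (G u, Gt u) \<xi>)" if "u \<in> ?O" for u \<xi> \<eta>
    using linear_gam[OF c] that by auto
  note bil = has_derivative_bilinear_family[where g = "\<lambda>z. gam c (G z, Gt z)", OF O zO lin g]
  have E: "((\<lambda>z. Gtt z + gam c (G z, Gt z) (Gt z) (Gt z)) has_derivative
      (\<lambda>k. ?DGtt k + (dgam c ?y (Gt ?z) (Gt ?z) (?DG k, ?DGt k) + gam c ?y (?DGt k) (Gt ?z) + gam c ?y (Gt ?z) (?DGt k)))) (at ?z)"
    by (intro has_derivative_add hd sm bil)
  have HD: "(H has_derivative
      (\<lambda>k. ?DGst k + (dgam c ?y (Gt ?z) (Gs ?z) (?DG k, ?DGt k) + gam c ?y (?DGt k) (Gs ?z) + gam c ?y (Gt ?z) (?DGs k)))) (at ?z)"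
    unfolding H_def by (intro has_derivative_add hd sm bil)
  show "(H has_derivative frechet_derivative H (at ?z)) (at ?z)"
    by (rule subst[OF frechet_derivative_at[OF HD], of "\<lambda>D. (H has_derivative D) (at ?z)"]) (rule HD)
  \<comment> \<open>The auto-parallel equation is available on the line t = t0 only: if t0 is an end
    point of [a,b], then G continues past the interval, where the equation is unknown. It is
    therefore differentiated in s alone.\<close>
  have "((\<lambda>s. 0) has_vector_derivative
      (?DGtt (0, 1) + (dgam c ?y (Gt ?z) (Gt ?z) (?DG (0, 1), ?DGt (0, 1)) + gam c ?y (?DGt (0, 1)) (Gt ?z) + gam c ?y (Gt ?z) (?DGt (0, 1))))) (at 0)"
    by (rule has_vector_derivative_transform_within_open[OF partial_has_vector_derivative(2)[OF E] V])
      (rule eqn)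
  from vector_derivative_unique_at[OF this has_vector_derivative_const]
  have s_deriv: "?DGtt (0, 1) + (dgam c ?y (Gt ?z) (Gt ?z) (?DG (0, 1), ?DGt (0, 1)) + gam c ?y (?DGt (0, 1)) (Gt ?z) + gam c ?y (Gt ?z) (?DGt (0, 1))) = 0" .
  have mixed: "frechet_derivative Gt (at z) (0, 1) = Gst z" if "z \<in> W" for z
    unfolding Gt_def Gst_def Gs_def by (rule second_derivative_symmetric[OF W(1) that G])
  \<comment> \<open>Moving the s-derivative past both t-derivatives takes two exchanges of second
    derivatives, one for G under a further derivative and one for Gt.\<close>
  have "?DGst (1, 0) = frechet_derivative (\<lambda>z. frechet_derivative Gt (at z) (0, 1)) (at ?z) (1, 0)"
    by (subst frechet_derivative_cong_open[OF W, of Gst]) (auto simp: mixed)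
  also have "\<dots> = ?DGtt (0, 1)"
    unfolding Gtt_def by (rule second_derivative_symmetric[OF W sm(1)])
  finally have third: "?DGst (1, 0) = ?DGtt (0, 1)" .
  have DG: "?DG (1, 0) = Gt ?z" "?DG (0, 1) = Gs ?z" "?DGt (1, 0) = Gtt ?z" "?DGt (0, 1) = Gst ?z" "?DGs (1, 0) = Gst ?z"
    using mixed[OF W(2)] by (simp_all add: Gt_def Gs_def Gtt_def Gst_def)
  have Gtt: "Gtt ?z = - gam c ?y (Gt ?z) (Gt ?z)"
    using eqn[OF V(2)] by (simp add: eq_neg_iff_add_eq_0)
  note lg = linear_gam[OF c dom]
  \<comment> \<open>The vertical entry of this derivative is irrelevant by P. It is Gst in the
    s-derivative of the auto-parallel equation, but minus the Christoffel term of Gt and Gs in the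
    curvature, so these two terms can now be matched.\<close>
  have Pw: "dgam c ?y (Gt ?z) (Gt ?z) (k, w) = dgam c ?y (Gt ?z) (Gt ?z) (k, 0)" for k w
    using linear_add[OF linear_dgam[OF c dom], of "Gt ?z" "Gt ?z" "(k, 0)" "(0, w)"] P by simp
  note sym = gam_symmetric[OF tf c dom]
  have DH: "frechet_derivative H (at ?z) (1, 0) = ?DGst (1, 0) +
      (dgam c ?y (Gt ?z) (Gs ?z) (Gt ?z, Gtt ?z) + gam c ?y (Gtt ?z) (Gs ?z) + gam c ?y (Gt ?z) (Gst ?z))"
    using fun_cong[OF frechet_derivative_at[OF HD, symmetric], of "(1, 0)"] by (simp add: DG)
  have third': "?DGst (1, 0) = - (dgam c ?y (Gt ?z) (Gt ?z) (Gs ?z, 0) + 2 *\<^sub>R gam c ?y (Gt ?z) (Gst ?z))"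
    using s_deriv unfolding third DG Pw[of _ "Gst ?z"] sym[of "Gst ?z" "Gt ?z"]
    by (simp only: eq_neg_iff_add_eq_0 scaleR_2 add.assoc)
  have Hz: "H ?z = Gst ?z + gam c ?y (Gt ?z) (Gs ?z)" by (simp add: H_def)
  show "frechet_derivative H (at ?z) (1, 0) + gam c ?y (Gt ?z) (H ?z) = curvature_map c ?y (Gt ?z) (Gs ?z) (Gt ?z)"
    unfolding DH third' Hz curvature_map_def linear_add[OF lg(2)] Gtt linear_neg[OF lg(1)]
      dgam_symmetric[OF tf c dom, of "Gs ?z"] snd_conv Pw[of _ "- gam c ?y (Gt ?z) (Gs ?z)"]
      sym[of "Gs ?z" "Gt ?z"] sym[of "Gs ?z" "gam c ?y (Gt ?z) (Gt ?z)"]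
    by (simp add: scaleR_2 algebra_simps)
qed

text \<open>To be differentiated again, D J must be known near t0, and its stored components refer
  to a different preferred chart at each point. One chart around \<gamma>(t0) is therefore kept, in
  which \<gamma>', J and D J are expressed by partial derivatives of a smooth extension G of the
  variation.\<close>

lemma jacobi_field_imp_equation:
  assumes tf: "torsion_free At A N"
    and P: "\<And>v u. v \<in> A \<Longrightarrow> conn_vert_deriv At N v (snd v) (snd v) u = 0"
    and J: "jacobi_field At A N a b \<gamma> J"
  shows "jacobi_equation At A N a b \<gamma> J"
  unfolding jacobi_equation_def
proof
  fix t0 assume t0: "t0 \<in> {a..b}"
  let ?I = "{a..b}"
  have ap: "autoparallel At A N a b \<gamma>" and ab: "a < b"
    using J unfolding jacobi_field_def autoparallel_def by auto
  obtain \<epsilon> \<Lambda> where \<Lambda>: "\<epsilon> > 0" "smooth_map_into At (?I \<times> {-\<epsilon><..<\<epsilon>}) \<Lambda>"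
    "\<And>t. t \<in> ?I \<Longrightarrow> \<Lambda> (t, 0) = \<gamma> t" "\<And>s. s \<in> {-\<epsilon><..<\<epsilon>} \<Longrightarrow> autoparallel At A N a b (\<lambda>t. \<Lambda> (t, s))"
    "\<And>t. t \<in> ?I \<Longrightarrow> J t = velocity At {-\<epsilon><..<\<epsilon>} (\<lambda>s. \<Lambda> (t, s)) 0"
    using J unfolding jacobi_field_def by metis
  let ?T = "{-\<epsilon><..<\<epsilon>}"
  have T0: "(0::real) \<in> ?T" using \<Lambda>(1) by simp
  define c where "c = chart_at At (\<gamma> t0)"
  have c: "c \<in> At" "\<gamma> t0 \<in> fst c" by (auto simp: c_def chart_at)
  have tc: "to_chart At c (\<gamma> t0) x = x" for x by (simp add: c_def)
  have "(t0, 0) \<in> ?I \<times> ?T" "\<Lambda> (t0, 0) \<in> fst c" using t0 T0 \<Lambda>(3) c by auto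
  then obtain W G where W: "open W" "(t0, 0) \<in> W" "smooth_on W G"
    "\<And>y. y \<in> ?I \<times> ?T \<inter> W \<Longrightarrow> \<Lambda> y \<in> fst c" "\<And>y. y \<in> ?I \<times> ?T \<inter> W \<Longrightarrow> snd c (\<Lambda> y) = G y"
    using smooth_map_into_chart[OF \<Lambda>(2) _ c(1)] by metis
  \<comment> \<open>A product neighbourhood allows t and s to move independently: along the curves
    of the variation and along the transversal lines.\<close>
  obtain U V0 where UV0: "open U" "open V0" "(t0, 0) \<in> U \<times> V0" "U \<times> V0 \<subseteq> W"
    using open_prod_elim[OF W(1,2)] by metis
  define V where "V = V0 \<inter> ?T"
  have UV: "open U" "open V" "t0 \<in> U" "0 \<in> V" "V \<subseteq> ?T"
    using UV0 T0 by (auto simp: V_def)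
  have inW: "(t, s) \<in> W" if "t \<in> U" "s \<in> V" for t s using UV0(4) that by (auto simp: V_def)
  have \<Lambda>G: "\<Lambda> (t, s) \<in> fst c" "snd c (\<Lambda> (t, s)) = G (t, s)" if "t \<in> ?I" "t \<in> U" "s \<in> V" for t s
    using W(4,5)[of "(t, s)"] that inW UV(5) by auto
  define Gt where "Gt = (\<lambda>z. frechet_derivative G (at z) (1, 0))"
  define Gs where "Gs = (\<lambda>z. frechet_derivative G (at z) (0, 1))"
  define Gtt where "Gtt = (\<lambda>z. frechet_derivative Gt (at z) (1, 0))"
  define Gst where "Gst = (\<lambda>z. frechet_derivative Gs (at z) (1, 0))"
  have sm: "smooth_on W Gt" "smooth_on W Gs"
    unfolding Gt_def Gs_def by (intro smooth_on_directional W)+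
  note bot = at_within_Icc_neq_bot[OF ab]

  \<comment> \<open>\<open>\<alpha>\<close> has to agree with a curve of the variation on [a,b]
    only, so this covers the neighbouring curves as well as \<gamma> itself.\<close>
  have curve: "\<forall>\<^sub>F \<tau> in at t within ?I. \<alpha> \<tau> \<in> fst c"
      "((\<lambda>\<tau>. snd c (\<alpha> \<tau>)) has_vector_derivative Gt (t, s)) (at t within ?I)"
      "to_chart At c (\<alpha> t) (velocity At ?I \<alpha> t) = Gt (t, s)"
    if s: "s \<in> V" and \<alpha>: "\<And>\<tau>. \<tau> \<in> ?I \<Longrightarrow> \<alpha> \<tau> = \<Lambda> (\<tau>, s)" and t: "t \<in> ?I" "t \<in> U" for \<alpha> s t
  proof -
    show ev: "\<forall>\<^sub>F \<tau> in at t within ?I. \<alpha> \<tau> \<in> fst c"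
      by (rule eventually_within_open[OF UV(1) t(2)]) (simp add: \<alpha> \<Lambda>G(1) s)
    have "((\<lambda>\<tau>. G (\<tau>, s)) has_vector_derivative Gt (t, s)) (at t)"
      unfolding Gt_def
      by (rule partial_has_vector_derivative(1)[OF smooth_on_has_derivative[OF W(3) inW[OF t(2) s]]])
    then show d: "((\<lambda>\<tau>. snd c (\<alpha> \<tau>)) has_vector_derivative Gt (t, s)) (at t within ?I)"
      by (rule has_vector_derivative_transform_on[OF _ UV(1) t(2) t(1)]) (simp add: \<alpha> \<Lambda>G(2) s)
    show "to_chart At c (\<alpha> t) (velocity At ?I \<alpha> t) = Gt (t, s)"
      by (rule velocity_rep[OF c(1) _ t(1) bot[OF t(1)] ev d]) (simp only: \<alpha>[OF t(1)] \<Lambda>G(1)[OF t s])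
  qed

  have dom: "(G (t, s), Gt (t, s)) \<in> coord_domain c"
    and eqn: "Gtt (t, s) + gam c (G (t, s), Gt (t, s)) (Gt (t, s)) (Gt (t, s)) = 0"
    if t: "t \<in> ?I" "t \<in> U" and s: "s \<in> V" for t s
  proof -
    let ?\<alpha> = "\<lambda>t. \<Lambda> (t, s)"
    have ap: "autoparallel At A N a b ?\<alpha>" using \<Lambda>(4) s UV(5) by auto
    let ?v = "(?\<alpha> t, velocity At ?I ?\<alpha> t)"
    have v: "?v \<in> A" and zero: "cov_along_at At N ?I ?\<alpha> ?v (velocity At ?I ?\<alpha>) t = 0"
      using ap t unfolding autoparallel_def cov_along_def by auto
    note cu = curve[OF s refl]
    have \<alpha>c: "?\<alpha> t \<in> fst c" using \<Lambda>G(1)[OF t s] .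
    show "(G (t, s), Gt (t, s)) \<in> coord_domain c"
      using coords_in_domain[OF c(1) _ v] \<alpha>c cu(3)[OF t] \<Lambda>G(2)[OF t s] by simp
    have "((\<lambda>\<tau>. Gt (\<tau>, s)) has_vector_derivative Gtt (t, s)) (at t)"
      unfolding Gtt_def
      by (rule partial_has_vector_derivative(1)[OF smooth_on_has_derivative[OF sm(1) inW[OF t(2) s]]])
    then have "((\<lambda>\<tau>. to_chart At c (?\<alpha> \<tau>) (velocity At ?I ?\<alpha> \<tau>)) has_vector_derivative Gtt (t, s)) (at t within ?I)"
      by (rule has_vector_derivative_transform_on[OF _ UV(1) t(2) t(1)]) (rule cu(3))
    from cov_along_at_rep[of ?v ?\<alpha> t, OF v _ c(1) \<alpha>c t(1) bot[OF t(1)] cu(1)[OF t] cu(2)[OF t] this]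
    show "Gtt (t, s) + gam c (G (t, s), Gt (t, s)) (Gt (t, s)) (Gt (t, s)) = 0"
      using zero cu(3)[OF t] \<Lambda>G(2)[OF t s] by (simp add: linear_0[OF linear_to_chart[OF c(1) \<alpha>c]])
  qed

  note cu = curve[OF UV(4), of \<gamma>, OF \<Lambda>(3)[symmetric]]
  have \<gamma>c: "\<gamma> t \<in> fst c" "snd c (\<gamma> t) = G (t, 0)" if "t \<in> ?I" "t \<in> U" for t
    using \<Lambda>G[OF that UV(4)] \<Lambda>(3)[OF that(1)] by simp_all
  have Jrep: "to_chart At c (\<gamma> t) (J t) = Gs (t, 0)" if t: "t \<in> ?I" "t \<in> U" for t
  proof -
    let ?\<beta> = "\<lambda>s. \<Lambda> (t, s)"
    have ev: "\<forall>\<^sub>F s in at 0 within ?T. ?\<beta> s \<in> fst c"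
      by (rule eventually_within_open[OF UV(2,4)]) (rule \<Lambda>G(1)[OF t])
    have "((\<lambda>s. G (t, s)) has_vector_derivative Gs (t, 0)) (at 0)"
      unfolding Gs_def
      by (rule partial_has_vector_derivative(2)[OF smooth_on_has_derivative[OF W(3) inW[OF t(2) UV(4)]]])
    then have d: "((\<lambda>s. snd c (?\<beta> s)) has_vector_derivative Gs (t, 0)) (at 0 within ?T)"
      by (rule has_vector_derivative_transform_on[OF _ UV(2,4) T0]) (rule \<Lambda>G(2)[OF t])
    have "at 0 within ?T \<noteq> bot" using at_within_open[OF T0] by simp
    from velocity_rep[OF c(1) \<Lambda>G(1)[OF t UV(4)] T0 this ev d]
    show ?thesis using \<Lambda>(3,5)[OF t(1)] by simp
  qed
  let ?vel = "velocity At ?I \<gamma>"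
  define DJ where "DJ = cov_along At N ?I \<gamma> ?vel J"
  define H where "H = (\<lambda>z. Gst z + gam c (G z, Gt z) (Gt z) (Gs z))"
  have velA: "(\<gamma> t, ?vel t) \<in> A" if "t \<in> ?I" for t
    using ap that by (simp add: autoparallel_def)
  have DJrep: "to_chart At c (\<gamma> t) (DJ t) = H (t, 0)" if t: "t \<in> ?I" "t \<in> U" for t
  proof -
    have "((\<lambda>\<tau>. Gs (\<tau>, 0)) has_vector_derivative Gst (t, 0)) (at t)"
      unfolding Gst_def
      by (rule partial_has_vector_derivative(1)[OF smooth_on_has_derivative[OF sm(2) inW[OF t(2) UV(4)]]])
    then have "((\<lambda>\<tau>. to_chart At c (\<gamma> \<tau>) (J \<tau>)) has_vector_derivative Gst (t, 0)) (at t within ?I)"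
      by (rule has_vector_derivative_transform_on[OF _ UV(1) t(2) t(1)]) (rule Jrep)
    from cov_along_at_rep[of "(\<gamma> t, ?vel t)" \<gamma> t, OF velA[OF t(1)] _ c(1) \<gamma>c(1)[OF t] t(1) bot[OF t(1)] cu(1)[OF _ t] cu(2)[OF _ t] this]
    show ?thesis
      using cu(3)[OF _ t] Jrep[OF t] \<gamma>c(2)[OF t] by (simp add: DJ_def cov_along_def H_def)
  qed
  have z0: "Gt (t0, 0) = ?vel t0" "G (t0, 0) = snd c (\<gamma> t0)" "Gs (t0, 0) = J t0"
    using cu(3)[OF _ t0 UV(3)] \<gamma>c(2)[OF t0 UV(3)] Jrep[OF t0 UV(3)] by (simp_all add: tc)
  \<comment> \<open>The condition on P is taken at v = \<gamma>'(t0). As c is the preferred chart of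
    \<gamma>(t0), the stored vectors are their own components.\<close>
  have Pz: "dgam c (G (t0, 0), Gt (t0, 0)) (Gt (t0, 0)) (Gt (t0, 0)) (0, w) = 0" for w
    using P[OF velA[OF t0], of w] conn_vert_deriv_rep[OF velA[OF t0], of "?vel t0" "?vel t0" w]
    by (simp add: z0 c_def)
  note key = variation_jacobi_identity[OF Gt_def Gs_def Gtt_def Gst_def H_def tf c(1) W(1-3) UV(2,4)
      dom[OF t0 UV(3,4)] eqn[OF t0 UV(3)] Pz]
  have "((\<lambda>\<tau>. H (\<tau>, 0)) has_vector_derivative frechet_derivative H (at (t0, 0)) (1, 0)) (at t0)"
    by (rule partial_has_vector_derivative(1)[OF key(1)])
  then have "((\<lambda>\<tau>. to_chart At c (\<gamma> \<tau>) (DJ \<tau>)) has_vector_derivative frechet_derivative H (at (t0, 0)) (1, 0)) (at t0 within ?I)"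
    by (rule has_vector_derivative_transform_on[OF _ UV(1) UV(3) t0]) (rule DJrep)
  from cov_along_at_rep[of "(\<gamma> t0, ?vel t0)" \<gamma> t0, OF velA[OF t0] _ c t0 bot[OF t0] cu(1)[OF _ t0 UV(3)] cu(2)[OF _ t0 UV(3)] this]
  have "cov_along At N ?I \<gamma> ?vel DJ t0 = curvature_map c (G (t0, 0), Gt (t0, 0)) (Gt (t0, 0)) (Gs (t0, 0)) (Gt (t0, 0))"
    using key(2) DJrep[OF t0 UV(3)] by (simp add: tc cov_along_def z0)
  also have "\<dots> = curvature_operator At A N a b \<gamma> J t0"
    using curvature_rep[OF c(1) _ velA[OF t0], of "?vel t0" "J t0" "?vel t0"] c(2)
    by (simp add: z0 tc curvature_operator_def Let_def)
  finally show "second_cov_along At N a b \<gamma> J t0 = curvature_operator At A N a b \<gamma> J t0"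
    by (simp add: second_cov_along_def Let_def DJ_def)
qed

end

section \<open>Comparison of two connections\<close>

locale conn_pair = N: aniso_conn At A N + N': aniso_conn At A N'
  for At :: "('m::{t2_space,second_countable_topology}, 'e::euclidean_space) chart set"
    and A :: "('m \<times> 'e) set" and N N' :: "('m, 'e) conn" +
  assumes torsion_free: "torsion_free At A N" and torsion_free': "torsion_free At A N'"
    and diff_vanishes: "\<And>v u. v \<in> A \<Longrightarrow> difference_tensor At N' N v (snd v) u = 0"
begin

definition diff_map :: "('m, 'e) chart \<Rightarrow> 'e \<times> 'e \<Rightarrow> 'e \<Rightarrow> 'e \<Rightarrow> 'e" where
  "diff_map c z a b = N'.gam c z a b - N.gam c z a b"

definition ddiff_map :: "('m, 'e) chart \<Rightarrow> 'e \<times> 'e \<Rightarrow> 'e \<Rightarrow> 'e \<Rightarrow> 'e \<times> 'e \<Rightarrow> 'e" where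
  "ddiff_map c z a b k = N'.dgam c z a b k - N.dgam c z a b k"

lemma difference_tensor_rep:
  assumes c: "c \<in> At" and z: "z \<in> N.coord_domain c"
  defines "p \<equiv> chart_inv c (fst z)"
  shows "to_chart At c p (difference_tensor At N' N (bundle_point At c z) a b) =
    diff_map c z (to_chart At c p a) (to_chart At c p b)"
proof -
  note d = N.coord_domainD[OF c z]
  let ?X = "field_through At p a" and ?Y = "field_through At p b"
  have p: "p \<in> fst c" "snd c p = fst z" using d by (simp_all add: p_def)
  have rep: "local_rep At c ?X (fst z) = to_chart At c p a" "local_rep At c ?Y (fst z) = to_chart At c p b"
    using N.local_rep_chart[OF c p(1)] by (simp_all add: p(2) N.field_through(2))
  show ?thesis
    using N.conn_rep[OF c z N.field_through(1) N.field_through(1), of p a p b]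
      N'.conn_rep[OF c z N.field_through(1) N.field_through(1), of p a p b]
    by (simp add: difference_tensor_def Let_def d(5) diff_map_def rep
        linear_diff[OF N.linear_to_chart[OF c p(1)]] flip: p_def)
qed

lemma diff_map_symmetric: "c \<in> At \<Longrightarrow> z \<in> N.coord_domain c \<Longrightarrow> diff_map c z a b = diff_map c z b a"
  by (simp add: diff_map_def N.gam_symmetric[OF torsion_free] N'.gam_symmetric[OF torsion_free'])

lemma diff_map_vanishes:
  assumes c: "c \<in> At" and z: "z \<in> N.coord_domain c"
  shows "diff_map c z (snd z) b = 0" "diff_map c z b (snd z) = 0"
proof -
  note d = N.coord_domainD[OF c z]
  show "diff_map c z (snd z) b = 0"
    using difference_tensor_rep[OF c z, of "snd (bundle_point At c z)" "from_chart At c (chart_inv c (fst z)) b"]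
      diff_vanishes[OF d(4)] c d(1)
    by (simp add: d(6) N.linear_to_chart linear_0)
  then show "diff_map c z b (snd z) = 0" by (simp add: diff_map_symmetric[OF c z])
qed

lemma linear_diff_map:
  assumes "c \<in> At" "z \<in> N.coord_domain c"
  shows "linear (\<lambda>a. diff_map c z a b)" "linear (diff_map c z a)"
proof -
  show "linear (\<lambda>a. diff_map c z a b)"
    unfolding diff_map_def by (intro linear_compose_sub N.linear_gam N'.linear_gam assms)
  have "linear (\<lambda>b. diff_map c z a b)"
    unfolding diff_map_def using linear_compose_sub[OF N'.linear_gam(2)[OF assms] N.linear_gam(2)[OF assms]] .
  then show "linear (diff_map c z a)" by simp
qed

text \<open>The relation \<open>diff_map c u (snd u) b = 0\<close> holds on an open set of the
  bundle, so it can be differentiated in every direction k, not just vertically. Base directions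
  give zero, and a horizontal lift contributes through its fibre component; the curvature comparison
  uses both.\<close>

lemma ddiff_map_eq:
  assumes c: "c \<in> At" and z: "z \<in> N.coord_domain c"
  shows "ddiff_map c z (snd z) b k = - diff_map c z (snd k) b"
    and "ddiff_map c z b (snd z) k = - diff_map c z (snd k) b"
proof -
  have "((\<lambda>u. diff_map c u a b) has_derivative ddiff_map c z a b) (at z)" for a b
    unfolding diff_map_def ddiff_map_def[abs_def]
    by (intro has_derivative_diff N.gam_has_derivative N'.gam_has_derivative c z)
  from has_derivative_bilinear_family[OF N.open_coord_domain[OF c] z linear_diff_map[OF c] this
      has_derivative_snd[OF has_derivative_ident] has_derivative_const[of b]]
  have "((\<lambda>u. diff_map c u (snd u) b) has_derivative
      (\<lambda>k. ddiff_map c z (snd z) b k + diff_map c z (snd k) b + diff_map c z (snd z) 0)) (at z)" .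
  then have "((\<lambda>u. 0) has_derivative
      (\<lambda>k. ddiff_map c z (snd z) b k + diff_map c z (snd k) b + diff_map c z (snd z) 0)) (at z)"
    by (rule has_derivative_transform_within_open[OF _ N.open_coord_domain[OF c] z])
      (simp add: diff_map_vanishes[OF c])
  from fun_cong[OF has_derivative_unique[OF has_derivative_const this], of k]
  have "ddiff_map c z (snd z) b k + diff_map c z (snd k) b + diff_map c z (snd z) 0 = 0"
    by (rule sym)
  then show *: "ddiff_map c z (snd z) b k = - diff_map c z (snd k) b"
    by (simp add: diff_map_vanishes[OF c z] eq_neg_iff_add_eq_0)
  have "ddiff_map c z b (snd z) k = ddiff_map c z (snd z) b k"
    by (simp add: ddiff_map_def N.dgam_symmetric[OF torsion_free c z, of b] N'.dgam_symmetric[OF torsion_free' c z, of b])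
  with * show "ddiff_map c z b (snd z) k = - diff_map c z (snd k) b" by simp
qed

lemma difference_tensor_chart_at:
  assumes v: "v \<in> A"
  defines "c \<equiv> chart_at At (fst v)"
  shows "difference_tensor At N' N v a b = diff_map c (snd c (fst v), snd v) a b"
    and "c \<in> At" and "(snd c (fst v), snd v) \<in> N.coord_domain c"
proof -
  show c: "c \<in> At" by (simp add: c_def N.chart_at)
  have p: "fst v \<in> fst c" by (simp add: c_def N.chart_at)
  have tc: "to_chart At c (fst v) x = x" for x by (simp add: c_def)
  show z: "(snd c (fst v), snd v) \<in> N.coord_domain c"
    using N.coords_in_domain[OF c p v] by (simp add: tc)
  show "difference_tensor At N' N v a b = diff_map c (snd c (fst v), snd v) a b"
    using difference_tensor_rep[OF c z, of a b] N.bundle_point_coords[OF c p] c p by (simp add: tc)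
qed

text \<open>\<open>field_through\<close> is selected from the base point, which a vertical shift
  leaves unchanged; hence the same two fields serve for all t and the derivative is the difference
  of two derivatives along fixed fields.\<close>

lemma vert_deriv2_difference_tensor:
  assumes v: "v \<in> A"
  defines "c \<equiv> chart_at At (fst v)"
  shows "vert_deriv2 (difference_tensor At N' N) v a b w = ddiff_map c (snd c (fst v), snd v) a b (0, w)"
proof -
  let ?X = "field_through At (fst v) a" and ?Y = "field_through At (fst v) b"
  have "((\<lambda>t. N' (vshift v t w) ?X ?Y - N (vshift v t w) ?X ?Y) has_vector_derivative
      ddiff_map c (snd c (fst v), snd v) a b (0, w)) (at 0)"
    unfolding ddiff_map_def
    using has_vector_derivative_diff[OF
        N'.conn_vert_has_derivative[OF v N.field_through(1) N.field_through(1), of w "fst v" a "fst v" b]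
        N.conn_vert_has_derivative[OF v N.field_through(1) N.field_through(1), of w "fst v" a "fst v" b]]
    by (simp add: N.field_through(2) c_def)
  from vector_derivative_at[OF this] show ?thesis
    by (simp add: vert_deriv2_def difference_tensor_def vshift_def Let_def)
qed

lemma vert_deriv2_difference_tensor_canonical:
  assumes v: "v \<in> A"
  shows "vert_deriv2 (difference_tensor At N' N) v (snd v) u w = - difference_tensor At N' N v w u"
  using vert_deriv2_difference_tensor[OF v, of "snd v" u w] difference_tensor_chart_at[OF v]
    ddiff_map_eq(1)[OF difference_tensor_chart_at(2,3)[OF v], of u "(0, w)"]
  by simp

lemma conn_vert_deriv_vanishes:
  assumes P: "\<And>v u. v \<in> A \<Longrightarrow> conn_vert_deriv At N v (snd v) (snd v) u = 0" and v: "v \<in> A"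
  shows "conn_vert_deriv At N' v (snd v) (snd v) u = 0"
proof -
  note d = difference_tensor_chart_at(2,3)[OF v]
  show ?thesis
    using P[OF v, of u] ddiff_map_eq(1)[OF d, of "snd v" "(0, u)"] diff_map_vanishes(2)[OF d, of u]
    by (simp add: N.conn_vert_deriv_rep[OF v] N'.conn_vert_deriv_rep[OF v] ddiff_map_def)
qed

lemma curvature_canonical_eq:
  assumes v: "v \<in> A"
  shows "curvature At A N' v (snd v) u (snd v) = curvature At A N v (snd v) u (snd v)"
proof -
  define c where "c = chart_at At (fst v)"
  define z where "z = (snd c (fst v), snd v)"
  have c: "c \<in> At" and z: "z \<in> N.coord_domain c" and p: "fst v \<in> fst c"
    using difference_tensor_chart_at(2,3)[OF v] by (simp_all add: c_def z_def N.chart_at)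
  have tc: "to_chart At c (fst v) x = x" for x by (simp add: c_def)
  let ?y = "snd z"
  have g: "N'.gam c z a b = N.gam c z a b + diff_map c z a b" for a b by (simp add: diff_map_def)
  have dg: "N'.dgam c z a b k = N.dgam c z a b k + ddiff_map c z a b k" for a b k by (simp add: ddiff_map_def)
  note q0 = diff_map_vanishes[OF c z]
  \<comment> \<open>With y the fibre coordinate, Q vanishes as soon as one argument is y. The
    derivative term in direction (y, -Gamma(y,y)) contributes Q(Gamma(y,y),u) and the one in
    direction u contributes -Q(.,y) = 0, so only -Q(u,Gamma(y,y)) is left to cancel the
    former.\<close>
  have "N'.curvature_map c z ?y u ?y = N.curvature_map c z ?y u ?y"
    unfolding N'.curvature_map_def N.curvature_map_def dg ddiff_map_eq[OF c z] g q0 snd_conv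
    by (simp add: q0 linear_neg[OF linear_diff_map(2)[OF c z]] diff_map_symmetric[OF c z, of _ u])
  then show ?thesis
    using N.curvature_rep[OF c p v, of "snd v" u "snd v"] N'.curvature_rep[OF c p v, of "snd v" u "snd v"]
    by (simp add: tc z_def)
qed

lemma cov_along_velocity_eq:
  assumes A: "(\<gamma> t, velocity At S \<gamma> t) \<in> A"
  shows "cov_along At N' S \<gamma> (velocity At S \<gamma>) X t = cov_along At N S \<gamma> (velocity At S \<gamma>) X t"
proof -
  let ?c = "chart_at At (\<gamma> t)" and ?v = "velocity At S \<gamma> t"
  have vel: "vector_derivative (\<lambda>\<tau>. snd ?c (\<gamma> \<tau>)) (at t within S) = ?v" by (simp add: velocity_def)
  have "diff_map ?c (snd ?c (\<gamma> t), ?v) ?v (X t) = 0"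
    using diff_map_vanishes(1)[OF difference_tensor_chart_at(2,3)[OF A], of "X t"] by simp
  then have "N'.gam ?c (snd ?c (\<gamma> t), ?v) ?v (X t) = N.gam ?c (snd ?c (\<gamma> t), ?v) ?v (X t)"
    by (simp add: diff_map_def)
  then show ?thesis
    unfolding cov_along_def using A
    by (simp add: N.cov_along_at_chart_at N'.cov_along_at_chart_at vel)
qed

text \<open>The inner derivatives agree on [a,b], which is enough because the outer derivative is
  taken within that interval.\<close>

lemma second_cov_along_eq:
  assumes A: "\<And>t. t \<in> {a..b} \<Longrightarrow> (\<gamma> t, velocity At {a..b} \<gamma> t) \<in> A" and t: "t \<in> {a..b}"
  shows "second_cov_along At N' a b \<gamma> J t = second_cov_along At N a b \<gamma> J t"
proof -
  let ?D = "cov_along At N {a..b} \<gamma> (velocity At {a..b} \<gamma>)"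
    and ?D' = "cov_along At N' {a..b} \<gamma> (velocity At {a..b} \<gamma>)"
  have eq: "?D' X t = ?D X t" if "t \<in> {a..b}" for X t by (rule cov_along_velocity_eq[OF A[OF that]])
  have "?D (?D' J) t = ?D (?D J) t"
    using vector_derivative_cong_on[OF t, of "\<lambda>\<tau>. to_chart At (chart_at At (\<gamma> t)) (\<gamma> \<tau>) (?D' J \<tau>)"
        "\<lambda>\<tau>. to_chart At (chart_at At (\<gamma> t)) (\<gamma> \<tau>) (?D J \<tau>)"] eq[OF t, of J]
    unfolding cov_along_def by (simp add: N.cov_along_at_chart_at A[OF t] eq[unfolded cov_along_def])
  then show ?thesis by (simp add: second_cov_along_def Let_def eq[OF t])
qed

end

theorem proposition2p18:
  fixes At :: "('m::{t2_space,second_countable_topology}, 'e::euclidean_space) chart set"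
    and A :: "('m \<times> 'e) set"
    and N N' :: "('m, 'e) conn"
  assumes "smooth_atlas At"
    and "aniso_domain At A"
    and "aniso_connection At A N" and "torsion_free At A N"
    and "\<And>v u. v \<in> A \<Longrightarrow> conn_vert_deriv At N v (snd v) (snd v) u = 0"
    and "aniso_connection At A N'" and "torsion_free At A N'"
    and "\<And>v u. v \<in> A \<Longrightarrow> difference_tensor At N' N v (snd v) u = 0"
  shows
    "(\<forall>v\<in>A. \<forall>u w. vert_deriv2 (difference_tensor At N' N) v (snd v) u w
                    = - difference_tensor At N' N v w u) \<and>
     (\<forall>v\<in>A. \<forall>u. conn_vert_deriv At N' v (snd v) (snd v) u = 0) \<and>
     (\<forall>a b \<gamma>. autoparallel At A N a b \<gamma> \<or> autoparallel At A N' a b \<gamma> \<longrightarrow>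
        (\<forall>U. field_along At {a..b} \<gamma> U \<longrightarrow>
           (\<forall>t\<in>{a..b}. curvature_operator At A N' a b \<gamma> U t = curvature_operator At A N a b \<gamma> U t)) \<and>
        (\<forall>J. field_along At {a..b} \<gamma> J \<longrightarrow>
           (\<forall>t\<in>{a..b}. second_cov_along At N' a b \<gamma> J t = second_cov_along At N a b \<gamma> J t) \<and>
           (jacobi_equation At A N' a b \<gamma> J \<longleftrightarrow> jacobi_equation At A N a b \<gamma> J)) \<and>
        (\<forall>J. jacobi_field At A N' a b \<gamma> J \<longrightarrow> jacobi_equation At A N' a b \<gamma> J) \<and>
        (\<forall>J. jacobi_field At A N a b \<gamma> J \<longrightarrow> jacobi_equation At A N a b \<gamma> J))"
proof -
  interpret conn_pair At A N N'
    using assms by unfold_locales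
  \<comment> \<open>The second claim provides for N' the condition on the vertical derivative under
    which Jacobi fields were shown to solve the Jacobi equation.\<close>
  have P': "conn_vert_deriv At N' v (snd v) (snd v) u = 0" if "v \<in> A" for v u
    by (rule conn_vert_deriv_vanishes[OF assms(5) that])
  \<comment> \<open>Either alternative places the velocity in \<open>A\<close>, which is what the
    pointwise comparison of the two connections takes from the curve.\<close>
  have velA: "(\<gamma> t, velocity At {a..b} \<gamma> t) \<in> A"
    if "autoparallel At A N a b \<gamma> \<or> autoparallel At A N' a b \<gamma>" "t \<in> {a..b}" for a b \<gamma> t
    using that unfolding autoparallel_def by auto
  have curv: "curvature_operator At A N' a b \<gamma> U t = curvature_operator At A N a b \<gamma> U t"
    if "autoparallel At A N a b \<gamma> \<or> autoparallel At A N' a b \<gamma>" "t \<in> {a..b}" for a b \<gamma> U t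
    using curvature_canonical_eq[OF velA[OF that], of "U t"] by (simp add: curvature_operator_def Let_def)
  have cov: "second_cov_along At N' a b \<gamma> J t = second_cov_along At N a b \<gamma> J t"
    if "autoparallel At A N a b \<gamma> \<or> autoparallel At A N' a b \<gamma>" "t \<in> {a..b}" for a b \<gamma> J t
    by (rule second_cov_along_eq[OF velA[OF that(1)] that(2)])
  have jac: "jacobi_equation At A N' a b \<gamma> J \<longleftrightarrow> jacobi_equation At A N a b \<gamma> J"
    if "autoparallel At A N a b \<gamma> \<or> autoparallel At A N' a b \<gamma>" for a b \<gamma> J
    unfolding jacobi_equation_def using curv[OF that] cov[OF that] by auto
  show ?thesis
    by (intro conjI ballI allI impI)
      (assumption | rule vert_deriv2_difference_tensor_canonical P' curv cov jac
        N'.jacobi_field_imp_equation[OF assms(7) P'] N.jacobi_field_imp_equation[OF assms(4,5)])+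
qed

end
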